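(* Let $\Pi$ be a compact right-angled (convex) polyhedron in $\mathbb{H}^3$ with $k\ge 18$ faces, and let $\Gamma$ be the Cayley graph of the reflection group of $\Pi$ with respect to its standard generating set. Then $$p_{\mathrm c}(\Gamma)<p_{\mathrm u}(\Gamma)$$ both for Bernoulli bond percolation and for Bernoulli site percolation on $\Gamma$.
   Context: Polyhedra. Half-spaces are closed. A convex polyhedron in $\mathbb{H}^3$ is an intersection of finitely many half-spaces in $\mathbb{H}^3$ with non-empty interior. The intersection of the polyhedron with a supporting plane is called a face, an edge or a vertex if it is $2$-, $1$- or $0$-dimensional, respectively. It is right-angled if the dihedral angle at each of its edges equals $\pi/2$. The reflection group $G$ of $\Pi$ is the group of isometries of $\mathbb{H}^3$ generated by the set $S$ of the hyperbolic reflections in the planes of the faces of $\Pi$; $S$ is the standard generating set. The Cayley graph $\Gamma$ of $(G,S)$ is the undirected simple graph with vertex set $G$ in which $v,w$ are joined by an edge iff $v=ws$ for some $s\in S$. Percolation. For $p\in[0,1]$, $p$-Bernoulli bond (resp. site) percolation on a graph is the random subgraph $\omega$ obtained by keeping each edge (resp. vertex) independently with probability $p$; in the bond case $\omega$ has all vertices and the kept edges, in the site case $\omega$ is the subgraph induced by the kept vertices. $\mathrm{P}_p$ is the corresponding probability measure. Clusters are the connected components of $\omega$. Define, for bond and for site percolation respectively, $p_{\mathrm c}(\Gamma)=\inf\{p\in[0,1]:\mathrm{P}_p(\omega\text{ has some infinite cluster})>0\}$ and $p_{\mathrm u}(\Gamma)=\inf\{p\in[0,1]:\mathrm{P}_p\text{-a.s.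 there is a unique infinite cluster in }\omega\}$. *)

theory Defs
  imports
    "HOL-Probability.Probability"
    "HOL-Algebra.Bij"
    "HOL-Algebra.Generated_Groups"
begin

section \<open>Hyperbolic 3-space (hyperboloid model)\<close>

type_synonym minkowski = "(real ^ 3) \<times> real"

definition lorentz :: "minkowski \<Rightarrow> minkowski \<Rightarrow> real" where
  "lorentz x y = fst x \<bullet> fst y - snd x * snd y"

definition H3 :: "minkowski set" where
  "H3 = {x. lorentz x x = -1 \<and> snd x > 0}"

definition hdist :: "minkowski \<Rightarrow> minkowski \<Rightarrow> real" where
  "hdist x y = arcosh (- lorentz x y)"

text \<open>
  Every plane of hyperbolic space is \<open>hplane u\<close> for a vector \<open>u\<close> with \<open>lorentz u u = 1\<close>, unique
  up to sign, and the closed half-spaces bounded by it are \<open>hhalfspace u\<close> and \<open>hhalfspace (- u)\<close>.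
  The vector \<open>u\<close> is the unit normal pointing out of \<open>hhalfspace u\<close>.
\<close>

definition hplane :: "minkowski \<Rightarrow> minkowski set" where
  "hplane u = {x \<in> H3. lorentz x u = 0}"

definition hhalfspace :: "minkowski \<Rightarrow> minkowski set" where
  "hhalfspace u = {x \<in> H3. lorentz x u \<le> 0}"

text \<open>
  The smallest hyperbolic subspace containing a non-empty \<open>A \<subseteq> H3\<close> is \<open>span A \<inter> H3\<close>, whose
  hyperbolic dimension is one less than the linear dimension of \<open>span A\<close>.
\<close>

definition hdim :: "minkowski set \<Rightarrow> int" where
  "hdim A = int (dim A) - 1"

definition hreflection :: "minkowski \<Rightarrow> minkowski \<Rightarrow> minkowski" where
  "hreflection u = (\<lambda>x\<in>H3. x - (2 * lorentz x u) *\<^sub>R u)"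

definition H3_isometries :: "(minkowski \<Rightarrow> minkowski) monoid" where
  "H3_isometries = (BijGroup H3)
     \<lparr>carrier := {f \<in> Bij H3. \<forall>x\<in>H3. \<forall>y\<in>H3. hdist (f x) (f y) = hdist x y}\<rparr>"


section \<open>Convex polyhedra\<close>

definition convex_polyhedron :: "minkowski set \<Rightarrow> bool" where
  "convex_polyhedron P \<longleftrightarrow>
     (\<exists>U. finite U \<and> (\<forall>u\<in>U. lorentz u u = 1) \<and> P = H3 \<inter> (\<Inter>u\<in>U. hhalfspace u)) \<and>
     (top_of_set H3) interior_of P \<noteq> {}"

text \<open>
  A supporting plane meets \<open>P\<close> and has \<open>P\<close> on one side. It is represented by its unit normal
  pointing away from \<open>P\<close>.
\<close>

definition supporting :: "minkowski set \<Rightarrow> minkowski \<Rightarrow> bool" where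
  "supporting P u \<longleftrightarrow> lorentz u u = 1 \<and> P \<subseteq> hhalfspace u \<and> P \<inter> hplane u \<noteq> {}"

definition face_normals :: "minkowski set \<Rightarrow> minkowski set" where
  "face_normals P = {u. supporting P u \<and> hdim (P \<inter> hplane u) = 2}"

definition faces :: "minkowski set \<Rightarrow> minkowski set set" where
  "faces P = {P \<inter> hplane u | u. u \<in> face_normals P}"

definition edges :: "minkowski set \<Rightarrow> minkowski set set" where
  "edges P = {P \<inter> hplane u | u. supporting P u \<and> hdim (P \<inter> hplane u) = 1}"

text \<open>
  Interior dihedral angle, between intersecting boundary planes, of the wedge
  \<open>hhalfspace u \<inter> hhalfspace v\<close>: it is \<open>pi\<close> minus the angle between the outward unit normals.
\<close>

definition dihedral_angle :: "minkowski \<Rightarrow> minkowski \<Rightarrow> real" where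
  "dihedral_angle u v = pi - arccos (lorentz u v)"

definition right_angled :: "minkowski set \<Rightarrow> bool" where
  "right_angled P \<longleftrightarrow>
     (\<forall>e\<in>edges P. \<forall>u\<in>face_normals P. \<forall>v\<in>face_normals P.
        u \<noteq> v \<and> e \<subseteq> P \<inter> hplane u \<and> e \<subseteq> P \<inter> hplane v \<longrightarrow> dihedral_angle u v = pi / 2)"

definition face_reflections :: "minkowski set \<Rightarrow> (minkowski \<Rightarrow> minkowski) set" where
  "face_reflections P = hreflection ` face_normals P"

definition reflection_group :: "minkowski set \<Rightarrow> (minkowski \<Rightarrow> minkowski) monoid" where
  "reflection_group P =
     H3_isometries\<lparr>carrier := generate H3_isometries (face_reflections P)\<rparr>"


section \<open>Graphs\<close>

text \<open>A pair of the vertex set and the set of edges, an edge being a two-element vertex set.\<close>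

type_synonym 'a ugraph = "'a set \<times> 'a set set"

definition cayley_graph :: "('a, 'b) monoid_scheme \<Rightarrow> 'a set \<Rightarrow> 'a ugraph" where
  "cayley_graph G S =
     (carrier G,
      {{v, w} | v w. v \<in> carrier G \<and> w \<in> carrier G \<and> v \<noteq> w \<and> (\<exists>s\<in>S. v = w \<otimes>\<^bsub>G\<^esub> s)})"

definition clusters :: "'a ugraph \<Rightarrow> 'a set set" where
  "clusters g = {{w. (v, w) \<in> {(x, y). {x, y} \<in> snd g}\<^sup>*} | v. v \<in> fst g}"

definition infinite_clusters :: "'a ugraph \<Rightarrow> 'a set set" where
  "infinite_clusters g = {C \<in> clusters g. infinite C}"


section \<open>Bernoulli percolation\<close>

definition bernoulli_measure :: "'i set \<Rightarrow> real \<Rightarrow> ('i \<Rightarrow> bool) measure" where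
  "bernoulli_measure I p = (\<Pi>\<^sub>M i\<in>I. measure_pmf (bernoulli_pmf p))"

definition bond_subgraph :: "'a ugraph \<Rightarrow> ('a set \<Rightarrow> bool) \<Rightarrow> 'a ugraph" where
  "bond_subgraph g \<omega> = (fst g, {e \<in> snd g. \<omega> e})"

definition site_subgraph :: "'a ugraph \<Rightarrow> ('a \<Rightarrow> bool) \<Rightarrow> 'a ugraph" where
  "site_subgraph g \<omega> = ({v \<in> fst g. \<omega> v}, {e \<in> snd g. \<forall>v\<in>e. \<omega> v})"

definition pc_bond :: "'a ugraph \<Rightarrow> real" where
  "pc_bond g = Inf {p \<in> {0..1}.
     \<P>(\<omega> in bernoulli_measure (snd g) p. infinite_clusters (bond_subgraph g \<omega>) \<noteq> {}) > 0}"

definition pu_bond :: "'a ugraph \<Rightarrow> real" where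
  "pu_bond g = Inf {p \<in> {0..1}.
     AE \<omega> in bernoulli_measure (snd g) p. \<exists>!C. C \<in> infinite_clusters (bond_subgraph g \<omega>)}"

definition pc_site :: "'a ugraph \<Rightarrow> real" where
  "pc_site g = Inf {p \<in> {0..1}.
     \<P>(\<omega> in bernoulli_measure (fst g) p. infinite_clusters (site_subgraph g \<omega>) \<noteq> {}) > 0}"

definition pu_site :: "'a ugraph \<Rightarrow> real" where
  "pu_site g = Inf {p \<in> {0..1}.
     AE \<omega> in bernoulli_measure (fst g) p. \<exists>!C. C \<in> infinite_clusters (site_subgraph g \<omega>)}"

end

theory Submission
  imports Defs
begin

text \<open>
  Let \<open>k\<close> be the number of faces. Two estimates for the Cayley graph are compared:
  \<open>p\<^sub>c \<le> 4 / (3 k)\<close> from growth and \<open>1 / (2 * sqrt (3 * (k - 3))) \<le> p\<^sub>u\<close> from the spectral radius;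
  the first bound is smaller than the second exactly when \<open>k\<close> is at least 18 (for \<open>k \<ge> 4\<close>).

  Each right angle lets projections onto face planes preserve the polyhedron, so two outward
  normals are either orthogonal (the faces share an edge) or have Lorentz product at most \<open>-1\<close>.
  Tits' argument then shows that the generators shortening a group element \<open>g\<close> are the
  reflections in the face planes separating the polyhedron from the translate by the inverse
  of \<open>g\<close> of a base point. These are pairwise orthogonal, hence at most three. The weight
  \<open>((k - 3) / 3) powr (- len g / 2)\<close> therefore bounds the number of closed walks of length \<open>n\<close>
  by \<open>(2 * sqrt (3 * (k - 3))) ^ n\<close>, connection probabilities decay below the inverse of this base,
  and a unique infinite cluster is impossible there.

  Inclusion and exclusion over the shortening generators gives a recursion for the sizes of the
  spheres whose coefficients are the numbers of faces, edges and vertices. With \<open>3 V = 2 E\<close>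
  and \<open>V \<le> 2 k - 4\<close> it yields that consecutive spheres grow by a factor of at least \<open>3 k / 4\<close>,
  and the second moment method on a geodesic spanning tree produces infinite clusters.
\<close>

section \<open>Words, walks and growth\<close>

text \<open>Only the Gram matrix of the face normals is used: neither a tessellation by copies of
  the polyhedron nor a Coxeter presentation is established, the signs of \<open>y g u\<close> serve
  instead. The tree argument compares subtrees with whole spheres, so the ratio bound is needed for
  every pair of consecutive spheres; an exponential growth rate would not do. Hence an induction
  along the recursion. Its constant 3/4 has to reproduce itself: if earlier ratios are at least 3 k
  / 4, the correction terms stay below 4 k - 13 per element two levels down, and k / 4 * (3 k / 4)
  must exceed this. At k = 18 that is 59 against 60.75.

  Compactness enters at one place: an edge must not run off to infinity, so that it has two ends.
  The bound on V is obtained without Euler's formula, from a height function that is affine in the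
  Klein model. One second moment inequality serves both thresholds: it produces infinite clusters,
  and it shows that far apart vertices cannot be almost disjointly in the same cluster.\<close>

locale involution_generated_group = group G for G :: "'g monoid" (structure) +
  fixes N :: "'n set" and r :: "'n \<Rightarrow> 'g"
  assumes finite_gens: "finite N"
    and r_closed: "u \<in> N \<Longrightarrow> r u \<in> carrier G"
    and r_sq: "u \<in> N \<Longrightarrow> r u \<otimes> r u = \<one>"
    and words_exhaust: "g \<in> carrier G \<Longrightarrow> \<exists>ws. set ws \<subseteq> N \<and> g = foldr (\<lambda>u h. r u \<otimes> h) ws \<one>"
begin

definition ev :: "'n list \<Rightarrow> 'g" where
  "ev ws = foldr (\<lambda>u h. r u \<otimes> h) ws \<one>"

definition len :: "'g \<Rightarrow> nat" where
  "len g = (LEAST n. \<exists>ws. set ws \<subseteq> N \<and> length ws = n \<and> g = ev ws)"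

definition sphere :: "nat \<Rightarrow> 'g set" where
  "sphere n = {g \<in> carrier G. len g = n}"

definition walks :: "nat \<Rightarrow> 'g \<Rightarrow> nat" where
  "walks n g = card {ws. set ws \<subseteq> N \<and> length ws = n \<and> ev ws = g}"

lemma ev_Nil [simp]: "ev [] = \<one>"
  and ev_Cons [simp]: "ev (u # ws) = r u \<otimes> ev ws"
  by (simp_all add: ev_def)

lemma ev_closed [simp]: "set ws \<subseteq> N \<Longrightarrow> ev ws \<in> carrier G"
  by (induction ws) (auto simp: r_closed)

lemma ev_append: "set ws \<subseteq> N \<Longrightarrow> set vs \<subseteq> N \<Longrightarrow> ev (ws @ vs) = ev ws \<otimes> ev vs"
  by (induction ws) (auto simp: r_closed m_assoc)

lemma r_inv: "u \<in> N \<Longrightarrow> inv (r u) = r u"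
  by (simp add: inv_equality r_closed r_sq)

lemma mult_r_r [simp]: "g \<in> carrier G \<Longrightarrow> u \<in> N \<Longrightarrow> g \<otimes> r u \<otimes> r u = g"
  by (simp add: m_assoc r_closed r_sq)

lemma ev_rev: "set ws \<subseteq> N \<Longrightarrow> ev (rev ws) = inv (ev ws)"
  by (induction ws) (auto simp: ev_append r_closed inv_mult_group r_inv)

lemma len_le: "set ws \<subseteq> N \<Longrightarrow> len (ev ws) \<le> length ws"
  unfolding len_def by (rule Least_le) blast

lemma obtain_reduced:
  assumes "g \<in> carrier G"
  obtains ws where "set ws \<subseteq> N" "length ws = len g" "g = ev ws"
proof -
  have "\<exists>n ws. set ws \<subseteq> N \<and> length ws = n \<and> g = ev ws"
    using words_exhaust[OF assms] by (auto simp: ev_def)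
  then have "\<exists>ws. set ws \<subseteq> N \<and> length ws = len g \<and> g = ev ws"
    unfolding len_def by (rule LeastI_ex)
  then show ?thesis using that by blast
qed

lemma len_one [simp]: "len \<one> = 0"
  using len_le[of "[]"] by simp

lemma len_eq_0: "g \<in> carrier G \<Longrightarrow> len g = 0 \<Longrightarrow> g = \<one>"
  by (metis ev_Nil length_0_conv obtain_reduced)

lemma len_mult_le:
  assumes "g \<in> carrier G" "h \<in> carrier G"
  shows "len (g \<otimes> h) \<le> len g + len h"
proof -
  obtain ws vs where "set ws \<subseteq> N" "length ws = len g" "g = ev ws"
    "set vs \<subseteq> N" "length vs = len h" "h = ev vs"
    using assms obtain_reduced by metis
  then show ?thesis
    using len_le[of "ws @ vs"] by (simp add: ev_append)
qed

lemma len_inv: assumes "g \<in> carrier G" shows "len (inv g) = len g"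
proof -
  have le: "len (inv h) \<le> len h" if "h \<in> carrier G" for h
    using that by (metis ev_rev len_le length_rev obtain_reduced set_rev)
  show ?thesis using le[OF assms] le[of "inv g"] assms by simp
qed

lemma len_r_le: "u \<in> N \<Longrightarrow> len (r u) \<le> 1"
  using len_le[of "[u]"] by (simp add: r_closed)

lemma len_mult_r_le: "g \<in> carrier G \<Longrightarrow> u \<in> N \<Longrightarrow> len (g \<otimes> r u) \<le> len g + 1"
  using len_mult_le[of g "r u"] len_r_le[of u] r_closed by fastforce

lemma len_le_mult_r: "g \<in> carrier G \<Longrightarrow> u \<in> N \<Longrightarrow> len g \<le> len (g \<otimes> r u) + 1"
  using len_mult_r_le[of "g \<otimes> r u" u] r_closed by simp

lemma exists_shortening:
  assumes "g \<in> carrier G" "g \<noteq> \<one>"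
  obtains u where "u \<in> N" "len (g \<otimes> r u) + 1 = len g"
proof -
  obtain ws where ws: "set ws \<subseteq> N" "length ws = len g" "g = ev ws"
    using assms obtain_reduced by metis
  with assms obtain vs u where vs: "ws = vs @ [u]" by (cases ws rule: rev_exhaust) auto
  with ws have "g = ev vs \<otimes> r u" by (simp add: ev_append r_closed)
  moreover have vsu: "set vs \<subseteq> N" "u \<in> N" using ws(1) vs by auto
  ultimately have "g \<otimes> r u = ev vs" using mult_r_r[of "ev vs" u] by simp
  then have "len (g \<otimes> r u) \<le> length vs" using vsu(1) len_le by simp
  moreover have "len g = length vs + 1" using ws(2) vs by simp
  ultimately have "len (g \<otimes> r u) + 1 = len g"
    using len_le_mult_r[OF assms(1) vsu(2)] by linarith
  with that vsu show ?thesis by blast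
qed

lemma finite_words: "finite {ws. set ws \<subseteq> N \<and> length ws = n}"
  using finite_lists_length_eq[OF finite_gens] .

lemma finite_sphere [simp]: "finite (sphere n)"
proof (rule finite_subset[OF _ finite_imageI[OF finite_words[of n]]])
  show "sphere n \<subseteq> ev ` {ws. set ws \<subseteq> N \<and> length ws = n}"
  proof
    fix g assume "g \<in> sphere n"
    then have g: "g \<in> carrier G" "len g = n" by (auto simp: sphere_def)
    from obtain_reduced[OF g(1)] show "g \<in> ev ` {ws. set ws \<subseteq> N \<and> length ws = n}"
      using g(2) by blast
  qed
qed

lemma sphere_0: "sphere 0 = {\<one>}"
  by (auto simp: sphere_def len_eq_0)

lemma countable_carrier: "countable (carrier G)"
proof -
  have "carrier G = (\<Union>n. sphere n)" by (auto simp: sphere_def)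
  then show ?thesis by (simp add: countable_finite)
qed

lemma walks_inv: assumes "g \<in> carrier G" shows "walks n (inv g) = walks n g"
  unfolding walks_def
proof (rule bij_betw_same_card[of rev], rule bij_betwI[where g = rev])
  show "rev \<in> {ws. set ws \<subseteq> N \<and> length ws = n \<and> ev ws = inv g}
      \<rightarrow> {ws. set ws \<subseteq> N \<and> length ws = n \<and> ev ws = g}"
    "rev \<in> {ws. set ws \<subseteq> N \<and> length ws = n \<and> ev ws = g}
      \<rightarrow> {ws. set ws \<subseteq> N \<and> length ws = n \<and> ev ws = inv g}"
    using assms by (auto simp: ev_rev)
qed auto

lemma walks_add:
  assumes x: "x \<in> carrier G"
  shows "walks (m + n) x
    = (\<Sum>y\<in>ev ` {ws. set ws \<subseteq> N \<and> length ws = m}. walks m y * walks n (inv y \<otimes> x))"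
    (is "_ = (\<Sum>y\<in>?Y. _)")
proof -
  let ?A = "\<lambda>y. {ws. set ws \<subseteq> N \<and> length ws = m \<and> ev ws = y}"
  let ?B = "\<lambda>y. {ws. set ws \<subseteq> N \<and> length ws = n \<and> ev ws = inv y \<otimes> x}"
  have finA: "finite (?A y)" and finB: "finite (?B y)" for y
    using finite_words[of m] finite_words[of n] by (auto elim: rev_finite_subset)
  have "{ws. set ws \<subseteq> N \<and> length ws = m + n \<and> ev ws = x}
      = (\<lambda>(a, b). a @ b) ` (\<Union>y\<in>?Y. ?A y \<times> ?B y)" (is "?L = ?R")
  proof
    show "?L \<subseteq> ?R"
    proof
      fix ws assume "ws \<in> ?L"
      then have ws: "set ws \<subseteq> N" "length ws = m + n" "ev ws = x" by auto
      let ?a = "take m ws" and ?b = "drop m ws"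
      have s: "set ?a \<subseteq> N" "set ?b \<subseteq> N"
        using ws set_take_subset[of m ws] set_drop_subset[of m ws] by auto
      then have "x = ev ?a \<otimes> ev ?b" using ws ev_append[OF s] by simp
      then have "ev ?b = inv (ev ?a) \<otimes> x" using s by (simp add: m_assoc[symmetric])
      then have "(?a, ?b) \<in> (\<Union>y\<in>?Y. ?A y \<times> ?B y)"
        using s ws by auto
      then show "ws \<in> ?R"
        by (rule rev_image_eqI) simp
    qed
    show "?R \<subseteq> ?L"
      using x by (auto simp: ev_append m_assoc[symmetric])
  qed
  moreover have "inj_on (\<lambda>(a, b). a @ b) (\<Union>y\<in>?Y. ?A y \<times> ?B y)"
    by (auto simp: inj_on_def)
  ultimately have "walks (m + n) x = card (\<Union>y\<in>?Y. ?A y \<times> ?B y)"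
    by (simp add: walks_def card_image)
  also have "\<dots> = (\<Sum>y\<in>?Y. card (?A y \<times> ?B y))"
    by (rule card_UN_disjoint) (use finA finB finite_words in auto)
  finally show ?thesis by (simp add: walks_def card_cartesian_product)
qed

lemma walks_zero: "x \<notin> ev ` {ws. set ws \<subseteq> N \<and> length ws = n} \<Longrightarrow> walks n x = 0"
  unfolding walks_def by (rule card_eq_0_iff[THEN iffD2]) auto

text \<open>Cut each walk at its midpoint and use 2ab \<le> a^2 + b^2. By \<open>walks_inv\<close>
  the squares of \<open>walks n\<close> over all midpoints add up to the number of closed walks; the
  translated midpoints give no more, since \<open>walks n\<close> vanishes outside
  \<open>?Y\<close>.\<close>

lemma walks_even_le: 
  assumes x: "x \<in> carrier G"
  shows "walks (n + n) x \<le> walks (n + n) \<one>"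
proof -
  let ?Y = "ev ` {ws. set ws \<subseteq> N \<and> length ws = n}"
  have finY: "finite ?Y" using finite_words by simp
  have Yc: "?Y \<subseteq> carrier G" by auto
  have "2 * walks (n + n) x = (\<Sum>y\<in>?Y. 2 * (walks n y * walks n (inv y \<otimes> x)))"
    by (simp add: walks_add[OF x] sum_distrib_left)
  also have "\<dots> \<le> (\<Sum>y\<in>?Y. walks n y ^ 2 + walks n (inv y \<otimes> x) ^ 2)"
  proof (rule sum_mono)
    fix y
    have "2 * (a * b) \<le> a ^ 2 + b ^ 2" for a b :: nat
    proof -
      have "real (2 * (a * b)) \<le> real (a ^ 2 + b ^ 2)"
        using sum_squares_bound[of "real a" "real b"] by (simp add: mult.assoc)
      then show ?thesis by (simp only: of_nat_le_iff)
    qed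
    then show "2 * (walks n y * walks n (inv y \<otimes> x)) \<le> walks n y ^ 2 + walks n (inv y \<otimes> x) ^ 2" .
  qed
  also have "\<dots> = (\<Sum>y\<in>?Y. walks n y ^ 2) + (\<Sum>y\<in>?Y. walks n (inv y \<otimes> x) ^ 2)"
    by (rule sum.distrib)
  also have "(\<Sum>y\<in>?Y. walks n (inv y \<otimes> x) ^ 2) = (\<Sum>z\<in>(\<lambda>y. inv y \<otimes> x) ` ?Y. walks n z ^ 2)"
  proof -
    have "inj_on (\<lambda>y. inv y \<otimes> x) ?Y"
    proof (rule inj_onI)
      fix y z assume "y \<in> ?Y" "z \<in> ?Y" and eq: "inv y \<otimes> x = inv z \<otimes> x"
      then have yz: "y \<in> carrier G" "z \<in> carrier G" using Yc by blast+
      with eq x have "inv y = inv z" by simp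
      with yz show "y = z" by (metis inv_inv)
    qed
    from sum.reindex[OF this, of "\<lambda>z. walks n z ^ 2"] show ?thesis unfolding o_def by (rule sym)
  qed
  also have "\<dots> \<le> (\<Sum>z\<in>(\<lambda>y. inv y \<otimes> x) ` ?Y \<union> ?Y. walks n z ^ 2)"
    using finY by (intro sum_mono2) auto
  also have "\<dots> = (\<Sum>z\<in>?Y. walks n z ^ 2)"
    using finY by (intro sum.mono_neutral_right) (auto simp: walks_zero)
  also have "(\<Sum>z\<in>?Y. walks n z ^ 2) = walks (n + n) \<one>"
    unfolding walks_add[OF one_closed] power2_eq_square
    using Yc by (intro sum.cong) (auto simp: walks_inv)
  finally show ?thesis by simp
qed

lemma walks_Suc:
  assumes x: "x \<in> carrier G"
  shows "walks (Suc n) x \<le> (\<Sum>u\<in>N. walks n (r u \<otimes> x))"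
proof -
  have "{ws. set ws \<subseteq> N \<and> length ws = Suc n \<and> ev ws = x}
      \<subseteq> (\<Union>u\<in>N. (#) u ` {ws. set ws \<subseteq> N \<and> length ws = n \<and> ev ws = r u \<otimes> x})"
  proof
    fix ws assume "ws \<in> {ws. set ws \<subseteq> N \<and> length ws = Suc n \<and> ev ws = x}"
    then obtain u vs where "ws = u # vs" "u \<in> N" "set vs \<subseteq> N" "length vs = n" "r u \<otimes> ev vs = x"
      by (cases ws) auto
    moreover from this have "ev vs = r u \<otimes> x"
      by (metis ev_closed l_one m_assoc r_closed r_sq)
    ultimately show "ws \<in> (\<Union>u\<in>N. (#) u ` {ws. set ws \<subseteq> N \<and> length ws = n \<and> ev ws = r u \<otimes> x})"
      by auto
  qed
  then have "walks (Suc n) x \<le> card (\<Union>u\<in>N. (#) u ` {ws. set ws \<subseteq> N \<and> length ws = n \<and> ev ws = r u \<otimes> x})"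
    unfolding walks_def using finite_gens finite_words[of n]
    by (intro card_mono) (auto intro!: finite_imageI elim: rev_finite_subset)
  also have "\<dots> \<le> (\<Sum>u\<in>N. card ((#) u ` {ws. set ws \<subseteq> N \<and> length ws = n \<and> ev ws = r u \<otimes> x}))"
    by (rule card_UN_le[OF finite_gens])
  also have "\<dots> = (\<Sum>u\<in>N. walks n (r u \<otimes> x))"
    unfolding walks_def by (intro sum.cong refl card_image) auto
  finally show ?thesis .
qed

text \<open>Among walks of a given even length, those returning to their origin are the most frequent, by
  transitivity and reversibility; so it suffices to bound the return counts.\<close>

lemma walks_le:
  fixes \<Lambda> :: real
  assumes L: "\<Lambda> \<ge> 1" and ret: "\<And>n. real (walks n \<one>) \<le> \<Lambda> ^ n" and x: "x \<in> carrier G"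
  shows "real (walks n x) \<le> (real (card N) + 1) * \<Lambda> ^ n"
proof -
  have even_n: "real (walks (m + m) z) \<le> \<Lambda> ^ (m + m)" if "z \<in> carrier G" for m z
    using walks_even_le[OF that, of m] ret[of "m + m"] by linarith
  show ?thesis
  proof (cases "even n")
    case True
    then obtain m where "n = m + m" by (metis evenE mult_2)
    then have "real (walks n x) \<le> 1 * \<Lambda> ^ n" using even_n[OF x] by simp
    also have "\<dots> \<le> (real (card N) + 1) * \<Lambda> ^ n"
      using L by (intro mult_right_mono) auto
    finally show ?thesis .
  next
    case False
    \<comment> \<open>An odd walk is one letter followed by an even walk; summing over the letter
      costs the factor \<open>card N\<close>.\<close>
    then obtain m where n: "n = Suc (m + m)" by (metis oddE mult_2 Suc_eq_plus1)
    have "real (walks n x) \<le> (\<Sum>u\<in>N. real (walks (m + m) (r u \<otimes> x)))"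
      unfolding n using walks_Suc[OF x, of "m + m"] by (metis of_nat_le_iff of_nat_sum)
    also have "\<dots> \<le> (\<Sum>u\<in>N. \<Lambda> ^ (m + m))"
      using x r_closed by (intro sum_mono even_n) auto
    also have "\<dots> = real (card N) * \<Lambda> ^ (m + m)" by simp
    also have "\<dots> \<le> (real (card N) + 1) * \<Lambda> ^ n"
      unfolding n using L by (intro mult_mono) (auto intro: power_increasing)
    finally show ?thesis .
  qed
qed

end

section \<open>Right-angled reflection systems\<close>

text \<open>The intended value of \<open>y g u\<close> is the Lorentz product of \<open>u\<close> with the image of a base point under
  the inverse of \<open>g\<close>.\<close>

locale right_angled_reflections = involution_generated_group G N r
  for G :: "'g monoid" (structure) and N :: "'n set" and r :: "'n \<Rightarrow> 'g" +
  fixes B :: "'n \<Rightarrow> 'n \<Rightarrow> real" and y :: "'g \<Rightarrow> 'n \<Rightarrow> real"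
  assumes B_unit: "u \<in> N \<Longrightarrow> B u u = 1"
    and B_sym: "u \<in> N \<Longrightarrow> v \<in> N \<Longrightarrow> B u v = B v u"
    and B_off: "u \<in> N \<Longrightarrow> v \<in> N \<Longrightarrow> u \<noteq> v \<Longrightarrow> B u v = 0 \<or> B u v \<le> -1"
    and r_comm: "u \<in> N \<Longrightarrow> v \<in> N \<Longrightarrow> B u v = 0 \<Longrightarrow> r u \<otimes> r v = r v \<otimes> r u"
    and y_one: "u \<in> N \<Longrightarrow> y \<one> u < 0"
    and y_mult: "g \<in> carrier G \<Longrightarrow> u \<in> N \<Longrightarrow> v \<in> N \<Longrightarrow> y (g \<otimes> r v) u = y g u - 2 * B u v * y g v"
    and card_orthogonal: "X \<subseteq> N \<Longrightarrow> pairwise (\<lambda>u v. B u v = 0) X \<Longrightarrow> card X \<le> 3"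
begin

text \<open>Tits' argument. The second claim keeps the induction running through the infinite dihedral
  subgroups.\<close>

lemma y_sign:
  assumes "g \<in> carrier G"
  shows "(\<forall>u\<in>N. len g \<le> len (g \<otimes> r u) \<longrightarrow> y g u < 0) \<and>
    (\<forall>u\<in>N. \<forall>v\<in>N. len g \<le> len (g \<otimes> r u) \<and> len (g \<otimes> r v) < len g \<and> B u v \<le> -1
       \<longrightarrow> y g u + y g v \<le> 0)"
  using assms
proof (induction "len g" arbitrary: g rule: less_induct)
  case less
  have step: "y g u < 0 \<and> (B u v \<le> -1 \<longrightarrow> y g u + y g v \<le> 0)"
    if u: "u \<in> N" and v: "v \<in> N" and lu: "len g \<le> len (g \<otimes> r u)" and lv: "len (g \<otimes> r v) < len g"
    for u v
  proof -
    define h where "h = g \<otimes> r v"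
    have h: "h \<in> carrier G" using less.prems v r_closed by (simp add: h_def)
    have g: "g = h \<otimes> r v" using less.prems v by (simp add: h_def)
    have lh: "len h < len g" using lv by (simp add: h_def)
    note IH = less.hyps[OF lh h]
    have uv: "u \<noteq> v" using lu lv by auto
    have hv: "y h v < 0" using IH v lh g by auto
    have yg: "y g w = y h w - 2 * B w v * y h v" if "w \<in> N" for w
      using y_mult[OF h that v] g by simp
    have ygv: "y g v = - y h v" using yg[OF v] B_unit[OF v] by simp
    have ygu: "y g u = y h u - 2 * B u v * y h v" using yg[OF u] .
    show ?thesis
    proof (cases "B u v = 0")
      case True
      \<comment> \<open>If \<open>r u\<close> shortened \<open>h\<close>, commuting it past
        \<open>r v\<close> would make \<open>g \<otimes> r u\<close> no longer than
        \<open>h\<close>, hence shorter than \<open>g\<close>.\<close>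
      have "len h \<le> len (h \<otimes> r u)"
      proof (rule ccontr)
        assume "\<not> len h \<le> len (h \<otimes> r u)"
        moreover have "g \<otimes> r u = h \<otimes> r u \<otimes> r v"
          using g h u v r_closed r_comm[OF u v True] by (simp add: m_assoc)
        then have "len (g \<otimes> r u) \<le> len (h \<otimes> r u) + 1"
          using len_mult_r_le[of "h \<otimes> r u" v] h u v r_closed by simp
        ultimately show False using lh lu by linarith
      qed
      then have "y h u < 0" using IH u by blast
      then show ?thesis using ygu True by simp
    next
      case False
      then have c: "B u v \<le> -1" using B_off[OF u v uv] by simp
      then have *: "(- 2 * B u v - 1) * y h v \<le> y h v" "(- 2 * B u v - 2) * y h v \<le> 0"
        using hv by (auto simp: mult_le_0_iff mult_le_cancel_right1 mult_le_cancel_right2 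
            mult_right_le_one_le zero_le_mult_iff intro: mult_nonneg_nonpos)
      \<comment> \<open>Since -2 * B u v \<ge> 2, both targets are y h u + y h v plus a nonnegative
        multiple of the negative \<open>y h v\<close>, with factor at least 1 in the first. The
        common summand is \<le> 0 either by two known signs or by the second claim for
        \<open>h\<close> with \<open>u\<close> and \<open>v\<close> exchanged.\<close>
      have sums: "y g u = (y h u + y h v) + (- 2 * B u v - 1) * y h v"
        "y g u + y g v = (y h u + y h v) + (- 2 * B u v - 2) * y h v"
        unfolding ygu ygv by (simp_all add: algebra_simps)
      have "y h u + y h v \<le> 0"
      proof (cases "len h \<le> len (h \<otimes> r u)")
        case True
        then show ?thesis using IH u hv by fastforce
      next
        case False
        then have "y h v + y h u \<le> 0" using IH u v lh g c B_sym[OF u v] by auto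
        then show ?thesis by simp
      qed
      then show ?thesis using sums * hv by linarith
    qed
  qed
  show ?case
  proof (cases "g = \<one>")
    case True
    then show ?thesis using y_one by auto
  next
    case False
    obtain v where "v \<in> N" "len (g \<otimes> r v) + 1 = len g"
      using exists_shortening[OF less.prems False] .
    then show ?thesis using step by auto
  qed
qed

text \<open>Defined by the sign of \<open>y\<close>, on which right multiplication acts explicitly
  by \<open>y_mult\<close>; \<open>descent_iff\<close> identifies these with the generators that
  shorten \<open>g\<close>.\<close>

definition descents :: "'g \<Rightarrow> 'n set" where
  "descents g = {u \<in> N. y g u > 0}"

lemma descents_subset: "descents g \<subseteq> N"
  and finite_descents [simp]: "finite (descents g)"
  using finite_gens by (auto simp: descents_def)

lemma y_mult_self: "g \<in> carrier G \<Longrightarrow> u \<in> N \<Longrightarrow> y (g \<otimes> r u) u = - y g u"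
  by (simp add: y_mult B_unit)

lemma descent_iff:
  assumes "g \<in> carrier G" "u \<in> N"
  shows "u \<in> descents g \<longleftrightarrow> len (g \<otimes> r u) < len g"
proof
  show "u \<in> descents g \<Longrightarrow> len (g \<otimes> r u) < len g"
    using y_sign[OF assms(1)] assms(2) by (force simp: descents_def)
  assume l: "len (g \<otimes> r u) < len g"
  have "y (g \<otimes> r u) u < 0"
    using y_sign[of "g \<otimes> r u"] l assms r_closed by simp
  then show "u \<in> descents g" using y_mult_self assms by (simp add: descents_def)
qed

lemma len_descent:
  assumes "g \<in> carrier G" "u \<in> descents g"
  shows "len (g \<otimes> r u) + 1 = len g"
  using assms descent_iff[of g u] len_le_mult_r[of g u] by (force simp: descents_def)

text \<open>The point is that \<open>y g u\<close> never vanishes: a zero would persist at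
  \<open>g \<otimes> r u\<close>, and \<open>y_sign\<close> would then make \<open>r u\<close>
  shorten both elements.\<close>

lemma mult_r_descent_iff:
  assumes "g \<in> carrier G" "u \<in> N"
  shows "u \<in> descents (g \<otimes> r u) \<longleftrightarrow> u \<notin> descents g"
proof -
  have "y g u \<noteq> 0"
  proof
    assume z: "y g u = 0"
    then have "y (g \<otimes> r u) u = 0" using y_mult_self assms by simp
    then have "len (g \<otimes> r u) < len g" "len (g \<otimes> r u \<otimes> r u) < len (g \<otimes> r u)"
      using y_sign[OF assms(1)] y_sign[of "g \<otimes> r u"] z assms r_closed by (metis less_irrefl m_closed not_le)+
    then show False using assms by simp
  qed
  then show ?thesis using y_mult_self assms by (auto simp: descents_def)
qed

lemma len_ascent:
  assumes "g \<in> carrier G" "u \<in> N" "u \<notin> descents g"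
  shows "len (g \<otimes> r u) = len g + 1"
  using len_descent[of "g \<otimes> r u" u] assms mult_r_descent_iff r_closed by simp

lemma descents_mult_orth:
  assumes "g \<in> carrier G" "u \<in> N" "v \<in> N" "B u v = 0"
  shows "u \<in> descents (g \<otimes> r v) \<longleftrightarrow> u \<in> descents g"
  using assms by (simp add: descents_def y_mult)

text \<open>An element cannot end in both generators of an infinite dihedral subgroup. If B u v
  \<le> -1, then after removing \<open>v\<close> the generator \<open>u\<close> is still a descent
  and \<open>v\<close> is not, so the second claim of \<open>y_sign\<close> bounds
  \<open>y h v + y h u\<close>; this contradicts the signs at \<open>g\<close>.\<close>

lemma descents_orthogonal:
  assumes g: "g \<in> carrier G"
  shows "pairwise (\<lambda>u v. B u v = 0) (descents g)"
proof (rule pairwiseI, rule ccontr)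
  fix u v assume uv: "u \<in> descents g" "v \<in> descents g" "u \<noteq> v" "B u v \<noteq> 0"
  then have N: "u \<in> N" "v \<in> N" and pos: "y g u > 0" "y g v > 0" by (auto simp: descents_def)
  have c: "B u v \<le> -1" using B_off N uv by blast
  define h where "h = g \<otimes> r v"
  have h: "h \<in> carrier G" using g N r_closed by (simp add: h_def)
  have yv: "y h v = - y g v" and yu: "y h u = y g u - 2 * B u v * y g v"
    using y_mult_self y_mult g N by (simp_all add: h_def)
  have "y h u > 0" using yu pos c mult_neg_pos[of "B u v" "y g v"] by linarith
  then have lu: "len (h \<otimes> r u) < len h" using descent_iff[OF h] N by (simp add: descents_def)
  have "len h \<le> len (h \<otimes> r v)" using descent_iff[OF h] N yv pos by (force simp: descents_def)
  then have "y h v + y h u \<le> 0" using y_sign[OF h] N lu c B_sym[OF N] by auto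
  then have "y g u \<le> (1 + 2 * B u v) * y g v" using yu yv by (simp add: algebra_simps)
  also have "\<dots> < 0" using c pos by (intro mult_neg_pos) auto
  finally show False using pos by simp
qed

lemma card_descents_le: "g \<in> carrier G \<Longrightarrow> card (descents g) \<le> 3"
  using card_orthogonal[OF descents_subset descents_orthogonal] .

lemma descents_nonempty:
  assumes "g \<in> carrier G" "g \<noteq> \<one>"
  shows "descents g \<noteq> {}"
proof -
  obtain u where "u \<in> N" "len (g \<otimes> r u) + 1 = len g" using exists_shortening assms by metis
  then show ?thesis using descent_iff[OF assms(1), of u] by auto
qed

text \<open>The number of elements of length \<open>n\<close> having \<open>j\<close> prescribed pairwise commuting descents. The
  subtraction is never truncated when there are such descents at all.\<close>

fun dcount :: "nat \<Rightarrow> nat \<Rightarrow> nat" where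
  "dcount 0 n = card (sphere n)"
| "dcount (Suc j) 0 = 0"
| "dcount (Suc j) (Suc n) = dcount j n - dcount (Suc j) n"

text \<open>Right multiplication by \<open>r u\<close> for one \<open>u\<close> in \<open>X\<close>
  removes the descent \<open>u\<close> and, by orthogonality, leaves the other descents in
  \<open>X\<close> untouched. This matches the sets counted on level n + 1 with a difference of two
  such sets on level n. Only the size of \<open>X\<close> survives in the answer.\<close>

lemma card_sphere_descents:
  assumes "X \<subseteq> N" "pairwise (\<lambda>u v. B u v = 0) X"
  shows "card {g \<in> sphere n. X \<subseteq> descents g} = dcount (card X) n"
  using assms
proof (induction "card X" n arbitrary: X rule: dcount.induct)
  case (1 n)
  then have "X = {}" using finite_gens finite_subset by fastforce
  then show ?case by simp
next
  case (2 j)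
  then obtain u where "u \<in> X" by fastforce
  then have "u \<notin> descents \<one>" using y_one 2 by (force simp: descents_def)
  then have "{g \<in> sphere 0. X \<subseteq> descents g} = {}" using \<open>u \<in> X\<close> by (auto simp: sphere_0)
  then have "card {g \<in> sphere 0. X \<subseteq> descents g} = 0" by (metis card.empty)
  then show ?case by (metis 2(1) dcount.simps(2))
next
  case (3 j n)
  obtain u where u: "u \<in> X" using 3 by fastforce
  define Z where "Z = X - {u}"
  have uN: "u \<in> N" and ZN: "Z \<subseteq> N" and XZ: "X = insert u Z" and uZ: "u \<notin> Z"
    using u 3 by (auto simp: Z_def)
  have pZ: "pairwise (\<lambda>u v. B u v = 0) Z" using 3 by (auto simp: Z_def pairwise_def)
  have cZ: "card Z = j" using 3 u by (simp add: Z_def)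
  have orth: "B z u = 0" if "z \<in> Z" for z using that u 3 uZ by (auto simp: Z_def pairwise_def)
  have Zd: "Z \<subseteq> descents (g \<otimes> r u) \<longleftrightarrow> Z \<subseteq> descents g" if "g \<in> carrier G" for g
    using descents_mult_orth[OF that _ uN orth] ZN by blast
  let ?S = "{g \<in> sphere n. Z \<subseteq> descents g}" and ?T = "{g \<in> sphere n. X \<subseteq> descents g}"
  have "card {g \<in> sphere (Suc n). X \<subseteq> descents g} = card (?S - ?T)"
  proof (rule bij_betw_same_card[of "\<lambda>g. g \<otimes> r u"], rule bij_betwI[where g = "\<lambda>g. g \<otimes> r u"])
    show "(\<lambda>g. g \<otimes> r u) \<in> {g \<in> sphere (Suc n). X \<subseteq> descents g} \<rightarrow> ?S - ?T"
    proof
      fix g assume g: "g \<in> {g \<in> sphere (Suc n). X \<subseteq> descents g}"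
      then have gc: "g \<in> carrier G" "len g = Suc n" "u \<in> descents g" "Z \<subseteq> descents g"
        by (auto simp: sphere_def XZ)
      then have "len (g \<otimes> r u) = n" "u \<notin> descents (g \<otimes> r u)" "Z \<subseteq> descents (g \<otimes> r u)"
        using len_descent[of g u] mult_r_descent_iff[OF _ uN] Zd by auto
      then show "g \<otimes> r u \<in> ?S - ?T" using gc r_closed[OF uN] by (auto simp: sphere_def XZ)
    qed
    show "(\<lambda>g. g \<otimes> r u) \<in> ?S - ?T \<rightarrow> {g \<in> sphere (Suc n). X \<subseteq> descents g}"
    proof
      fix g assume g: "g \<in> ?S - ?T"
      then have gc: "g \<in> carrier G" "len g = n" "u \<notin> descents g" "Z \<subseteq> descents g"
        by (auto simp: sphere_def XZ)
      then have "len (g \<otimes> r u) = Suc n" "u \<in> descents (g \<otimes> r u)" "Z \<subseteq> descents (g \<otimes> r u)"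
        using len_ascent[of g u] uN mult_r_descent_iff[OF _ uN] Zd by auto
      then show "g \<otimes> r u \<in> {g \<in> sphere (Suc n). X \<subseteq> descents g}"
        using gc r_closed[OF uN] by (auto simp: sphere_def XZ)
    qed
  qed (auto simp: sphere_def uN)
  also have "\<dots> = card ?S - card ?T"
    by (intro card_Diff_subset finite_subset[OF _ finite_sphere[of n]]) (auto simp: XZ)
  also have "card ?S = dcount j n" using 3(1)[of Z] cZ ZN pZ by simp
  also have "card ?T = dcount (Suc j) n" using 3(2)[of X] 3(3-5) by simp
  finally show ?case by (metis 3(3) dcount.simps(3))
qed

end


text \<open>\<open>A n\<close> is a sphere size, \<open>b\<close>, \<open>c\<close>,
  \<open>d\<close> count its elements with one, two, three prescribed descents, and
  \<open>k\<close>, \<open>e\<close>, \<open>t\<close> number faces, edges and vertices. The loss of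
  \<open>A (Suc n)\<close> against \<open>k * A n\<close> must be at most
  \<open>k / 4 * A n\<close>; it is rewritten one level lower, where the earlier ratios control
  it.\<close>

lemma growth_ratio_from_recursion:
  fixes A b c d :: "nat \<Rightarrow> real"
  assumes k: "k \<ge> 18" and e: "3 * t = 2 * e" and t: "t \<le> 2 * k - 4"
    and start: "A 0 = 1" "b 0 = 0" "c 0 = 0" "d 0 = 0"
    and rec: "\<And>n. b (Suc n) = A n - b n" "\<And>n. c (Suc n) = b n - c n" "\<And>n. d (Suc n) = c n - d n"
    and pos: "\<And>n. 0 \<le> b n" "\<And>n. 0 \<le> c n" "\<And>n. 0 \<le> d n" "\<And>n. d n \<le> c n"
    and lower: "\<And>n. A (Suc n) \<le> k * b (Suc n)"
    and total: "\<And>n. A (Suc n) = k * b (Suc n) - e * c (Suc n) + t * d (Suc n)"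
  shows "A (Suc n) \<ge> 3 * k / 4 * A n"
proof (induction n rule: less_induct)
  case (less n)
  have step: "A (Suc n) \<ge> k * A n - ((4 * k - 6) * b n - (5 * k - 10) * c n + (2 * k - 4) * d n)" for n
  proof -
    have "e = 3 * t / 2" using e by simp
    then have "A (Suc n) = k * b (Suc n) - t * (3 / 2 * c (Suc n) - d (Suc n))"
      by (simp add: total algebra_simps)
    \<comment> \<open>The second factor is nonnegative because d \<le> c, so \<open>t\<close> may be
      replaced by its upper bound.\<close>
    moreover have "t * (3 / 2 * c (Suc n) - d (Suc n)) \<le> (2 * k - 4) * (3 / 2 * c (Suc n) - d (Suc n))"
      using t pos(4)[of "Suc n"] pos(2)[of "Suc n"] by (intro mult_right_mono) auto
    ultimately have "A (Suc n) \<ge> k * b (Suc n) - (2 * k - 4) * (3 / 2 * c (Suc n) - d (Suc n))" by linarith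
    then show ?thesis by (simp add: rec field_simps)
  qed
  \<comment> \<open>The left side is the loss relative to \<open>A (Suc m)\<close> found below, the
    right side is k / 4 times the inductive ratio 3 * k / 4.\<close>
  have k2: "4 * k - 6 - 9 + 16 / k + 16 * (7 * k - 14) / (9 * k\<^sup>2) \<le> 3 * k\<^sup>2 / 16"
  proof -
    have "16 * (7 * k - 14) / (9 * k\<^sup>2) \<le> 16 * (7 * k) / (9 * k\<^sup>2)"
      using k by (intro divide_right_mono) auto
    also have "\<dots> = (112 / 9) / k" using k by (simp add: power2_eq_square)
    also have "16 / k \<le> 16 / 18" "(112 / 9) / k \<le> (112 / 9) / 18" using k by (simp_all add: field_simps)
    ultimately have 1: "4 * k - 6 - 9 + 16 / k + 16 * (7 * k - 14) / (9 * k\<^sup>2) \<le> 4 * k - 13" by simp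
    have "0 \<le> (k - 18) * (3 * k / 16 - 5 / 8)" using k by (intro mult_nonneg_nonneg) auto
    also have "\<dots> = 3 * k\<^sup>2 / 16 - 4 * k + 45 / 4" by (simp add: power2_eq_square field_simps)
    finally show ?thesis using 1 by linarith
  qed
  consider "n = 0" | "n = 1" | m where "n = Suc (Suc m)"
    by (metis One_nat_def not0_implies_Suc)
  then show ?case
  proof cases
    case 1
    then show ?thesis using step[of 0] start k by simp
  next
    case 2
    have "A 1 = k" using total[of 0] rec[of 0] start by simp
    then have "k / 4 * A 1 = k * k / 4" by simp
    moreover have "18 * k \<le> k * k" using k by (intro mult_right_mono) auto
    ultimately have "4 * k - 6 \<le> k / 4 * A 1" using k by linarith
    moreover have "A (Suc 1) \<ge> k * A 1 - (4 * k - 6)" using step[of 1] rec start by simp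
    ultimately show ?thesis using 2 by (simp add: algebra_simps)
  next
    case (3 m)
    let ?n1 = "Suc m"
    have A1: "A n \<ge> 3 * k / 4 * A ?n1" using less[of ?n1] 3 by simp
    have Apos: "0 \<le> A i" for i
      using rec(1)[of i] pos(1)[of i] pos(1)[of "Suc i"] by simp
    have b1: "b ?n1 \<ge> A ?n1 / k" using lower[of m] k by (simp add: field_simps)
    \<comment> \<open>Stripping two prescribed descents gives c (j + 2) \<le> A j, and two inductive
      ratios contribute (4 / (3 k))^2 = 16 / (9 k^2).\<close>
    have c1: "c ?n1 \<le> A ?n1 * 16 / (9 * k\<^sup>2)"
    proof (cases m)
      case 0
      then have "c ?n1 = 0" using rec start by simp
      then show ?thesis using Apos[of ?n1] by simp
    next
      case (Suc j)
      have "c ?n1 \<le> b m" "b m \<le> A j"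
        using rec(2)[of m] pos(2)[of m] rec(1)[of j] pos(1)[of j] Suc by auto
      moreover have "A ?n1 \<ge> 3 * k / 4 * A m" using less[of m] 3 by simp
      moreover have "3 * k / 4 * A m \<ge> 3 * k / 4 * (3 * k / 4 * A j)"
        using less[of j] 3 Suc k by (intro mult_left_mono) auto
      ultimately have "c ?n1 \<le> A j" and j: "(9 * k\<^sup>2 / 16) * A j \<le> A ?n1"
        by (auto simp: power2_eq_square algebra_simps)
      then have "(9 * k\<^sup>2 / 16) * c ?n1 \<le> (9 * k\<^sup>2 / 16) * A j" by (intro mult_left_mono) auto
      with j have "(9 * k\<^sup>2 / 16) * c ?n1 \<le> A ?n1" by linarith
      then show ?thesis using k by (simp add: field_simps)
    qed
    have "(4 * k - 6) * b n - (5 * k - 10) * c n + (2 * k - 4) * d n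
        \<le> (4 * k - 6) * b n - (5 * k - 10) * c n + (2 * k - 4) * c ?n1"
      using 3 rec(3)[of ?n1] pos(3)[of ?n1] k by (intro add_left_mono mult_left_mono) auto
    also have "\<dots> = (4 * k - 6) * A ?n1 - (9 * k - 16) * b ?n1 + (7 * k - 14) * c ?n1"
      by (simp add: 3 rec algebra_simps)
    also have "\<dots> \<le> (4 * k - 6) * A ?n1 - (9 * k - 16) * (A ?n1 / k) + (7 * k - 14) * (A ?n1 * 16 / (9 * k\<^sup>2))"
      using b1 c1 k by (intro add_mono diff_mono mult_left_mono) auto
    also have "\<dots> = A ?n1 * (4 * k - 6 - 9 + 16 / k + 16 * (7 * k - 14) / (9 * k\<^sup>2))"
      using k by (simp add: field_simps power2_eq_square)
    also have "\<dots> \<le> A ?n1 * (3 * k\<^sup>2 / 16)" using Apos k2 by (intro mult_left_mono) auto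
    also have "\<dots> = k / 4 * (3 * k / 4 * A ?n1)" by (simp add: power2_eq_square)
    also have "\<dots> \<le> k / 4 * A n" using A1 k by (intro mult_left_mono) auto
    finally show ?thesis using step[of n] by (simp add: algebra_simps)
  qed
qed

section \<open>Inclusion and exclusion over commuting descents; the walk bound\<close>

context right_angled_reflections
begin

definition cliques :: "nat \<Rightarrow> 'n set set" where
  "cliques j = {X. X \<subseteq> N \<and> pairwise (\<lambda>u v. B u v = 0) X \<and> card X = j}"

lemma finite_cliques [simp]: "finite (cliques j)"
  by (rule finite_subset[of _ "Pow N"]) (auto simp: cliques_def finite_gens)

text \<open>Double counting of pairs of an orthogonal set of size \<open>j\<close> and an element
  having it among its descents. Descent sets are orthogonal, so all their subsets of size
  \<open>j\<close> occur.\<close>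

lemma card_cliques_mult_dcount:
  "card (cliques j) * dcount j n = (\<Sum>g\<in>sphere n. card (descents g) choose j)"
proof -
  have "card (cliques j) * dcount j n = (\<Sum>X\<in>cliques j. card {g \<in> sphere n. X \<subseteq> descents g})"
    by (simp add: cliques_def card_sphere_descents)
  also have "\<dots> = (\<Sum>X\<in>cliques j. \<Sum>g\<in>sphere n. if X \<subseteq> descents g then 1 else 0)"
    by (intro sum.cong refl) (simp add: sum.If_cases Int_def)
  also have "\<dots> = (\<Sum>g\<in>sphere n. \<Sum>X\<in>cliques j. if X \<subseteq> descents g then 1 else 0)"
    by (rule sum.swap)
  also have "\<dots> = (\<Sum>g\<in>sphere n. card (descents g) choose j)"
  proof (intro sum.cong refl)
    fix g assume g: "g \<in> sphere n"
    then have "{X \<in> cliques j. X \<subseteq> descents g} = {X. X \<subseteq> descents g \<and> card X = j}"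
      using descents_orthogonal[of g] descents_subset[of g]
      by (auto simp: cliques_def sphere_def intro: pairwise_subset)
    then show "(\<Sum>X\<in>cliques j. if X \<subseteq> descents g then 1 else 0) = card (descents g) choose j"
      by (simp add: sum.If_cases Int_def n_subsets)
  qed
  finally show ?thesis .
qed

lemma card_cliques_1: "card (cliques 1) = card N"
proof -
  have "cliques 1 = (\<lambda>u. {u}) ` N"
    by (auto simp: cliques_def card_1_singleton_iff)
  then show ?thesis by (simp add: card_image)
qed

text \<open>An orthogonal set of size j + 1 makes both sides cardinalities of nested sets; this is
  what keeps the natural subtraction in \<open>dcount\<close> exact.\<close>

lemma dcount_antimono:
  assumes "cliques (Suc j) \<noteq> {}"
  shows "dcount (Suc j) n \<le> dcount j n"
proof -
  obtain X where X: "X \<subseteq> N" "pairwise (\<lambda>u v. B u v = 0) X" "card X = Suc j"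
    using assms by (auto simp: cliques_def)
  then obtain u where u: "u \<in> X" by fastforce
  have "pairwise (\<lambda>u v. B u v = 0) (X - {u})" "card (X - {u}) = j" "X - {u} \<subseteq> N"
    using X u by (auto simp: pairwise_def)
  then have "dcount j n = card {g \<in> sphere n. X - {u} \<subseteq> descents g}"
    using card_sphere_descents[of "X - {u}" n] by simp
  moreover have "dcount (Suc j) n = card {g \<in> sphere n. X \<subseteq> descents g}"
    using card_sphere_descents[OF X(1,2)] X(3) by simp
  moreover have "card {g \<in> sphere n. X \<subseteq> descents g} \<le> card {g \<in> sphere n. X - {u} \<subseteq> descents g}"
    by (rule card_mono) auto
  ultimately show ?thesis by simp
qed

lemma dcount_Suc_Suc:
  assumes "cliques (Suc j) \<noteq> {}"
  shows "real (dcount (Suc j) (Suc n)) = real (dcount j n) - real (dcount (Suc j) n)"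
  using dcount_antimono[OF assms, of n] by simp

theorem sphere_growth:
  assumes k: "card N \<ge> 18"
    and e: "3 * card (cliques 3) = 2 * card (cliques 2)"
    and t: "card (cliques 3) + 4 \<le> 2 * card N"
  shows "real (card (sphere (Suc n))) \<ge> 3 * real (card N) / 4 * real (card (sphere n))"
proof -
  let ?k = "real (card N)"
  define A where "A n = real (dcount 0 n)" for n
  define b where "b n = real (dcount 1 n)" for n
  define c where "c n = real (dcount 2 n)" for n
  define d where "d n = real (dcount 3 n)" for n
  have A0: "A 0 = 1" by (simp add: A_def sphere_0)
  have bcd0: "b 0 = 0" "c 0 = 0" "d 0 = 0" by (simp_all add: b_def c_def d_def numeral_2_eq_2 numeral_3_eq_3)
  have "cliques (Suc 0) \<noteq> {}" using card_cliques_1 k by fastforce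
  then have recb: "b (Suc n) = A n - b n" for n
    using dcount_Suc_Suc[of 0] by (simp add: A_def b_def del: dcount.simps)
  have card_pos: "1 \<le> card (descents g)" "card (descents g) \<le> 3" if "g \<in> sphere (Suc n)" for g n
  proof -
    have "g \<in> carrier G" "g \<noteq> \<one>" using that by (auto simp: sphere_def)
    then show "1 \<le> card (descents g)" "card (descents g) \<le> 3"
      using descents_nonempty card_descents_le by (auto simp: Suc_le_eq card_gt_0_iff)
  qed
  have lower: "A (Suc n) \<le> ?k * b (Suc n)" for n
  proof -
    have "card (sphere (Suc n)) \<le> (\<Sum>g\<in>sphere (Suc n). card (descents g) choose 1)"
      using sum_mono[of "sphere (Suc n)" "\<lambda>_. 1" "\<lambda>g. card (descents g)"] card_pos(1) by simp
    also have "\<dots> = card N * dcount 1 (Suc n)"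
      using card_cliques_mult_dcount[of 1 "Suc n"] by (simp only: card_cliques_1)
    finally show ?thesis by (simp add: A_def b_def del: of_nat_mult dcount.simps(2,3) flip: of_nat_mult)
  qed
  \<comment> \<open>inclusion and exclusion over the descents, of which there are one, two or three\<close>
  have total: "A (Suc n) = ?k * b (Suc n) - card (cliques 2) * c (Suc n) + card (cliques 3) * d (Suc n)" for n
  proof -
    have one: "real 1 = real (m choose 1) - real (m choose 2) + real (m choose 3)" if "1 \<le> m" "m \<le> 3" for m
    proof -
      have "m = 1 \<or> m = 2 \<or> m = 3" using that by auto
      then show ?thesis by (auto simp: numeral_2_eq_2 numeral_3_eq_3)
    qed
    have "(\<Sum>g\<in>sphere (Suc n). real 1) = (\<Sum>g\<in>sphere (Suc n). real (card (descents g) choose 1)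
        - real (card (descents g) choose 2) + real (card (descents g) choose 3))"
      by (intro sum.cong refl one; rule card_pos; assumption)
    then have "A (Suc n) = real (\<Sum>g\<in>sphere (Suc n). card (descents g) choose 1)
        - real (\<Sum>g\<in>sphere (Suc n). card (descents g) choose 2)
        + real (\<Sum>g\<in>sphere (Suc n). card (descents g) choose 3)"
      by (simp only: A_def dcount.simps(1) sum.distrib sum_subtractf of_nat_sum sum_constant mult_1_right of_nat_1)
    then show ?thesis
      by (simp only: card_cliques_mult_dcount[symmetric] card_cliques_1 b_def c_def d_def of_nat_mult)
  qed
  \<comment> \<open>Without orthogonal triples there are, by \<open>e\<close>, no orthogonal pairs
    either. Then the recursions for \<open>c\<close> and \<open>d\<close> count nothing, every
    nontrivial element has exactly one descent, and \<open>b\<close> alone determines the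
    growth.\<close>
  have "A (Suc n) \<ge> 3 * ?k / 4 * A n"
  proof (cases "cliques 3 = {}")
    case True
    then have total': "A (Suc n) = ?k * b (Suc n)" for n using total[of n] e by simp
    have bpos: "0 \<le> b n" for n by (simp add: b_def)
    have bA: "b (Suc n) \<le> A n" for n using recb[of n] bpos[of n] by simp
    show ?thesis
    proof (induction n)
      case 0
      then show ?case using total'[of 0] recb[of 0] A0 bcd0 by simp
    next
      case (Suc n)
      have "4 * A n \<le> 3 * ?k / 4 * A n" using k by (intro mult_right_mono) (auto simp: A_def)
      then have "4 * b (Suc n) \<le> A (Suc n)" using Suc bA[of n] by linarith
      then have "?k * (4 * b (Suc n)) \<le> ?k * A (Suc n)" by (intro mult_left_mono) auto
      then show ?case using total'[of "Suc n"] recb[of "Suc n"] by (simp add: algebra_simps)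
    qed
  next
    case False
    then have "card (cliques 3) \<noteq> 0" by simp
    then have "card (cliques 2) \<noteq> 0" using e by linarith
    then have "cliques 2 \<noteq> {}" by fastforce
    with False have recs: "c (Suc n) = b n - c n" "d (Suc n) = c n - d n" "d n \<le> c n" for n
      using dcount_Suc_Suc[of 1] dcount_Suc_Suc[of 2] dcount_antimono[of 2]
      by (simp_all add: b_def c_def d_def numeral_2_eq_2 numeral_3_eq_3 del: dcount.simps)
    show ?thesis
    proof (rule growth_ratio_from_recursion[of ?k "real (card (cliques 3))" "real (card (cliques 2))" A b c d])
      show "18 \<le> ?k" using k by simp
      show "3 * real (card (cliques 3)) = 2 * real (card (cliques 2))"
        using e by (metis of_nat_mult of_nat_numeral)
      show "real (card (cliques 3)) \<le> 2 * ?k - 4" using t by linarith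
    qed (use A0 bcd0 recb recs lower total in \<open>auto simp: b_def c_def d_def simp del: dcount.simps\<close>)
  qed
  then show ?thesis by (simp add: A_def)
qed

text \<open>The function \<open>(1 / a) ^ len g\<close> is a supersolution for the adjacency operator, since at most
  three neighbours of a vertex are closer to the identity; \<open>a\<close> balances these three against the
  other \<open>k - 3\<close> neighbours.\<close>

lemma walks_one_le:
  assumes k: "card N \<ge> 6"
  shows "real (walks n \<one>) \<le> (2 * sqrt (3 * (real (card N) - 3))) ^ n"
proof -
  define k where "k = real (card N)"
  define a where "a = sqrt ((k - 3) / 3)"
  define L where "L = 2 * sqrt (3 * (k - 3))"
  have k6: "k \<ge> 6" using assms by (simp add: k_def)
  then have a1: "a \<ge> 1" by (simp add: a_def)
  have aa: "a * a = (k - 3) / 3" using k6 by (simp add: a_def)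
  have "sqrt (3 * (k - 3)) = sqrt (3 * 3 * ((k - 3) / 3))" by simp
  also have "\<dots> = sqrt (3 * 3) * a" unfolding a_def by (rule real_sqrt_mult)
  finally have sq: "sqrt (3 * (k - 3)) = 3 * a" by simp
  have La: "L = 3 * a + (k - 3) / a" using aa a1 sq by (simp add: L_def field_simps)
  define f where "f g = (1 / a) ^ len g" for g
  have f: "(\<Sum>u\<in>N. f (g \<otimes> r u)) \<le> L * f g" if g: "g \<in> carrier G" for g
  proof -
    define m where "m = real (card (descents g))"
    have m: "m \<le> 3" using card_descents_le[OF g] by (simp add: m_def)
    have "(\<Sum>u\<in>N. f (g \<otimes> r u)) = (\<Sum>u\<in>descents g. f (g \<otimes> r u)) + (\<Sum>u\<in>N - descents g. f (g \<otimes> r u))"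
      using sum.subset_diff[OF descents_subset[of g] finite_gens, of "\<lambda>u. f (g \<otimes> r u)"]
      by (simp add: add.commute)
    also have "(\<Sum>u\<in>descents g. f (g \<otimes> r u)) = (\<Sum>u\<in>descents g. a * f g)"
    proof (intro sum.cong refl)
      fix u assume "u \<in> descents g"
      then have "len g = Suc (len (g \<otimes> r u))" using len_descent[OF g] by simp
      then show "f (g \<otimes> r u) = a * f g" using a1 by (simp add: f_def)
    qed
    also have "(\<Sum>u\<in>N - descents g. f (g \<otimes> r u)) = (\<Sum>u\<in>N - descents g. f g / a)"
      using len_ascent[OF g] by (intro sum.cong) (auto simp: f_def)
    also have "(\<Sum>u\<in>descents g. a * f g) + (\<Sum>u\<in>N - descents g. f g / a) = (m * a + (k - m) / a) * f g"
      using card_mono[OF finite_gens descents_subset[of g]]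
      by (simp add: m_def k_def card_Diff_subset[OF finite_descents descents_subset] algebra_simps of_nat_diff
          add_divide_distrib diff_divide_distrib)
    also have "\<dots> \<le> L * f g"
    proof (rule mult_right_mono)
      \<comment> \<open>For a \<ge> 1 the factor m a + (k - m) / a increases with m, so m = 3 is the
        worst case. The choice of \<open>a\<close> makes the two terms 3 a and (k - 3) / a
        equal.\<close>
      have "1 / a \<le> a" using a1 by (simp add: field_simps) (metis mult_mono one_le_numeral mult_1 order.trans zero_le_one)
      then have "(3 - m) * (1 / a) \<le> (3 - m) * a" using m by (intro mult_left_mono) auto
      then show "m * a + (k - m) / a \<le> L" unfolding La by (simp add: algebra_simps diff_divide_distrib)
    qed (use a1 in \<open>simp add: f_def\<close>)
    finally show ?thesis .
  qed
  have "L \<ge> 0" using k6 by (simp add: L_def)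
  \<comment> \<open>The weight is summed over all words, so that the one-letter estimate can be
    iterated; a word evaluating to the identity has weight 1.\<close>
  have sums: "(\<Sum>ws | set ws \<subseteq> N \<and> length ws = n. f (ev ws)) \<le> L ^ n" for n
  proof (induction n)
    case 0
    have "{ws. set ws \<subseteq> N \<and> length ws = 0} = {[]}" by auto
    then show ?case by (simp add: f_def)
  next
    case (Suc n)
    let ?W = "\<lambda>n. {ws. set ws \<subseteq> N \<and> length ws = n}"
    have "?W (Suc n) = (\<lambda>(ws, u). ws @ [u]) ` (?W n \<times> N)"
    proof
      show "?W (Suc n) \<subseteq> (\<lambda>(ws, u). ws @ [u]) ` (?W n \<times> N)"
      proof
        fix ws assume "ws \<in> ?W (Suc n)"
        then show "ws \<in> (\<lambda>(ws, u). ws @ [u]) ` (?W n \<times> N)"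
          by (cases ws rule: rev_exhaust) auto
      qed
    qed auto
    moreover have inj: "inj_on (\<lambda>(ws, u). ws @ [u]) (?W n \<times> N)" by (auto simp: inj_on_def)
    ultimately have "(\<Sum>ws\<in>?W (Suc n). f (ev ws)) = (\<Sum>(ws, u)\<in>?W n \<times> N. f (ev (ws @ [u])))"
      using sum.reindex[OF inj, of "\<lambda>ws. f (ev ws)"] by (simp only: o_def split_def)
    also have "\<dots> = (\<Sum>ws\<in>?W n. \<Sum>u\<in>N. f (ev (ws @ [u])))"
      by (rule sum.cartesian_product[symmetric])
    also have "\<dots> = (\<Sum>ws\<in>?W n. \<Sum>u\<in>N. f (ev ws \<otimes> r u))"
      by (intro sum.cong) (auto simp: ev_append r_closed)
    also have "\<dots> \<le> (\<Sum>ws\<in>?W n. L * f (ev ws))" by (intro sum_mono f) auto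
    also have "\<dots> \<le> L * L ^ n" using Suc \<open>L \<ge> 0\<close> by (simp add: sum_distrib_left[symmetric] mult_left_mono)
    finally show ?case by simp
  qed
  have "real (walks n \<one>) = (\<Sum>ws | set ws \<subseteq> N \<and> length ws = n \<and> ev ws = \<one>. f (ev ws))"
    by (simp add: walks_def f_def)
  also have "\<dots> \<le> (\<Sum>ws | set ws \<subseteq> N \<and> length ws = n. f (ev ws))"
    using finite_words[of n] a1 by (intro sum_mono2) (auto simp: f_def)
  also have "\<dots> \<le> L ^ n" by (rule sums)
  finally show ?thesis by (simp add: L_def k_def)
qed

end

section \<open>Percolation on Cayley graphs\<close>

lemma bernoulli_measure_prob_space: "prob_space (bernoulli_measure I p)"
  unfolding bernoulli_measure_def by (intro prob_space_PiM measure_pmf.prob_space_axioms)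

lemma bernoulli_measure_all_open:
  assumes "finite Q" "Q \<subseteq> I" "0 \<le> p" "p \<le> 1"
  shows "measure (bernoulli_measure I p) {\<omega> \<in> space (bernoulli_measure I p). \<forall>i\<in>Q. \<omega> i} = p ^ card Q"
proof -
  interpret product_prob_space "\<lambda>_. measure_pmf (bernoulli_pmf p)" I
    by unfold_locales
  have "emeasure (bernoulli_measure I p) {\<omega> \<in> space (bernoulli_measure I p). \<forall>i\<in>Q. \<omega> i \<in> {True}}
      = (\<Prod>i\<in>Q. emeasure (measure_pmf (bernoulli_pmf p)) {True})"
    unfolding bernoulli_measure_def using assms by (intro emeasure_PiM_Collect) auto
  also have "\<dots> = (ennreal p) ^ card Q"
    using assms by (simp add: emeasure_pmf_single)
  finally show ?thesis
    using assms by (simp add: measure_def ennreal_power)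
qed

lemma pred_bernoulli_all_open:
  assumes "finite Q" "Q \<subseteq> I"
  shows "Measurable.pred (bernoulli_measure I p) (\<lambda>\<omega>. \<forall>i\<in>Q. \<omega> i)"
proof -
  have "Measurable.pred (bernoulli_measure I p) (\<lambda>\<omega>. \<omega> i)" if "i \<in> I" for i
  proof -
    have "(\<lambda>\<omega>. \<omega> i) \<in> measurable (bernoulli_measure I p) (measure_pmf (bernoulli_pmf p))"
      unfolding bernoulli_measure_def using that by (rule measurable_component_singleton)
    also have "measurable (bernoulli_measure I p) (measure_pmf (bernoulli_pmf p))
        = measurable (bernoulli_measure I p) (count_space UNIV)"
      by (rule measurable_cong_sets) auto
    finally show ?thesis .
  qed
  then show ?thesis using assms by (intro pred_intros_finite) auto
qed

text \<open>Integrate the pointwise bound 2 t Z - t^2 Z^2 \<le> 1, whose left side is 0 where the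
  counting variable Z vanishes. For the optimal \<open>t\<close> this is the Cauchy-Schwarz bound (E
  Z)^2 / E Z^2; leaving \<open>t\<close> free avoids a division.\<close>

lemma (in prob_space) second_moment_bound:
  assumes "finite X" and E: "\<And>x. x \<in> X \<Longrightarrow> E x \<in> events"
  shows "2 * t * (\<Sum>x\<in>X. prob (E x)) - t\<^sup>2 * (\<Sum>x\<in>X. \<Sum>y\<in>X. prob (E x \<inter> E y)) \<le> prob (\<Union>x\<in>X. E x)"
proof -
  define Z where "Z \<omega> = (\<Sum>x\<in>X. indicator (E x) \<omega> :: real)" for \<omega>
  have Zsq: "(Z \<omega>)\<^sup>2 = (\<Sum>x\<in>X. \<Sum>y\<in>X. indicator (E x \<inter> E y) \<omega>)" for \<omega>
    by (simp add: Z_def power2_eq_square sum_product indicator_inter_arith)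
  have int: "integrable M (indicator A :: _ \<Rightarrow> real)" if "A \<in> events" for A
    using that by (simp add: integrable_indicator_iff emeasure_eq_measure)
  have EE: "E x \<inter> E y \<in> events" if "x \<in> X" "y \<in> X" for x y using E that by auto
  have "2 * t * Z \<omega> - t\<^sup>2 * (Z \<omega>)\<^sup>2 \<le> indicator (\<Union>x\<in>X. E x) \<omega>" for \<omega>
  proof (cases "\<omega> \<in> (\<Union>x\<in>X. E x)")
    case True
    have "0 \<le> (1 - t * Z \<omega>)\<^sup>2" by simp
    then show ?thesis using True by (simp add: power2_eq_square algebra_simps)
  next
    case False
    then have "Z \<omega> = 0" unfolding Z_def by (intro sum.neutral) auto
    then show ?thesis by simp
  qed
  then have "(\<integral>\<omega>. 2 * t * Z \<omega> - t\<^sup>2 * (Z \<omega>)\<^sup>2 \<partial>M) \<le> (\<integral>\<omega>. indicator (\<Union>x\<in>X. E x) \<omega> \<partial>M)"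
    unfolding Zsq unfolding Z_def using assms EE
    by (intro integral_mono Bochner_Integration.integrable_diff integrable_mult_right
        Bochner_Integration.integrable_sum int sets.finite_UN) auto
  also have "\<dots> = prob (\<Union>x\<in>X. E x)"
    using assms sets.finite_UN[of X E] by (simp add: Int_absorb2 sets.sets_into_space)
  also have "(\<integral>\<omega>. 2 * t * Z \<omega> - t\<^sup>2 * (Z \<omega>)\<^sup>2 \<partial>M)
      = 2 * t * (\<integral>\<omega>. Z \<omega> \<partial>M) - t\<^sup>2 * (\<integral>\<omega>. (Z \<omega>)\<^sup>2 \<partial>M)"
    unfolding Zsq unfolding Z_def using assms EE
    by (subst Bochner_Integration.integral_diff)
      (auto intro!: integrable_mult_right Bochner_Integration.integrable_sum int)
  also have "(\<integral>\<omega>. Z \<omega> \<partial>M) = (\<Sum>x\<in>X. prob (E x))"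
    unfolding Z_def using E
    by (subst Bochner_Integration.integral_sum) (auto intro!: int sum.cong simp: Int_absorb2 sets.sets_into_space)
  also have "(\<integral>\<omega>. (Z \<omega>)\<^sup>2 \<partial>M) = (\<Sum>x\<in>X. \<Sum>y\<in>X. prob (E x \<inter> E y))"
    unfolding Zsq using EE
    by (subst Bochner_Integration.integral_sum, force intro: int Bochner_Integration.integrable_sum,
        intro sum.cong refl, subst Bochner_Integration.integral_sum)
      (auto intro!: int sum.cong simp: Int_absorb2 sets.sets_into_space le_infI1)
  finally show ?thesis .
qed

text \<open>A common description of bond and site percolation: a vertex \<open>v\<close> is kept if all labels in
  \<open>J0 v\<close> are open, and a step from a kept vertex \<open>v\<close> to a neighbour \<open>w\<close> costs the additional
  label \<open>\<kappa> v w\<close>. For bond percolation \<open>J0 v\<close> is empty and \<open>\<kappa> v w\<close> is the edge; for site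
  percolation these are \<open>{v}\<close> and \<open>w\<close>. Translations act on the labels through \<open>\<psi>\<close>.\<close>

locale cayley_percolation = involution_generated_group G N r
  for G :: "'g monoid" (structure) and N :: "'n set" and r :: "'n \<Rightarrow> 'g" +
  fixes I :: "'i set" and J0 :: "'g \<Rightarrow> 'i set" and \<kappa> :: "'g \<Rightarrow> 'g \<Rightarrow> 'i" and \<psi> :: "'g \<Rightarrow> 'i \<Rightarrow> 'i"
    and adj :: "'g \<Rightarrow> 'g \<Rightarrow> bool"
  assumes adj_iff: "adj v w \<longleftrightarrow> v \<in> carrier G \<and> w \<in> carrier G \<and> v \<noteq> w \<and> (\<exists>u\<in>N. w = v \<otimes> r u)"
    and J0_I: "v \<in> carrier G \<Longrightarrow> J0 v \<subseteq> I" and finite_J0: "finite (J0 v)"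
    and \<kappa>_I: "adj v w \<Longrightarrow> \<kappa> v w \<in> I"
    and J0_step: "adj v w \<Longrightarrow> J0 w \<subseteq> insert (\<kappa> v w) (J0 v)"
    and \<kappa>_inj: "adj v w \<Longrightarrow> adj v' w' \<Longrightarrow> \<kappa> v w = \<kappa> v' w' \<Longrightarrow> w = w' \<or> {v, w} = {v', w'}"
    and \<psi>_inj: "g \<in> carrier G \<Longrightarrow> inj_on (\<psi> g) I" and \<psi>_I: "g \<in> carrier G \<Longrightarrow> \<psi> g \<in> I \<rightarrow> I"
    and \<psi>_J0: "g \<in> carrier G \<Longrightarrow> v \<in> carrier G \<Longrightarrow> J0 (g \<otimes> v) = \<psi> g ` J0 v"
    and \<psi>_\<kappa>: "g \<in> carrier G \<Longrightarrow> adj v w \<Longrightarrow> \<kappa> (g \<otimes> v) (g \<otimes> w) = \<psi> g (\<kappa> v w)"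
begin

definition alive :: "('i \<Rightarrow> bool) \<Rightarrow> 'g \<Rightarrow> bool" where
  "alive \<omega> v \<longleftrightarrow> (\<forall>i\<in>J0 v. \<omega> i)"

text \<open>Only the source is tested for being alive; by \<open>J0_step\<close> the target of a
  step then is alive as well.\<close>

definition steps :: "('i \<Rightarrow> bool) \<Rightarrow> ('g \<times> 'g) set" where
  "steps \<omega> = {(v, w). adj v w \<and> alive \<omega> v \<and> \<omega> (\<kappa> v w)}"

definition cluster :: "('i \<Rightarrow> bool) \<Rightarrow> 'g \<Rightarrow> 'g set" where
  "cluster \<omega> v = {w. (v, w) \<in> (steps \<omega>)\<^sup>*}"

definition infinite_at :: "'g \<Rightarrow> ('i \<Rightarrow> bool) \<Rightarrow> bool" where
  "infinite_at v \<omega> \<longleftrightarrow> alive \<omega> v \<and> infinite (cluster \<omega> v)"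

definition iclusters :: "('i \<Rightarrow> bool) \<Rightarrow> 'g set set" where
  "iclusters \<omega> = {cluster \<omega> v |v. v \<in> carrier G \<and> infinite_at v \<omega>}"

abbreviation PM :: "real \<Rightarrow> ('i \<Rightarrow> bool) measure" where
  "PM \<equiv> bernoulli_measure I"

lemma adj_mult_r: "v \<in> carrier G \<Longrightarrow> u \<in> N \<Longrightarrow> v \<otimes> r u \<noteq> v \<Longrightarrow> adj v (v \<otimes> r u)"
  using r_closed by (auto simp: adj_iff)

lemma adj_sym: "adj v w \<Longrightarrow> adj w v"
  unfolding adj_iff by (metis mult_r_r)

lemma adj_left: "g \<in> carrier G \<Longrightarrow> adj v w \<Longrightarrow> adj (g \<otimes> v) (g \<otimes> w)"
  using r_closed by (auto simp: adj_iff m_assoc)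

lemma cluster_subset: "v \<in> carrier G \<Longrightarrow> cluster \<omega> v \<subseteq> carrier G"
proof
  fix w assume v: "v \<in> carrier G" and "w \<in> cluster \<omega> v"
  then have "(v, w) \<in> (steps \<omega>)\<^sup>*" by (simp add: cluster_def)
  then show "w \<in> carrier G" by (cases rule: rtranclE) (use v in \<open>auto simp: steps_def adj_iff\<close>)
qed

text \<open>Spheres are finite. The right side uses countable quantifiers only, which makes infinite
  clusters measurable.\<close>

lemma infinite_iff_unbounded_len:
  assumes "X \<subseteq> carrier G"
  shows "infinite X \<longleftrightarrow> (\<forall>n. \<exists>w\<in>carrier G. n \<le> len w \<and> w \<in> X)"
proof
  assume inf: "infinite X"
  show "\<forall>n. \<exists>w\<in>carrier G. n \<le> len w \<and> w \<in> X"
  proof (rule ccontr)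
    assume "\<not> ?thesis"
    then obtain n where "\<forall>w\<in>carrier G. \<not> (n \<le> len w \<and> w \<in> X)" by blast
    then have "len w < n" if "w \<in> X" for w using assms that by (auto simp: not_le)
    then have "X \<subseteq> (\<Union>m\<in>{..<n}. sphere m)" using assms by (auto simp: sphere_def)
    then show False using inf finite_subset by (metis finite_UN finite_lessThan finite_sphere)
  qed
next
  assume unb: "\<forall>n. \<exists>w\<in>carrier G. n \<le> len w \<and> w \<in> X"
  show "infinite X"
  proof
    assume "finite X"
    then have "\<forall>w\<in>X. len w < Suc (Max (len ` X))" by (auto simp: less_Suc_eq_le)
    moreover obtain w where "Suc (Max (len ` X)) \<le> len w" "w \<in> X" using unb by blast
    ultimately show False by fastforce
  qed
qed

lemma pred_steps:
  assumes "v \<in> carrier G"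
  shows "Measurable.pred (PM p) (\<lambda>\<omega>. (v, w) \<in> steps \<omega>)"
proof (cases "adj v w")
  case True
  have "Measurable.pred (PM p) (\<lambda>\<omega>. \<forall>i\<in>insert (\<kappa> v w) (J0 v). \<omega> i)"
    using True assms J0_I \<kappa>_I finite_J0 by (intro pred_bernoulli_all_open) auto
  then show ?thesis using True by (simp add: steps_def alive_def conj_commute)
qed (simp add: steps_def)

lemma pred_relpow:
  assumes v: "v \<in> carrier G"
  shows "Measurable.pred (PM p) (\<lambda>\<omega>. (v, w) \<in> steps \<omega> ^^ n)"
proof (induction n arbitrary: w)
  case 0
  then show ?case by simp
next
  case (Suc n)
  have "(v, w) \<in> steps \<omega> ^^ Suc n \<longleftrightarrow> (\<exists>x\<in>carrier G. (v, x) \<in> steps \<omega> ^^ n \<and> (x, w) \<in> steps \<omega>)" for \<omega>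
    by (auto simp: steps_def adj_iff)
  moreover have "Measurable.pred (PM p)
      (\<lambda>\<omega>. \<exists>x\<in>carrier G. (v, x) \<in> steps \<omega> ^^ n \<and> (x, w) \<in> steps \<omega>)"
    by (intro measurable_pred_countable countable_carrier pred_intros_logic Suc pred_steps)
  ultimately show ?case by (simp only:)
qed

lemma pred_cluster:
  assumes v: "v \<in> carrier G"
  shows "Measurable.pred (PM p) (\<lambda>\<omega>. w \<in> cluster \<omega> v)"
proof -
  have "w \<in> cluster \<omega> v \<longleftrightarrow> (\<exists>n. (v, w) \<in> steps \<omega> ^^ n)" for \<omega>
    by (simp add: cluster_def rtrancl_power)
  then show ?thesis using pred_relpow[OF v] by simp
qed

lemma pred_infinite_at:
  assumes v: "v \<in> carrier G"
  shows "Measurable.pred (PM p) (infinite_at v)"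
proof -
  have "infinite_at v = (\<lambda>\<omega>. (\<forall>i\<in>J0 v. \<omega> i) \<and> (\<forall>n. \<exists>w\<in>carrier G. n \<le> len w \<and> w \<in> cluster \<omega> v))"
    using infinite_iff_unbounded_len[OF cluster_subset[OF v]] by (auto simp: infinite_at_def alive_def fun_eq_iff)
  moreover have "Measurable.pred (PM p) (\<lambda>\<omega>. \<forall>i\<in>J0 v. \<omega> i)"
    by (intro pred_bernoulli_all_open J0_I[OF v] finite_J0)
  moreover have "Measurable.pred (PM p) (\<lambda>\<omega>. \<exists>w\<in>carrier G. n \<le> len w \<and> w \<in> cluster \<omega> v)" for n
    by (intro measurable_pred_countable countable_carrier) (use pred_cluster[OF v] in auto)
  ultimately show ?thesis
    using pred_intros_logic(3) pred_intros_countable(1) by auto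
qed

lemma iclusters_nonempty_iff: "iclusters \<omega> \<noteq> {} \<longleftrightarrow> (\<exists>v\<in>carrier G. infinite_at v \<omega>)"
  by (auto simp: iclusters_def)

lemma pred_iclusters: "Measurable.pred (PM p) (\<lambda>\<omega>. iclusters \<omega> \<noteq> {})"
  unfolding iclusters_nonempty_iff
  by (intro measurable_pred_countable countable_carrier pred_infinite_at)

lemma event: "Measurable.pred (PM p) P \<Longrightarrow> {\<omega> \<in> space (PM p). P \<omega>} \<in> sets (PM p)"
  by (simp add: pred_def)

lemma steps_translate:
  assumes g: "g \<in> carrier G" and v: "v \<in> carrier G"
  shows "(v, w) \<in> steps (\<lambda>i\<in>I. \<omega> (\<psi> g i)) \<longleftrightarrow> w \<in> carrier G \<and> (g \<otimes> v, g \<otimes> w) \<in> steps \<omega>"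
proof (cases "adj v w")
  case True
  then show ?thesis
    using g v adj_left[OF g True] J0_I[OF v] \<kappa>_I[OF True] \<psi>_J0[OF g v] \<psi>_\<kappa>[OF g True]
    by (auto simp: steps_def alive_def adj_iff subset_eq)
next
  case False
  have "\<not> adj (g \<otimes> v) (g \<otimes> w)" if w: "w \<in> carrier G"
  proof
    assume "adj (g \<otimes> v) (g \<otimes> w)"
    then have "adj (inv g \<otimes> (g \<otimes> v)) (inv g \<otimes> (g \<otimes> w))"
      by (rule adj_left[OF inv_closed[OF g]])
    moreover have "inv g \<otimes> (g \<otimes> v) = v" "inv g \<otimes> (g \<otimes> w) = w"
      using g v w by (simp_all add: m_assoc[symmetric])
    ultimately show False using False by simp
  qed
  then show ?thesis using False by (auto simp: steps_def)
qed

lemma cluster_translate: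
  assumes g: "g \<in> carrier G" and v: "v \<in> carrier G"
  shows "cluster \<omega> (g \<otimes> v) = (\<lambda>w. g \<otimes> w) ` cluster (\<lambda>i\<in>I. \<omega> (\<psi> g i)) v"
proof
  let ?\<omega> = "\<lambda>i\<in>I. \<omega> (\<psi> g i)"
  show "(\<lambda>w. g \<otimes> w) ` cluster ?\<omega> v \<subseteq> cluster \<omega> (g \<otimes> v)"
  proof safe
    fix w assume "w \<in> cluster ?\<omega> v"
    then have "(v, w) \<in> (steps ?\<omega>)\<^sup>*" by (simp add: cluster_def)
    then have "(g \<otimes> v, g \<otimes> w) \<in> (steps \<omega>)\<^sup>*"
    proof induction
      case (step x z)
      then have "x \<in> carrier G" by (auto simp: steps_def adj_iff)
      then have "(g \<otimes> x, g \<otimes> z) \<in> steps \<omega>" using steps_translate[OF g] step by blast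
      then show ?case using step by (meson rtrancl.rtrancl_into_rtrancl)
    qed simp
    then show "g \<otimes> w \<in> cluster \<omega> (g \<otimes> v)" by (simp add: cluster_def)
  qed
  show "cluster \<omega> (g \<otimes> v) \<subseteq> (\<lambda>w. g \<otimes> w) ` cluster ?\<omega> v"
  proof
    fix z assume "z \<in> cluster \<omega> (g \<otimes> v)"
    then have "(g \<otimes> v, z) \<in> (steps \<omega>)\<^sup>*" by (simp add: cluster_def)
    then have "\<exists>w\<in>carrier G. z = g \<otimes> w \<and> (v, w) \<in> (steps ?\<omega>)\<^sup>*"
    proof induction
      case base
      then show ?case using v by auto
    next
      case (step x z)
      then obtain w where w: "w \<in> carrier G" "x = g \<otimes> w" "(v, w) \<in> (steps ?\<omega>)\<^sup>*" by blast
      have z: "z \<in> carrier G" using step by (auto simp: steps_def adj_iff)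
      define w' where "w' = inv g \<otimes> z"
      have w': "w' \<in> carrier G" "z = g \<otimes> w'" using z g by (simp_all add: w'_def m_assoc[symmetric])
      have "(g \<otimes> w, g \<otimes> w') \<in> steps \<omega>" using step(2) w(2) w'(2) by simp
      then have "(w, w') \<in> steps ?\<omega>" using steps_translate[OF g w(1), of w' \<omega>] w'(1) by blast
      with w(3) have "(v, w') \<in> (steps ?\<omega>)\<^sup>*" by (rule rtrancl.rtrancl_into_rtrancl)
      then show ?case using w' by blast
    qed
    then show "z \<in> (\<lambda>w. g \<otimes> w) ` cluster ?\<omega> v" by (auto simp: cluster_def)
  qed
qed

lemma infinite_at_translate:
  assumes g: "g \<in> carrier G"
  shows "infinite_at g \<omega> \<longleftrightarrow> infinite_at \<one> (\<lambda>i\<in>I. \<omega> (\<psi> g i))"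
proof -
  let ?\<omega> = "\<lambda>i\<in>I. \<omega> (\<psi> g i)"
  have "alive \<omega> g \<longleftrightarrow> alive ?\<omega> \<one>"
    using \<psi>_J0[OF g one_closed] J0_I[OF one_closed] g by (auto simp: alive_def subset_eq)
  moreover have "infinite (cluster \<omega> g) \<longleftrightarrow> infinite (cluster ?\<omega> \<one>)"
  proof -
    have "inj_on (\<lambda>w. g \<otimes> w) (cluster ?\<omega> \<one>)"
      using cluster_subset[OF one_closed, of ?\<omega>] g by (auto simp: inj_on_def subset_eq)
    from finite_image_iff[OF this] show ?thesis using cluster_translate[OF g one_closed, of \<omega>] g by simp
  qed
  ultimately show ?thesis by (simp add: infinite_at_def)
qed

text \<open>Reindexing a product of equal factors along the injective map \<open>\<psi> g\<close>
  preserves the measure. The restriction to \<open>I\<close> keeps the translated configuration in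
  the product space.\<close>

lemma prob_infinite_at:
  assumes g: "g \<in> carrier G"
  shows "measure (PM p) {\<omega> \<in> space (PM p). infinite_at g \<omega>}
    = measure (PM p) {\<omega> \<in> space (PM p). infinite_at \<one> \<omega>}"
proof -
  let ?T = "\<lambda>\<omega>. \<lambda>i\<in>I. \<omega> (\<psi> g i)"
  let ?A = "{\<omega> \<in> space (PM p). infinite_at \<one> \<omega>}"
  have distr: "distr (PM p) (PM p) ?T = PM p"
    unfolding bernoulli_measure_def
    using distr_PiM_reindex[OF measure_pmf.prob_space_axioms \<psi>_inj[OF g] \<psi>_I[OF g],
        of "\<lambda>_. bernoulli_pmf p"] by simp
  have T: "?T \<in> measurable (PM p) (PM p)"
    unfolding bernoulli_measure_def using \<psi>_I[OF g]
    by (intro measurable_restrict measurable_component_singleton) auto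
  have "measure (PM p) ?A = measure (distr (PM p) (PM p) ?T) ?A" by (simp add: distr)
  also have "\<dots> = measure (PM p) (?T -` ?A \<inter> space (PM p))"
    by (rule measure_distr[OF T event[OF pred_infinite_at[OF one_closed]]])
  also have "?T -` ?A \<inter> space (PM p) = {\<omega> \<in> space (PM p). infinite_at g \<omega>}"
    using infinite_at_translate[OF g] measurable_space[OF T] by auto
  finally show ?thesis by simp
qed

end


section \<open>Decay of connection probabilities and failure of uniqueness\<close>

context cayley_percolation
begin

text \<open>A shortest open path visits no vertex twice, since a loop could be cut out. This will
  make the labels along it distinct, hence independent.\<close>

lemma cluster_path:
  assumes x: "x \<in> carrier G" and y: "y \<in> cluster \<omega> x"
  obtains ws where "set ws \<subseteq> N" "ev ws = inv x \<otimes> y"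
    "inj_on (\<lambda>i. x \<otimes> ev (take i ws)) {..length ws}"
    "\<And>i. i < length ws \<Longrightarrow> adj (x \<otimes> ev (take i ws)) (x \<otimes> ev (take (Suc i) ws))"
    "\<And>i. i < length ws \<Longrightarrow> \<omega> (\<kappa> (x \<otimes> ev (take i ws)) (x \<otimes> ev (take (Suc i) ws)))"
proof -
  define n where "n = (LEAST n. (x, y) \<in> steps \<omega> ^^ n)"
  have "\<exists>n. (x, y) \<in> steps \<omega> ^^ n" using y by (simp add: cluster_def rtrancl_power)
  then have n: "(x, y) \<in> steps \<omega> ^^ n" unfolding n_def by (rule LeastI_ex)
  then obtain f where f: "f 0 = x" "f n = y" "\<And>i. i < n \<Longrightarrow> (f i, f (Suc i)) \<in> steps \<omega>"
    by (auto simp: relpow_fun_conv)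
  have seg: "(f i, f (i + j)) \<in> steps \<omega> ^^ j" if "i + j \<le> n" for i j
    unfolding relpow_fun_conv using that f(3) by (intro exI[of _ "\<lambda>k. f (i + k)"]) auto
  have inj: "inj_on f {..n}"
  proof (rule linorder_inj_onI, rule notI)
    fix i j assume ij: "i < j" "i \<in> {..n}" "j \<in> {..n}" "f i = f j"
    have "(x, f i) \<in> steps \<omega> ^^ i" "(f i, y) \<in> steps \<omega> ^^ (n - j)"
      using seg[of 0 i] seg[of j "n - j"] ij f by auto
    then have "(x, y) \<in> steps \<omega> ^^ (i + (n - j))"
      unfolding relpow_add by (rule relcompI)
    then have "n \<le> i + (n - j)" unfolding n_def by (rule Least_le)
    then show False using ij by auto
  qed auto
  have "\<forall>i<n. \<exists>u\<in>N. f (Suc i) = f i \<otimes> r u" using f(3) by (auto simp: steps_def adj_iff)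
  then obtain u where u: "\<And>i. i < n \<Longrightarrow> u i \<in> N" "\<And>i. i < n \<Longrightarrow> f (Suc i) = f i \<otimes> r (u i)"
    by metis
  define ws where "ws = map u [0..<n]"
  have ws: "set ws \<subseteq> N" "length ws = n" using u by (auto simp: ws_def)
  have take: "take (Suc i) ws = take i ws @ [u i]" if "i < n" for i
    using that by (simp add: ws_def take_Suc_conv_app_nth)
  have fi: "f i = x \<otimes> ev (take i ws)" if "i \<le> n" for i
    using that
  proof (induction i)
    case 0
    then show ?case using f x by simp
  next
    case (Suc i)
    have "set (take i ws) \<subseteq> N" using ws set_take_subset[of i ws] by auto
    then show ?case using Suc u[of i] x r_closed by (simp add: take ev_append m_assoc)
  qed
  show ?thesis
  proof (rule that[OF ws(1)])
    have "y = x \<otimes> ev ws" using fi[of n] f ws by simp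
    then show "ev ws = inv x \<otimes> y" using x ws by (simp add: m_assoc[symmetric])
    show "inj_on (\<lambda>i. x \<otimes> ev (take i ws)) {..length ws}"
      using inj fi ws by (simp add: inj_on_def)
    fix i assume "i < length ws"
    then have i: "i < n" "i \<le> n" "Suc i \<le> n" using ws by auto
    show "adj (x \<otimes> ev (take i ws)) (x \<otimes> ev (take (Suc i) ws))"
      "\<omega> (\<kappa> (x \<otimes> ev (take i ws)) (x \<otimes> ev (take (Suc i) ws)))"
      using f(3)[OF i(1)] fi[OF i(2)] fi[OF i(3)] by (auto simp: steps_def)
  qed
qed

text \<open>Union bound over the self-avoiding words from \<open>x\<close> to \<open>y\<close>: a
  word of length n is open with probability p^n, there are at most \<open>walks n\<close> of them,
  and none is shorter than \<open>L\<close>. The tail of a geometric series remains.\<close>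

lemma prob_connected_le:
  assumes p: "0 \<le> p" "p \<le> 1" and K: "0 \<le> K" "\<And>n g. g \<in> carrier G \<Longrightarrow> real (walks n g) \<le> K * \<Lambda> ^ n"
    and \<Lambda>: "0 \<le> \<Lambda>" "p * \<Lambda> < 1"
    and xy: "x \<in> carrier G" "y \<in> carrier G" "L \<le> len (inv x \<otimes> y)"
  shows "measure (PM p) {\<omega> \<in> space (PM p). y \<in> cluster \<omega> x} \<le> K * (p * \<Lambda>) ^ L / (1 - p * \<Lambda>)"
proof -
  interpret prob_space "PM p" by (rule bernoulli_measure_prob_space)
  define W where "W n = {ws. set ws \<subseteq> N \<and> length ws = n \<and> ev ws = inv x \<otimes> y
    \<and> inj_on (\<lambda>i. x \<otimes> ev (take i ws)) {..n}
    \<and> (\<forall>i<n. adj (x \<otimes> ev (take i ws)) (x \<otimes> ev (take (Suc i) ws)))}" for n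
  define e where "e ws i = \<kappa> (x \<otimes> ev (take i ws)) (x \<otimes> ev (take (Suc i) ws))" for ws i
  define A where "A ws = {\<omega> \<in> space (PM p). \<forall>i\<in>e ws ` {..<length ws}. \<omega> i}" for ws
  have finW: "finite (W n)" for n
    unfolding W_def by (rule finite_subset[OF _ finite_words[of n]]) auto
  have eI: "e ws ` {..<length ws} \<subseteq> I" if "ws \<in> W n" for ws n
    using that \<kappa>_I by (auto simp: W_def e_def)
  have A_ev: "A ws \<in> events" if "ws \<in> W n" for ws n
    unfolding A_def using eI[OF that] by (intro event pred_bernoulli_all_open) auto
  have probA: "prob (A ws) = p ^ n" if "ws \<in> W n" for ws n
  proof -
    let ?f = "\<lambda>i. x \<otimes> ev (take i ws)"
    have len: "length ws = n" and inj: "inj_on ?f {..n}" and adj: "\<And>i. i < n \<Longrightarrow> adj (?f i) (?f (Suc i))"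
      using that by (auto simp: W_def)
    \<comment> \<open>\<open>\<kappa>_inj\<close> turns equal labels into a coincidence of path
      vertices, both for shared end vertices (sites) and for shared edges (bonds), against
      \<open>inj\<close>.\<close>
    have "inj_on (e ws) {..<n}"
    proof (rule linorder_inj_onI, rule notI)
      fix i j assume ij: "i < j" "i \<in> {..<n}" "j \<in> {..<n}" "e ws i = e ws j"
      then have "?f (Suc i) = ?f (Suc j) \<or> {?f i, ?f (Suc i)} = {?f j, ?f (Suc j)}"
        using adj[of i] adj[of j] by (intro \<kappa>_inj) (auto simp: e_def)
      then have "?f (Suc i) = ?f (Suc j) \<or> ?f i = ?f j \<or> ?f i = ?f (Suc j)" by (auto simp: doubleton_eq_iff)
      then have "Suc i = Suc j \<or> i = j \<or> i = Suc j"
        using inj_onD[OF inj, of "Suc i" "Suc j"] inj_onD[OF inj, of i j] inj_onD[OF inj, of i "Suc j"] ij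
        by auto
      then show False using ij by auto
    qed auto
    then show ?thesis unfolding A_def len using eI[OF that] len p
      by (subst bernoulli_measure_all_open) (auto simp: card_image)
  qed
  define U where "U n = (\<Union>ws\<in>W n. A ws)" for n
  have U_ev: "U n \<in> events" for n unfolding U_def using finW A_ev by (intro sets.finite_UN) auto
  have probU: "prob (U n) \<le> K * (p * \<Lambda>) ^ n" for n
  proof -
    have "prob (U n) \<le> (\<Sum>ws\<in>W n. prob (A ws))"
      unfolding U_def using finW A_ev by (intro finite_measure_subadditive_finite) auto
    also have "\<dots> = real (card (W n)) * p ^ n" using probA by simp
    also have "card (W n) \<le> walks n (inv x \<otimes> y)"
      unfolding walks_def W_def by (intro card_mono finite_subset[OF _ finite_words[of n]]) auto
    then have "real (card (W n)) * p ^ n \<le> (K * \<Lambda> ^ n) * p ^ n"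
      using K(2)[of "inv x \<otimes> y" n] xy p by (intro mult_right_mono) auto
    finally show ?thesis by (simp add: power_mult_distrib mult_ac)
  qed
  have WL: "L \<le> n" if "ws \<in> W n" for n ws
    using that xy(3) len_le[of ws] by (auto simp: W_def)
  have "{\<omega> \<in> space (PM p). y \<in> cluster \<omega> x} \<subseteq> (\<Union>n. U (n + L))"
  proof safe
    fix \<omega> assume \<omega>: "\<omega> \<in> space (PM p)" "y \<in> cluster \<omega> x"
    obtain ws where "ws \<in> W (length ws)" "\<omega> \<in> A ws"
      using cluster_path[OF xy(1) \<omega>(2)] \<omega>(1) unfolding W_def A_def e_def by (smt (verit) imageE lessThan_iff mem_Collect_eq)
    then have "\<omega> \<in> U (length ws)" "L \<le> length ws" using WL by (auto simp: U_def)
    then show "\<omega> \<in> (\<Union>n. U (n + L))" by (intro UN_I[of "length ws - L"]) auto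
  qed
  then have "prob {\<omega> \<in> space (PM p). y \<in> cluster \<omega> x} \<le> prob (\<Union>n. U (n + L))"
    using U_ev by (intro finite_measure_mono) auto
  also have "\<dots> \<le> (\<Sum>n. prob (U (n + L)))"
  proof (rule finite_measure_subadditive_countably)
    show "summable (\<lambda>n. prob (U (n + L)))"
    proof (rule summable_comparison_test')
      show "summable (\<lambda>n. K * (p * \<Lambda>) ^ L * (p * \<Lambda>) ^ n)"
        using p \<Lambda> by (intro summable_mult summable_geometric) auto
      show "norm (prob (U (n + L))) \<le> K * (p * \<Lambda>) ^ L * (p * \<Lambda>) ^ n" if "n \<ge> 0" for n
        using probU[of "n + L"] by (simp add: power_add mult_ac)
    qed
  qed (use U_ev in auto)
  also have "\<dots> \<le> (\<Sum>n. K * (p * \<Lambda>) ^ L * (p * \<Lambda>) ^ n)"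
  proof (rule suminf_le)
    show geo: "summable (\<lambda>n. K * (p * \<Lambda>) ^ L * (p * \<Lambda>) ^ n)"
      using p \<Lambda> by (intro summable_mult summable_geometric) auto
    show le: "prob (U (n + L)) \<le> K * (p * \<Lambda>) ^ L * (p * \<Lambda>) ^ n" for n
      using probU[of "n + L"] by (simp add: power_add mult_ac)
    show "summable (\<lambda>n. prob (U (n + L)))"
      by (rule summable_comparison_test'[OF geo, of 0]) (use le in auto)
  qed
  also have "\<dots> = K * (p * \<Lambda>) ^ L / (1 - p * \<Lambda>)"
    using p \<Lambda> by (subst suminf_mult) (auto simp: suminf_geometric summable_geometric)
  finally show ?thesis .
qed

text \<open>If the infinite cluster were unique, far apart vertices would lie in it almost
  disjointly, although each does with the same positive probability.\<close>

theorem not_unique_below: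
  assumes p: "0 \<le> p" "p \<le> 1" and K: "0 \<le> K" "\<And>n g. g \<in> carrier G \<Longrightarrow> real (walks n g) \<le> K * \<Lambda> ^ n"
    and \<Lambda>: "0 \<le> \<Lambda>" and spheres: "\<And>n. sphere n \<noteq> {}"
    and uniq: "AE \<omega> in PM p. \<exists>!C. C \<in> iclusters \<omega>"
  shows "1 \<le> p * \<Lambda>"
proof (rule ccontr)
  assume "\<not> 1 \<le> p * \<Lambda>"
  then have q: "0 \<le> p * \<Lambda>" "p * \<Lambda> < 1" using p \<Lambda> by auto
  interpret prob_space "PM p" by (rule bernoulli_measure_prob_space)
  define E where "E v = {\<omega> \<in> space (PM p). infinite_at v \<omega>}" for v
  define \<theta> where "\<theta> = prob (E \<one>)"
  have E_ev: "E v \<in> events" if "v \<in> carrier G" for v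
    unfolding E_def by (intro event pred_infinite_at that)
  have \<theta>: "prob (E v) = \<theta>" if "v \<in> carrier G" for v
    using prob_infinite_at[OF that] by (simp add: E_def \<theta>_def)
  \<comment> \<open>If one vertex almost never lies in an infinite cluster, then by translation and
    countability none does, so there would not even be one infinite cluster.\<close>
  have "\<theta> \<noteq> 0"
  proof
    assume "\<theta> = 0"
    then have "AE \<omega> in PM p. \<forall>v\<in>carrier G. \<not> infinite_at v \<omega>"
      using \<theta> E_ev by (subst AE_ball_countable[OF countable_carrier])
        (auto simp: E_def prob_eq_0 pred_def[symmetric])
    with uniq have "AE \<omega> in PM p. False"
      by eventually_elim (auto simp: iclusters_def)
    then show False by simp
  qed
  then have \<theta>pos: "0 < \<theta>" by (simp add: \<theta>_def order_less_le)
  have pair: "prob (E x \<inter> E y) \<le> K * (p * \<Lambda>) ^ L / (1 - p * \<Lambda>)"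
    if x: "x \<in> carrier G" and y: "y \<in> carrier G" and L: "L \<le> len (inv x \<otimes> y)" for x y L
  proof -
    have ev: "{\<omega> \<in> space (PM p). y \<in> cluster \<omega> x} \<in> events"
      by (intro event pred_cluster x)
    have "AE \<omega> in PM p. \<omega> \<in> E x \<inter> E y \<longrightarrow> \<omega> \<in> {\<omega> \<in> space (PM p). y \<in> cluster \<omega> x}"
      using uniq
    proof eventually_elim
      case (elim \<omega>)
      show ?case
      proof
        assume "\<omega> \<in> E x \<inter> E y"
        then have "\<omega> \<in> space (PM p)" "cluster \<omega> x \<in> iclusters \<omega>" "cluster \<omega> y \<in> iclusters \<omega>"
          using x y by (auto simp: E_def iclusters_def)
        then show "\<omega> \<in> {\<omega> \<in> space (PM p). y \<in> cluster \<omega> x}"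
          using elim by (auto simp: cluster_def)
      qed
    qed
    then have "prob (E x \<inter> E y) \<le> prob {\<omega> \<in> space (PM p). y \<in> cluster \<omega> x}"
      using ev by (rule finite_measure_mono_AE)
    also have "\<dots> \<le> K * (p * \<Lambda>) ^ L / (1 - p * \<Lambda>)"
      by (rule prob_connected_le[OF p K(1) _ \<Lambda> q(2) x y L]) (erule K(2))
    finally show ?thesis .
  qed
  obtain m :: nat where m: "4 / \<theta> < real m" using reals_Archimedean2 by blast
  then have mpos: "0 < m" using \<theta>pos by (metis divide_pos_pos gr0I of_nat_0 less_asym zero_less_numeral)
  have "(\<lambda>L. K * (p * \<Lambda>) ^ L / (1 - p * \<Lambda>)) \<longlonglongrightarrow> K * 0 / (1 - p * \<Lambda>)"
    using q by (intro tendsto_intros LIMSEQ_power_zero) auto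
  then have "eventually (\<lambda>L. K * (p * \<Lambda>) ^ L / (1 - p * \<Lambda>) < \<theta>\<^sup>2 / 4) sequentially"
    using \<theta>pos by (intro order_tendstoD(2)) auto
  then obtain L where L: "K * (p * \<Lambda>) ^ L / (1 - p * \<Lambda>) < \<theta>\<^sup>2 / 4"
    by (auto simp: eventually_sequentially)
  \<comment> \<open>Points on spheres whose radii are multiples of \<open>L\<close> are pairwise at
    distance at least \<open>L\<close> by the triangle inequality.\<close>
  define x where "x i = (SOME g. g \<in> sphere (i * L))" for i
  have "x i \<in> sphere (i * L)" for i
    unfolding x_def using spheres some_in_eq by blast
  then have x: "x i \<in> carrier G" "len (x i) = i * L" for i by (auto simp: sphere_def)
  have far: "L \<le> len (inv (x i) \<otimes> x j)" if "i \<noteq> j" for i j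
  proof -
    have le: "L \<le> len (inv (x i) \<otimes> x j)" if "i < j" for i j
    proof -
      have "x j = x i \<otimes> (inv (x i) \<otimes> x j)" using x by (simp add: m_assoc[symmetric])
      then have "len (x j) \<le> len (x i) + len (inv (x i) \<otimes> x j)"
        using len_mult_le[of "x i" "inv (x i) \<otimes> x j"] x by simp
      moreover have "(i + 1) * L \<le> j * L" using that by (intro mult_right_mono) auto
      ultimately show ?thesis using x by simp
    qed
    have "len (inv (x j) \<otimes> x i) = len (inv (x i) \<otimes> x j)"
      using len_inv[of "inv (x i) \<otimes> x j"] x by (simp add: inv_mult_group)
    then show ?thesis using le[of i j] le[of j i] that by (cases "i < j") auto
  qed
  have "(\<Sum>i<m. \<Sum>j<m. prob (E (x i) \<inter> E (x j))) \<le> (\<Sum>i<m. \<Sum>j<m. (if i = j then \<theta> else 0) + \<theta>\<^sup>2 / 4)"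
  proof (intro sum_mono)
    fix i j
    show "prob (E (x i) \<inter> E (x j)) \<le> (if i = j then \<theta> else 0) + \<theta>\<^sup>2 / 4"
    proof (cases "i = j")
      case True
      then show ?thesis using \<theta>[OF x(1)] by simp
    next
      case False
      have "prob (E (x i) \<inter> E (x j)) \<le> \<theta>\<^sup>2 / 4"
        using pair[OF x(1) x(1) far[OF False]] L by linarith
      then show ?thesis using False by simp
    qed
  qed
  also have "\<dots> = m * \<theta> + m * (m * (\<theta>\<^sup>2 / 4))"
    by (simp add: sum.distrib algebra_simps)
  finally have S2: "(\<Sum>i<m. \<Sum>j<m. prob (E (x i) \<inter> E (x j))) \<le> m * \<theta> + m * (m * (\<theta>\<^sup>2 / 4))" .
  \<comment> \<open>With this \<open>t\<close> the first moment term is 4, while the second moment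
    term is at most 1 + 4 / (m \<theta>) < 2. As a probability is at most 1, this would give 4 <
    3.\<close>
  define t where "t = 2 / (m * \<theta>)"
  have "2 * t * (\<Sum>i<m. prob (E (x i))) - t\<^sup>2 * (\<Sum>i<m. \<Sum>j<m. prob (E (x i) \<inter> E (x j)))
      \<le> prob (\<Union>i<m. E (x i))"
    using second_moment_bound[of "{..<m}" "\<lambda>i. E (x i)" t] E_ev x by simp
  also have "\<dots> \<le> 1" by simp
  finally have "2 * t * (m * \<theta>) \<le> 1 + t\<^sup>2 * (\<Sum>i<m. \<Sum>j<m. prob (E (x i) \<inter> E (x j)))"
    using \<theta>[OF x(1)] by simp
  also have "\<dots> \<le> 1 + t\<^sup>2 * (m * \<theta> + m * (m * (\<theta>\<^sup>2 / 4)))"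
    using S2 by (intro add_left_mono mult_left_mono) auto
  also have "\<dots> = 2 + 4 / (m * \<theta>)"
    using mpos \<theta>pos by (simp add: t_def field_simps power2_eq_square)
  also have "\<dots> < 3" using m \<theta>pos mpos by (simp add: field_simps)
  finally show False using mpos \<theta>pos by (simp add: t_def)
qed

lemma cluster_all_open:
  assumes open_all: "\<And>v. v \<in> carrier G \<Longrightarrow> alive \<omega> v" "\<And>v w. adj v w \<Longrightarrow> \<omega> (\<kappa> v w)"
    and v: "v \<in> carrier G"
  shows "cluster \<omega> v = carrier G"
proof
  have "v \<otimes> ev ws \<in> cluster \<omega> v" if "set ws \<subseteq> N" for ws
    using that
  proof (induction ws rule: rev_induct)
    case Nil
    then show ?case using v by (simp add: cluster_def)
  next
    case (snoc u ws)
    let ?x = "v \<otimes> ev ws"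
    have x: "?x \<in> carrier G" "u \<in> N" "?x \<in> cluster \<omega> v" using snoc v by auto
    have *: "v \<otimes> ev (ws @ [u]) = ?x \<otimes> r u" using snoc v r_closed by (simp add: ev_append m_assoc)
    show ?case
    proof (cases "?x \<otimes> r u = ?x")
      case True
      then show ?thesis using x * by simp
    next
      case False
      then have "adj ?x (?x \<otimes> r u)" using adj_mult_r x by blast
      then have "(?x, ?x \<otimes> r u) \<in> steps \<omega>" using open_all x by (auto simp: steps_def)
      then show ?thesis using x(3) * by (auto simp: cluster_def intro: rtrancl.rtrancl_into_rtrancl)
    qed
  qed
  then show "carrier G \<subseteq> cluster \<omega> v"
  proof (intro subsetI)
    fix w assume w: "w \<in> carrier G" and *: "\<And>ws. set ws \<subseteq> N \<Longrightarrow> v \<otimes> ev ws \<in> cluster \<omega> v"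
    have "inv v \<otimes> w \<in> carrier G" using v w by simp
    then obtain ws where ws: "set ws \<subseteq> N" "length ws = len (inv v \<otimes> w)" "inv v \<otimes> w = ev ws"
      by (rule obtain_reduced)
    have "w = v \<otimes> (inv v \<otimes> w)" using v w by (simp add: m_assoc[symmetric])
    then show "w \<in> cluster \<omega> v" using *[OF ws(1)] ws(3) by simp
  qed
qed (rule cluster_subset[OF v])

text \<open>Makes the set whose infimum is the uniqueness threshold nonempty, so that lower bounds
  for its members pass to \<open>Inf\<close>.\<close>

theorem unique_at_one:
  assumes spheres: "\<And>n. sphere n \<noteq> {}"
  shows "AE \<omega> in PM 1. \<exists>!C. C \<in> iclusters \<omega>"
proof -
  interpret prob_space "PM 1" by (rule bernoulli_measure_prob_space)
  have open_fin: "AE \<omega> in PM 1. \<forall>i\<in>Q. \<omega> i" if Q: "finite Q" "Q \<subseteq> I" for Q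
  proof -
    have "prob {\<omega> \<in> space (PM 1). \<forall>i\<in>Q. \<omega> i} = 1"
      using bernoulli_measure_all_open[OF Q, of 1] by simp
    then show ?thesis
      using prob_Collect_eq_1[OF event[OF pred_bernoulli_all_open[OF Q]]] by blast
  qed
  have "AE \<omega> in PM 1. \<forall>v\<in>carrier G. alive \<omega> v"
    unfolding AE_ball_countable[OF countable_carrier] alive_def
    using open_fin finite_J0 J0_I by blast
  moreover have "AE \<omega> in PM 1. \<forall>v\<in>carrier G. \<forall>w\<in>carrier G. adj v w \<longrightarrow> \<omega> (\<kappa> v w)"
  proof -
    have "AE \<omega> in PM 1. adj v w \<longrightarrow> \<omega> (\<kappa> v w)" for v w
      using open_fin[of "{\<kappa> v w}"] \<kappa>_I[of v w] by (cases "adj v w") auto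
    then show ?thesis unfolding AE_ball_countable[OF countable_carrier] by blast
  qed
  ultimately show ?thesis
  proof eventually_elim
    case (elim \<omega>)
    have "cluster \<omega> v = carrier G" if "v \<in> carrier G" for v
      by (rule cluster_all_open[OF _ _ that]) (use elim in \<open>auto simp: adj_iff\<close>)
    moreover have "infinite (carrier G)"
    proof -
      have "\<exists>w\<in>carrier G. n \<le> len w" for n using spheres[of n] by (auto simp: sphere_def)
      then show ?thesis using infinite_iff_unbounded_len[of "carrier G"] by blast
    qed
    ultimately have "iclusters \<omega> = {carrier G}"
      using elim one_closed by (auto simp: iclusters_def infinite_at_def intro!: exI[of _ \<one>])
    then show ?case by simp
  qed
qed

end


section \<open>A geodesic spanning tree of the Cayley graph\<close>

context involution_generated_group
begin

definition parent :: "'g \<Rightarrow> 'g" where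
  "parent g = g \<otimes> r (SOME u. u \<in> N \<and> len (g \<otimes> r u) + 1 = len g)"

text \<open>The index is the level of the ancestor, that is its distance from the identity, and not
  the number of generations back from \<open>g\<close>.\<close>

definition ancestor :: "'g \<Rightarrow> nat \<Rightarrow> 'g" where
  "ancestor g j = (parent ^^ (len g - j)) g"

lemma parent:
  assumes "g \<in> carrier G" "len g \<noteq> 0"
  obtains u where "u \<in> N" "parent g = g \<otimes> r u" "len (parent g) + 1 = len g"
proof -
  have "g \<noteq> \<one>" using assms by auto
  with assms(1) have "\<exists>u. u \<in> N \<and> len (g \<otimes> r u) + 1 = len g" by (metis exists_shortening)
  from someI_ex[OF this] show ?thesis by (intro that[of "SOME u. u \<in> N \<and> len (g \<otimes> r u) + 1 = len g"])
      (auto simp: parent_def)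
qed

lemma parent_pow:
  assumes "g \<in> carrier G" "i \<le> len g"
  shows "(parent ^^ i) g \<in> carrier G" "len ((parent ^^ i) g) = len g - i"
    "len (inv ((parent ^^ i) g) \<otimes> g) \<le> i"
proof -
  have "(parent ^^ i) g \<in> carrier G \<and> len ((parent ^^ i) g) = len g - i \<and> len (inv ((parent ^^ i) g) \<otimes> g) \<le> i"
    using assms(2)
  proof (induction i)
    case 0
    then show ?case using assms by simp
  next
    case (Suc i)
    define z where "z = (parent ^^ i) g"
    have z: "z \<in> carrier G" "len z = len g - i" "len (inv z \<otimes> g) \<le> i" "len z \<noteq> 0"
      using Suc by (auto simp: z_def)
    obtain u where u: "u \<in> N" "parent z = z \<otimes> r u" "len (parent z) + 1 = len z"
      using parent[OF z(1) z(4)] .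
    have "inv (parent z) \<otimes> g = r u \<otimes> (inv z \<otimes> g)"
      using u z assms r_closed[OF u(1)] by (simp add: inv_mult_group r_inv m_assoc)
    then have "len (inv (parent z) \<otimes> g) \<le> len (r u) + len (inv z \<otimes> g)"
      using len_mult_le[of "r u" "inv z \<otimes> g"] z assms r_closed[OF u(1)] by simp
    then have "len (inv (parent z) \<otimes> g) \<le> Suc i" using len_r_le[OF u(1)] z by simp
    then show ?case using u z r_closed[OF u(1)] Suc.prems by (simp add: z_def[symmetric])
  qed
  then show "(parent ^^ i) g \<in> carrier G" "len ((parent ^^ i) g) = len g - i"
    "len (inv ((parent ^^ i) g) \<otimes> g) \<le> i" by auto
qed

lemma ancestor:
  assumes "g \<in> carrier G" "j \<le> len g"
  shows "ancestor g j \<in> carrier G" "len (ancestor g j) = j" "len (inv (ancestor g j) \<otimes> g) = len g - j"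
proof -
  show c: "ancestor g j \<in> carrier G" and l: "len (ancestor g j) = j"
    using parent_pow[OF assms(1), of "len g - j"] assms(2) by (auto simp: ancestor_def)
  have "ancestor g j \<otimes> (inv (ancestor g j) \<otimes> g) = g" using c assms by (simp add: m_assoc[symmetric])
  then have "len g \<le> j + len (inv (ancestor g j) \<otimes> g)"
    using len_mult_le[of "ancestor g j" "inv (ancestor g j) \<otimes> g"] c l assms by simp
  then show "len (inv (ancestor g j) \<otimes> g) = len g - j"
    using parent_pow(3)[OF assms(1), of "len g - j"] assms(2) by (auto simp: ancestor_def)
qed

lemma ancestor_self [simp]: "ancestor g (len g) = g"
  by (simp add: ancestor_def)

lemma ancestor_0: "g \<in> carrier G \<Longrightarrow> ancestor g 0 = \<one>"
  using ancestor[of g 0] len_eq_0 by simp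

lemma ancestor_parent: "j < len g \<Longrightarrow> ancestor g j = parent (ancestor g (Suc j))"
proof -
  assume "j < len g"
  then have "len g - j = Suc (len g - Suc j)" by simp
  then show ?thesis by (simp add: ancestor_def)
qed

lemma ancestor_of_parent:
  assumes "g \<in> carrier G" "j < len g"
  shows "ancestor (parent g) j = ancestor g j"
proof -
  have "len g \<noteq> 0" using assms by simp
  then obtain u where "u \<in> N" "parent g = g \<otimes> r u" "len (parent g) + 1 = len g"
    by (rule parent[OF assms(1)])
  then have "len g - j = Suc (len (parent g) - j)" using assms by simp
  then show ?thesis by (simp add: ancestor_def funpow_swap1)
qed

text \<open>\<open>z\<close> lies on a geodesic from the identity to each of its descendants, so
  left translation by its inverse carries them injectively into the sphere of radius n - m. Since
  parents are chosen arbitrarily, subtrees need not be translates of each other.\<close>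

lemma card_descendants_le:
  assumes "m \<le> n"
  shows "card {w \<in> sphere n. ancestor w m = z} \<le> card (sphere (n - m))"
proof (rule card_inj_on_le[where f = "\<lambda>w. inv z \<otimes> w"])
  show "inj_on (\<lambda>w. inv z \<otimes> w) {w \<in> sphere n. ancestor w m = z}"
  proof (rule inj_onI)
    fix v w assume "v \<in> {w \<in> sphere n. ancestor w m = z}" "w \<in> {w \<in> sphere n. ancestor w m = z}"
      "inv z \<otimes> v = inv z \<otimes> w"
    then show "v = w" using ancestor(1)[of v m] assms by (auto simp: sphere_def)
  qed
  show "(\<lambda>w. inv z \<otimes> w) ` {w \<in> sphere n. ancestor w m = z} \<subseteq> sphere (n - m)"
    using ancestor assms by (auto simp: sphere_def)
qed simp

end

section \<open>Infinite clusters along the spanning tree\<close>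

context cayley_percolation
begin

definition tree_label :: "'g \<Rightarrow> nat \<Rightarrow> 'i" where
  "tree_label g j = \<kappa> (ancestor g j) (ancestor g (Suc j))"

text \<open>\<open>J0 \<one>\<close> keeps the root alive; every later vertex is made alive by the
  label of the step entering it.\<close>

definition tree_labels :: "'g \<Rightarrow> 'i set" where
  "tree_labels g = J0 \<one> \<union> tree_label g ` {..<len g}"

lemma ancestor_adj:
  assumes "g \<in> carrier G" "j < len g"
  shows "adj (ancestor g j) (ancestor g (Suc j))"
proof -
  have a: "ancestor g (Suc j) \<in> carrier G" "len (ancestor g (Suc j)) = Suc j"
    "len (ancestor g j) = j"
    using ancestor[of g "Suc j"] ancestor[of g j] assms by auto
  then have "len (ancestor g (Suc j)) \<noteq> 0" by simp
  then obtain u where "u \<in> N" "parent (ancestor g (Suc j)) = ancestor g (Suc j) \<otimes> r u"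
    "len (parent (ancestor g (Suc j))) + 1 = len (ancestor g (Suc j))"
    by (rule parent[OF a(1)])
  then have "u \<in> N" "ancestor g j = ancestor g (Suc j) \<otimes> r u"
    using ancestor_parent[OF assms(2)] by auto
  then have "adj (ancestor g (Suc j)) (ancestor g j)"
    using adj_mult_r[of "ancestor g (Suc j)" u] a by fastforce
  then show ?thesis by (rule adj_sym)
qed

lemma finite_tree_labels [simp]: "finite (tree_labels g)"
  by (simp add: tree_labels_def finite_J0)

lemma tree_labels_I: "g \<in> carrier G \<Longrightarrow> tree_labels g \<subseteq> I"
  using J0_I[OF one_closed] \<kappa>_I ancestor_adj by (auto simp: tree_labels_def tree_label_def)

lemma card_tree_labels_le: "card (tree_labels g) \<le> card (J0 \<one>) + len g"
  unfolding tree_labels_def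
  using card_Un_le[of "J0 \<one>" "tree_label g ` {..<len g}"] card_image_le[of "{..<len g}" "tree_label g"]
  by simp

text \<open>A label determines the child vertex of its tree edge: traversing the same edge in
  opposite directions is excluded by comparing lengths.\<close>

lemma tree_label_eq:
  assumes "v \<in> carrier G" "w \<in> carrier G" "i < len v" "j < len w" "tree_label v i = tree_label w j"
  shows "i = j \<and> ancestor v (Suc i) = ancestor w (Suc j)"
proof -
  have l: "len (ancestor v i) = i" "len (ancestor v (Suc i)) = Suc i"
    "len (ancestor w j) = j" "len (ancestor w (Suc j)) = Suc j"
    using ancestor(2)[of v i] ancestor(2)[of v "Suc i"] ancestor(2)[of w j] ancestor(2)[of w "Suc j"] assms by auto
  have "ancestor v (Suc i) = ancestor w (Suc j)
      \<or> {ancestor v i, ancestor v (Suc i)} = {ancestor w j, ancestor w (Suc j)}"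
    using assms by (intro \<kappa>_inj ancestor_adj) (auto simp: tree_label_def)
  then have "ancestor v (Suc i) = ancestor w (Suc j)
      \<or> (ancestor v i = ancestor w (Suc j) \<and> ancestor v (Suc i) = ancestor w j)"
    by (auto simp: doubleton_eq_iff)
  then show ?thesis
  proof
    assume "ancestor v (Suc i) = ancestor w (Suc j)"
    then show ?thesis using l by (metis Suc_inject)
  next
    assume "ancestor v i = ancestor w (Suc j) \<and> ancestor v (Suc i) = ancestor w j"
    then have "len (ancestor v i) = len (ancestor w (Suc j))"
      "len (ancestor v (Suc i)) = len (ancestor w j)" by simp_all
    then show ?thesis using l by simp
  qed
qed

text \<open>Take for \<open>m\<close> the last level at which both tree paths agree. Beyond it the n
  - m labels of \<open>w\<close> differ from all n labels of \<open>v\<close>, because a shared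
  label would mean a shared later ancestor.\<close>

lemma card_tree_labels_Un_ge:
  assumes v: "v \<in> sphere n" and w: "w \<in> sphere n"
  obtains m where "m \<le> n" "ancestor v m = ancestor w m" "2 * n - m \<le> card (tree_labels v \<union> tree_labels w)"
proof -
  have vw: "v \<in> carrier G" "len v = n" "w \<in> carrier G" "len w = n" using v w by (auto simp: sphere_def)
  define m where "m = Max {j. j \<le> n \<and> ancestor v j = ancestor w j}"
  have fin: "finite {j. j \<le> n \<and> ancestor v j = ancestor w j}" by simp
  have "0 \<in> {j. j \<le> n \<and> ancestor v j = ancestor w j}" using vw by (simp add: ancestor_0)
  then have "m \<in> {j. j \<le> n \<and> ancestor v j = ancestor w j}"
    unfolding m_def by (intro Max_in[OF fin]) blast
  then have m: "m \<le> n" "ancestor v m = ancestor w m" by auto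
  have max: "j \<le> m" if "j \<le> n" "ancestor v j = ancestor w j" for j
    using Max_ge[OF fin, of j] that by (simp add: m_def)
  have inj: "inj_on (tree_label x) {..<n}" if "x \<in> carrier G" "len x = n" for x
    using tree_label_eq that by (auto intro!: inj_onI)
  have disj: "tree_label v ` {..<n} \<inter> tree_label w ` {m..<n} = {}"
  proof (rule equals0I)
    fix x assume x: "x \<in> tree_label v ` {..<n} \<inter> tree_label w ` {m..<n}"
    then obtain i where i: "x = tree_label v i" "i < n" by auto
    from x obtain j where j: "x = tree_label w j" "m \<le> j" "j < n" by auto
    from i j have ij: "i < n" "m \<le> j" "j < n" "tree_label v i = tree_label w j" by auto
    then have "i = j" "ancestor v (Suc i) = ancestor w (Suc j)"
      using tree_label_eq[of v w i j] vw by auto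
    then have "Suc j \<le> m" using max[of "Suc j"] ij by auto
    then show False using ij by simp
  qed
  have "inj_on (tree_label w) {m..<n}" using inj[OF vw(3,4)] by (rule inj_on_subset) auto
  then have "2 * n - m = card (tree_label v ` {..<n}) + card (tree_label w ` {m..<n})"
    using m inj[OF vw(1,2)] by (simp add: card_image)
  also have "\<dots> = card (tree_label v ` {..<n} \<union> tree_label w ` {m..<n})"
    by (rule card_Un_disjoint[symmetric]) (use disj in auto)
  also have "\<dots> \<le> card (tree_labels v \<union> tree_labels w)"
    by (intro card_mono finite_UnI finite_tree_labels) (auto simp: tree_labels_def vw)
  finally show ?thesis using that m by blast
qed

lemma tree_labels_open:
  assumes g: "g \<in> carrier G" and op: "\<forall>i\<in>tree_labels g. \<omega> i"
  shows "g \<in> cluster \<omega> \<one>"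
proof -
  have "alive \<omega> (ancestor g j) \<and> (\<one>, ancestor g j) \<in> (steps \<omega>)\<^sup>*" if "j \<le> len g" for j
    using that
  proof (induction j)
    case 0
    then show ?case using op g by (simp add: ancestor_0 alive_def tree_labels_def)
  next
    case (Suc j)
    have adj: "adj (ancestor g j) (ancestor g (Suc j))" using ancestor_adj g Suc by simp
    have lab: "\<omega> (\<kappa> (ancestor g j) (ancestor g (Suc j)))"
      using op Suc by (auto simp: tree_labels_def tree_label_def)
    then have "alive \<omega> (ancestor g (Suc j))" using J0_step[OF adj] Suc by (auto simp: alive_def)
    moreover have "(ancestor g j, ancestor g (Suc j)) \<in> steps \<omega>" using adj lab Suc by (auto simp: steps_def)
    ultimately show ?case using Suc by (auto intro: rtrancl.rtrancl_into_rtrancl)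
  qed
  from this[of "len g"] show ?thesis by (simp add: cluster_def)
qed

text \<open>The second moment of the number of vertices of a sphere joined to the identity inside a
  geodesic spanning tree. Subtrees of the tree are no larger than spheres, so a lower bound on
  the ratio of the sizes of consecutive spheres suffices.\<close>

theorem infinite_cluster_above:
  assumes p: "0 \<le> p" "p \<le> 1" and \<mu>: "0 < \<mu>" "1 < p * \<mu>"
    and growth: "\<And>n. \<mu> * real (card (sphere n)) \<le> real (card (sphere (Suc n)))"
  shows "\<P>(\<omega> in PM p. iclusters \<omega> \<noteq> {}) > 0"
proof -
  interpret prob_space "PM p" by (rule bernoulli_measure_prob_space)
  \<comment> \<open>Each further common level divides the number of partners by \<mu> and saves one
    factor \<open>p\<close> in the joint probability, so \<open>q\<close> is the ratio of the
    geometric series in the second moment.\<close>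
  define q where "q = 1 / (p * \<mu>)"
  have ppos: "0 < p" using \<mu> p by (metis less_eq_real_def mult_zero_left not_one_less_zero)
  have q: "0 < q" "q < 1" using \<mu> ppos by (auto simp: q_def)
  define c where "c = card (J0 \<one>)"
  define a where "a n = real (card (sphere n))" for n
  have growth_m: "\<mu> ^ m * a n \<le> a (n + m)" for m n
  proof (induction m)
    case (Suc m)
    have "\<mu> ^ Suc m * a n \<le> \<mu> * a (n + m)" using Suc \<mu> by (simp add: mult_left_mono)
    also have "\<dots> \<le> a (n + Suc m)" using growth[of "n + m"] by (simp add: a_def)
    finally show ?case .
  qed simp
  have apos: "0 < a n" for n
  proof -
    have "0 < \<mu> ^ n * a 0" using \<mu> by (simp add: a_def sphere_0)
    also have "\<dots> \<le> a n" using growth_m[of n 0] by simp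
    finally show ?thesis .
  qed
  define E where "E g = {\<omega> \<in> space (PM p). \<forall>i\<in>tree_labels g. \<omega> i}" for g
  define D where "D n = (\<Union>g\<in>sphere n. E g)" for n
  have sphereD: "g \<in> carrier G" "len g = n" if "g \<in> sphere n" for g n using that by (auto simp: sphere_def)
  have E_ev: "E g \<in> events" if "g \<in> carrier G" for g
    unfolding E_def using tree_labels_I[OF that] by (intro event pred_bernoulli_all_open) auto
  have probE: "prob (E g) = p ^ card (tree_labels g)" if "g \<in> carrier G" for g
    unfolding E_def by (rule bernoulli_measure_all_open[OF _ tree_labels_I[OF that] p]) simp
  \<comment> \<open>The last common level is replaced by a sum over all common levels, which allows
    the order of summation to be exchanged.\<close>
  have EE: "prob (E v \<inter> E w) \<le> (\<Sum>m\<le>n. if ancestor w m = ancestor v m then p ^ (2 * n - m) else 0)"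
    if v: "v \<in> sphere n" and w: "w \<in> sphere n" for v w n
  proof -
    obtain m where m: "m \<le> n" "ancestor v m = ancestor w m" "2 * n - m \<le> card (tree_labels v \<union> tree_labels w)"
      using card_tree_labels_Un_ge[OF v w] .
    have "E v \<inter> E w = {\<omega> \<in> space (PM p). \<forall>i\<in>tree_labels v \<union> tree_labels w. \<omega> i}"
      by (auto simp: E_def)
    then have "prob (E v \<inter> E w) = p ^ card (tree_labels v \<union> tree_labels w)"
      using tree_labels_I sphereD[OF v] sphereD[OF w] p
      by (subst bernoulli_measure_all_open[symmetric, of "tree_labels v \<union> tree_labels w" I p]) auto
    also have "\<dots> \<le> p ^ (2 * n - m)" using m p by (intro power_decreasing) auto
    also have "\<dots> = (if ancestor w m = ancestor v m then p ^ (2 * n - m) else 0)" using m by simp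
    also have "\<dots> \<le> (\<Sum>m\<le>n. if ancestor w m = ancestor v m then p ^ (2 * n - m) else 0)"
      using m p by (intro member_le_sum[of m "{..n}"]) auto
    finally show ?thesis .
  qed
  have lower: "p ^ (2 * c) * (1 - q) \<le> prob (D n)" for n
  proof -
    \<comment> \<open>\<alpha> bounds the first moment from below and \<beta> the second from above.
      With t = \<alpha> / \<beta> the moment bound is \<alpha>^2 / \<beta>, in which the sphere size
      cancels; \<open>c\<close> accounts for the labels of the root.\<close>
    define \<alpha> where "\<alpha> = a n * p ^ (n + c)"
    define \<beta> where "\<beta> = (a n)\<^sup>2 * p ^ (2 * n) / (1 - q)"
    have pos: "0 < \<alpha>" "0 < \<beta>" using apos[of n] ppos q by (auto simp: \<alpha>_def \<beta>_def)
    have first: "\<alpha> \<le> (\<Sum>g\<in>sphere n. prob (E g))"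
    proof -
      have "\<alpha> = (\<Sum>g\<in>sphere n. p ^ (n + c))" by (simp add: \<alpha>_def a_def)
      also have "\<dots> \<le> (\<Sum>g\<in>sphere n. prob (E g))"
      proof (intro sum_mono)
        fix g assume g: "g \<in> sphere n"
        have "card (tree_labels g) \<le> n + c"
          using card_tree_labels_le[of g] sphereD[OF g] by (simp add: c_def)
        then show "p ^ (n + c) \<le> prob (E g)"
          unfolding probE[OF sphereD(1)[OF g]] using p by (intro power_decreasing) auto
      qed
      finally show ?thesis .
    qed
    have second: "(\<Sum>v\<in>sphere n. \<Sum>w\<in>sphere n. prob (E v \<inter> E w)) \<le> \<beta>"
    proof -
      have "(\<Sum>v\<in>sphere n. \<Sum>w\<in>sphere n. prob (E v \<inter> E w))
          \<le> (\<Sum>v\<in>sphere n. \<Sum>w\<in>sphere n. \<Sum>m\<le>n. if ancestor w m = ancestor v m then p ^ (2 * n - m) else 0)"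
        by (intro sum_mono EE; assumption)
      also have "\<dots> = (\<Sum>v\<in>sphere n. \<Sum>m\<le>n. \<Sum>w\<in>sphere n. if ancestor w m = ancestor v m then p ^ (2 * n - m) else 0)"
        by (intro sum.cong refl sum.swap)
      also have "\<dots> = (\<Sum>v\<in>sphere n. \<Sum>m\<le>n. real (card {w \<in> sphere n. ancestor w m = ancestor v m}) * p ^ (2 * n - m))"
        by (simp add: sum.If_cases Int_def)
      also have "\<dots> \<le> (\<Sum>v\<in>sphere n. \<Sum>m\<le>n. a n * p ^ (2 * n) * q ^ m)"
      proof (intro sum_mono)
        fix v m assume "v \<in> sphere n" "m \<in> {..n}"
        then have m: "m \<le> n" by simp
        have "real (card {w \<in> sphere n. ancestor w m = ancestor v m}) \<le> a (n - m)"
          unfolding a_def using card_descendants_le[OF m] by simp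
        also have "\<dots> \<le> a n / \<mu> ^ m"
          using growth_m[of m "n - m"] m \<mu> by (simp add: field_simps)
        finally have "real (card {w \<in> sphere n. ancestor w m = ancestor v m}) * p ^ (2 * n - m)
            \<le> a n / \<mu> ^ m * p ^ (2 * n - m)" using p by (intro mult_right_mono) auto
        also have "a n / \<mu> ^ m * p ^ (2 * n - m) = a n / \<mu> ^ m * (p ^ (2 * n) / p ^ m)"
          using ppos m by (subst power_diff) auto
        also have "\<dots> = a n * p ^ (2 * n) * q ^ m"
          by (simp add: q_def power_divide power_mult_distrib mult_ac)
        finally show "real (card {w \<in> sphere n. ancestor w m = ancestor v m}) * p ^ (2 * n - m)
            \<le> a n * p ^ (2 * n) * q ^ m" .
      qed
      also have "\<dots> = a n * (a n * p ^ (2 * n)) * (\<Sum>m\<le>n. q ^ m)"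
        by (simp add: a_def mult.assoc flip: sum_distrib_left)
      also have "\<dots> \<le> a n * (a n * p ^ (2 * n)) * (1 / (1 - q))"
      proof (rule mult_left_mono)
        have "(\<Sum>m\<le>n. q ^ m) \<le> (\<Sum>m. q ^ m)"
          using q by (intro sum_le_suminf) (auto intro: summable_geometric)
        then show "(\<Sum>m\<le>n. q ^ m) \<le> 1 / (1 - q)" using q by (simp add: suminf_geometric)
      qed (use apos[of n] p in auto)
      also have "\<dots> = \<beta>" by (simp add: \<beta>_def power2_eq_square)
      finally show ?thesis .
    qed
    have "p ^ (2 * c) * (1 - q) = 2 * (\<alpha> / \<beta>) * \<alpha> - (\<alpha> / \<beta>)\<^sup>2 * \<beta>"
    proof -
      have "2 * (\<alpha> / \<beta>) * \<alpha> - (\<alpha> / \<beta>)\<^sup>2 * \<beta> = \<alpha>\<^sup>2 / \<beta>"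
        using pos by (simp add: field_simps power2_eq_square)
      also have "\<alpha>\<^sup>2 = (a n)\<^sup>2 * p ^ (2 * n) * p ^ (2 * c)"
        by (simp add: \<alpha>_def power_add power_mult power2_eq_square power_mult_distrib)
      also have "(a n)\<^sup>2 * p ^ (2 * n) * p ^ (2 * c) / \<beta> = p ^ (2 * c) * (1 - q)"
        using apos[of n] ppos q by (simp add: \<beta>_def)
      finally show ?thesis by simp
    qed
    also have "\<dots> \<le> 2 * (\<alpha> / \<beta>) * (\<Sum>g\<in>sphere n. prob (E g))
        - (\<alpha> / \<beta>)\<^sup>2 * (\<Sum>v\<in>sphere n. \<Sum>w\<in>sphere n. prob (E v \<inter> E w))"
      using first second pos by (intro diff_mono mult_left_mono) auto
    also have "\<dots> \<le> prob (D n)"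
      unfolding D_def using E_ev sphereD by (intro second_moment_bound) auto
    finally show ?thesis .
  qed
  have D_ev: "D n \<in> events" for n
    unfolding D_def using E_ev sphereD by (intro sets.finite_UN) auto
  \<comment> \<open>The tree path to an element contains the path to its parent. Nestedness carries
    the uniform lower bound over to the intersection, where the cluster of the identity reaches
    every level.\<close>
  have "D (Suc n) \<subseteq> D n" for n
  proof
    fix \<omega> assume "\<omega> \<in> D (Suc n)"
    then obtain g where g: "g \<in> sphere (Suc n)" "\<omega> \<in> E g" by (auto simp: D_def)
    note gc = sphereD[OF g(1)]
    obtain u where u: "u \<in> N" "parent g = g \<otimes> r u" "len (parent g) + 1 = len g"
      using parent[of g] gc by auto
    have "tree_label (parent g) j = tree_label g j" if "j < n" for j
      using that ancestor_of_parent[OF gc(1)] gc u by (simp add: tree_label_def)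
    then have "tree_labels (parent g) \<subseteq> tree_labels g" using u gc by (auto simp: tree_labels_def)
    then have "\<omega> \<in> E (parent g)" using g by (auto simp: E_def)
    moreover have "parent g \<in> sphere n" using u gc r_closed by (simp add: sphere_def)
    ultimately show "\<omega> \<in> D n" by (auto simp: D_def)
  qed
  then have dec: "decseq D" by (rule decseq_SucI)
  have "(\<lambda>n. prob (D n)) \<longlonglongrightarrow> prob (\<Inter>n. D n)"
    using D_ev dec by (intro finite_Lim_measure_decseq) auto
  then have "p ^ (2 * c) * (1 - q) \<le> prob (\<Inter>n. D n)"
    by (rule LIMSEQ_le_const) (use lower in auto)
  also have "prob (\<Inter>n. D n) \<le> \<P>(\<omega> in PM p. iclusters \<omega> \<noteq> {})"
  proof (rule finite_measure_mono)
    show "(\<Inter>n. D n) \<subseteq> {\<omega> \<in> space (PM p). iclusters \<omega> \<noteq> {}}"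
    proof
      fix \<omega> assume \<omega>: "\<omega> \<in> (\<Inter>n. D n)"
      have far: "\<exists>g\<in>carrier G. len g = n \<and> \<omega> \<in> E g" for n
        using \<omega> sphereD by (fastforce simp: D_def)
      then have "\<omega> \<in> space (PM p)" "alive \<omega> \<one>"
        by (auto simp: E_def alive_def tree_labels_def)
      moreover have "infinite (cluster \<omega> \<one>)"
        unfolding infinite_iff_unbounded_len[OF cluster_subset[OF one_closed]]
      proof
        fix n
        obtain g where "g \<in> carrier G" "len g = n" "\<omega> \<in> E g" using far by blast
        then show "\<exists>w\<in>carrier G. n \<le> len w \<and> w \<in> cluster \<omega> \<one>"
          using tree_labels_open by (auto simp: E_def)
      qed
      ultimately show "\<omega> \<in> {\<omega> \<in> space (PM p). iclusters \<omega> \<noteq> {}}"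
        by (auto simp: iclusters_nonempty_iff infinite_at_def)
    qed
  qed (rule event[OF pred_iclusters])
  finally have "p ^ (2 * c) * (1 - q) \<le> \<P>(\<omega> in PM p. iclusters \<omega> \<noteq> {})" .
  moreover have "0 < p ^ (2 * c) * (1 - q)" using ppos q by simp
  ultimately show ?thesis by linarith
qed

end

section \<open>Lorentzian geometry\<close>

interpretation lorentz: bounded_bilinear lorentz
proof
  fix a a' b b' :: minkowski and r :: real
  show "lorentz (a + a') b = lorentz a b + lorentz a' b" "lorentz a (b + b') = lorentz a b + lorentz a b'"
    "lorentz (r *\<^sub>R a) b = r *\<^sub>R lorentz a b" "lorentz a (r *\<^sub>R b) = r *\<^sub>R lorentz a b"
    by (simp_all add: lorentz_def inner_add_left inner_add_right algebra_simps)
  show "\<exists>K. \<forall>a b. norm (lorentz a b) \<le> norm a * norm b * K"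
  proof (intro exI allI)
    fix a b :: minkowski
    have "norm (lorentz a b) \<le> norm (fst a) * norm (fst b) + norm (snd a) * norm (snd b)"
      unfolding lorentz_def using Cauchy_Schwarz_ineq2[of "fst a" "fst b"]
      by (auto simp: abs_mult intro: order_trans[OF abs_triangle_ineq4])
    also have "\<dots> \<le> norm a * norm b + norm a * norm b"
      using norm_fst_le[of "fst a" "snd a"] norm_fst_le[of "fst b" "snd b"]
        norm_snd_le[of "snd a" "fst a"] norm_snd_le[of "snd b" "fst b"]
      by (intro add_mono mult_mono) auto
    finally show "norm (lorentz a b) \<le> norm a * norm b * 2" by simp
  qed
qed

lemmas lorentz_expand = lorentz.add_left lorentz.add_right lorentz.diff_left lorentz.diff_right
  lorentz.scaleR_left lorentz.scaleR_right lorentz.minus_left lorentz.minus_right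

lemma lorentz_commute: "lorentz x y = lorentz y x"
  by (simp add: lorentz_def inner_commute mult.commute)

lemma linear_lorentz_left: "linear (\<lambda>x. lorentz x w)"
  by (intro linearI) (simp_all add: lorentz_expand)

text \<open>The open convex cone over \<open>H3\<close>: sums and small linear displacements stay in
  it, whereas they leave the hyperboloid. Normalization is postponed to the end.\<close>

definition future :: "minkowski set" where
  "future = {x. lorentz x x < 0 \<and> snd x > 0}"

lemma H3_subset_future: "H3 \<subseteq> future"
  by (auto simp: H3_def future_def)

lemma norm_fst_less_future: "x \<in> future \<Longrightarrow> norm (fst x) < snd x"
  by (simp add: future_def lorentz_def flip: power2_norm_eq_inner power2_eq_square)
    (metis less_imp_le power2_less_imp_less)

lemma lorentz_future_causal:
  assumes x: "x \<in> future" and y: "lorentz y y \<le> 0" "snd y > 0"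
  shows "lorentz x y < 0"
proof -
  have "(norm (fst y))\<^sup>2 \<le> (snd y)\<^sup>2"
    unfolding power2_norm_eq_inner using y by (simp add: lorentz_def power2_eq_square)
  then have "norm (fst y) \<le> snd y" using y by (auto intro: power2_le_imp_le)
  have "fst x \<bullet> fst y \<le> norm (fst x) * norm (fst y)" by (rule norm_cauchy_schwarz)
  also have "\<dots> \<le> norm (fst x) * snd y" using \<open>norm (fst y) \<le> snd y\<close> by (intro mult_left_mono) auto
  also have "\<dots> < snd x * snd y" using norm_fst_less_future[OF x] y by simp
  finally show ?thesis by (simp add: lorentz_def)
qed

lemma lorentz_future_neg: "x \<in> future \<Longrightarrow> y \<in> future \<Longrightarrow> lorentz x y < 0"
  by (rule lorentz_future_causal) (auto simp: future_def)

lemma future_scaleR: "x \<in> future \<Longrightarrow> c > 0 \<Longrightarrow> c *\<^sub>R x \<in> future"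
  by (simp add: future_def lorentz_expand mult_pos_neg)

lemma future_add: "x \<in> future \<Longrightarrow> y \<in> future \<Longrightarrow> x + y \<in> future"
  using lorentz_future_neg[of x y] lorentz_commute[of x y] by (simp add: future_def lorentz_expand)

lemma future_normalize:
  assumes "x \<in> future"
  obtains c where "c > 0" "c *\<^sub>R x \<in> H3"
proof (rule that[of "1 / sqrt (- lorentz x x)"])
  show "1 / sqrt (- lorentz x x) > 0" using assms by (simp add: future_def)
  show "(1 / sqrt (- lorentz x x)) *\<^sub>R x \<in> H3"
    using assms by (simp add: future_def H3_def lorentz_expand divide_simps)
qed

text \<open>A causal vector has nonzero time component, so it or its negative is future-directed;
  neither can be orthogonal to a timelike future vector by
  \<open>lorentz_future_causal\<close>.\<close>

lemma spacelike_if_orthogonal_future: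
  assumes x: "x \<in> future" and w: "lorentz x w = 0" "w \<noteq> 0"
  shows "lorentz w w > 0"
proof (rule ccontr)
  assume "\<not> lorentz w w > 0"
  then have c: "lorentz w w \<le> 0" by simp
  have "snd w \<noteq> 0"
  proof
    assume "snd w = 0"
    then have "fst w \<bullet> fst w = 0" using c inner_ge_zero[of "fst w"] by (simp add: lorentz_def)
    then have "fst w = 0" by simp
    then show False using w \<open>snd w = 0\<close> by (simp add: prod_eq_iff)
  qed
  then show False
  proof (cases "snd w > 0")
    case True
    then show ?thesis using lorentz_future_causal[OF x c] w by simp
  next
    case False
    then show ?thesis using lorentz_future_causal[OF x, of "- w"] c w \<open>snd w \<noteq> 0\<close>
      by (simp add: lorentz_expand)
  qed
qed

lemma future_if_timelike:
  assumes x: "x \<in> future" and y: "lorentz y y < 0" "lorentz x y < 0"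
  shows "y \<in> future"
proof -
  have "snd y \<noteq> 0"
  proof
    assume "snd y = 0"
    then have "fst y \<bullet> fst y < 0" using y by (simp add: lorentz_def)
    then show False using inner_ge_zero[of "fst y"] by linarith
  qed
  moreover have "\<not> snd y < 0"
  proof
    assume "snd y < 0"
    then have "- y \<in> future" using y by (simp add: future_def lorentz_expand)
    then show False using lorentz_future_neg[OF x] y by (fastforce simp: lorentz_expand)
  qed
  ultimately show ?thesis using y by (simp add: future_def)
qed

lemma eventually_future:
  assumes "x \<in> future"
  shows "eventually (\<lambda>t. x + t *\<^sub>R d \<in> future) (at_right 0)"
proof -
  have "((\<lambda>t. lorentz (x + t *\<^sub>R d) (x + t *\<^sub>R d)) \<longlongrightarrow> lorentz (x + 0 *\<^sub>R d) (x + 0 *\<^sub>R d)) (at_right 0)"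
    "((\<lambda>t. snd (x + t *\<^sub>R d)) \<longlongrightarrow> snd (x + 0 *\<^sub>R d)) (at_right 0)"
    by (intro tendsto_intros lorentz.tendsto)+
  then have "eventually (\<lambda>t. lorentz (x + t *\<^sub>R d) (x + t *\<^sub>R d) < 0) (at_right 0)"
    "eventually (\<lambda>t. snd (x + t *\<^sub>R d) > 0) (at_right 0)"
    using assms by (auto simp: future_def intro: order_tendstoD)
  then show ?thesis by eventually_elim (simp add: future_def)
qed

lemma eventually_lorentz_neg:
  assumes "lorentz x w < 0"
  shows "eventually (\<lambda>t. lorentz (x + t *\<^sub>R d) w < 0) (at_right (0::real))"
proof -
  have "((\<lambda>t. lorentz (x + t *\<^sub>R d) w) \<longlongrightarrow> lorentz (x + 0 *\<^sub>R d) w) (at_right 0)"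
    by (intro tendsto_intros lorentz.tendsto)
  then show ?thesis using assms by (auto intro: order_tendstoD)
qed

lemma small_step:
  assumes x: "x \<in> future" and W: "finite W"
    "\<And>w. w \<in> W \<Longrightarrow> lorentz x w < 0 \<or> lorentz x w \<le> 0 \<and> lorentz d w \<le> 0"
  obtains t :: real where "0 < t" "x + t *\<^sub>R d \<in> future" "\<forall>w\<in>W. lorentz (x + t *\<^sub>R d) w \<le> 0"
proof -
  have "eventually (\<lambda>t. lorentz (x + t *\<^sub>R d) w \<le> 0) (at_right (0::real))" if "w \<in> W" for w
    using W(2)[OF that]
  proof
    assume "lorentz x w < 0"
    from eventually_lorentz_neg[OF this, of d] show ?thesis by eventually_elim simp
  next
    assume "lorentz x w \<le> 0 \<and> lorentz d w \<le> 0"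
    then show ?thesis
      using eventually_at_right_less[of "0::real"]
      by (auto elim!: eventually_mono simp: lorentz_expand intro: add_nonpos_nonpos mult_nonneg_nonpos less_imp_le)
  qed
  then have "eventually (\<lambda>t. \<forall>w\<in>W. lorentz (x + t *\<^sub>R d) w \<le> 0) (at_right (0::real))"
    using W(1) by (simp add: eventually_ball_finite)
  then have "eventually (\<lambda>t. 0 < t \<and> x + t *\<^sub>R d \<in> future \<and> (\<forall>w\<in>W. lorentz (x + t *\<^sub>R d) w \<le> 0)) (at_right (0::real))"
    using eventually_future[OF x, of d] eventually_at_right_less[of "0::real"] by eventually_elim auto
  then show ?thesis using that eventually_happens by force
qed

section \<open>Orthogonality and dimension\<close>

lemma lorentz_self_combination:
  assumes "finite Y" "\<And>u. u \<in> Y \<Longrightarrow> lorentz u u = 1" "pairwise (\<lambda>u v. lorentz u v = 0) Y"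
  shows "v \<in> Y \<Longrightarrow> lorentz (\<Sum>u\<in>Y. a u *\<^sub>R u) v = a v"
    and "lorentz (\<Sum>u\<in>Y. a u *\<^sub>R u) (\<Sum>u\<in>Y. a u *\<^sub>R u) = (\<Sum>u\<in>Y. (a u)\<^sup>2)"
proof -
  have *: "lorentz (\<Sum>u\<in>Y. a u *\<^sub>R u) v = a v" if "v \<in> Y" for v
  proof -
    have "lorentz (\<Sum>u\<in>Y. a u *\<^sub>R u) v = (\<Sum>u\<in>Y. a u * lorentz u v)"
      by (simp add: lorentz.sum_left lorentz_expand)
    also have "\<dots> = (\<Sum>u\<in>Y. if u = v then a v else 0)"
      using assms that by (intro sum.cong) (auto simp: pairwise_def)
    also have "\<dots> = a v" using assms that by simp
    finally show ?thesis .
  qed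
  then show "v \<in> Y \<Longrightarrow> lorentz (\<Sum>u\<in>Y. a u *\<^sub>R u) v = a v" .
  show "lorentz (\<Sum>u\<in>Y. a u *\<^sub>R u) (\<Sum>u\<in>Y. a u *\<^sub>R u) = (\<Sum>u\<in>Y. (a u)\<^sup>2)"
    using * by (simp add: lorentz.sum_right lorentz_expand power2_eq_square)
qed


lemma independent_orthonormal:
  assumes "finite Y" "\<And>u. u \<in> Y \<Longrightarrow> lorentz u u = 1" "pairwise (\<lambda>u v. lorentz u v = 0) Y"
  shows "independent Y"
proof
  assume "dependent Y"
  then obtain a v where av: "v \<in> Y" "a v \<noteq> 0" "(\<Sum>u\<in>Y. a u *\<^sub>R u) = 0"
    using assms(1) by (auto simp: dependent_finite)
  then show False using lorentz_self_combination(1)[OF assms av(1), of a]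
    by (simp add: lorentz.zero_left)
qed

text \<open>Four such vectors would be a basis of the four-dimensional space, and the form would be
  positive semidefinite; but (0, 1) is timelike.\<close>

lemma card_orthonormal_spacelike:
  assumes unit: "\<And>u. u \<in> X \<Longrightarrow> lorentz u u = 1" and orth: "pairwise (\<lambda>u v. lorentz u v = 0) X"
  shows "card X \<le> 3"
proof (rule ccontr)
  assume "\<not> card X \<le> 3"
  then obtain Y where Y: "Y \<subseteq> X" "card Y = 4" "finite Y"
    by (metis not_less_eq_eq numeral_3_eq_3 numeral_eq_Suc obtain_subset_with_card_n pred_numeral_simps(2) semiring_norm(26) semiring_norm(27))
  then have Y': "\<And>u. u \<in> Y \<Longrightarrow> lorentz u u = 1" "pairwise (\<lambda>u v. lorentz u v = 0) Y"
    using unit orth by (auto intro: pairwise_subset)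
  have "UNIV \<subseteq> span Y"
    using independent_orthonormal[OF Y(3) Y'] Y by (intro card_ge_dim_independent) (auto simp: dim_UNIV)
  then have "(0, 1) \<in> span Y" by auto
  then obtain a where a: "(\<Sum>u\<in>Y. a u *\<^sub>R u) = (0, 1)"
    using Y(3) by (auto simp: span_finite)
  have "0 \<le> (\<Sum>u\<in>Y. (a u)\<^sup>2)" by (intro sum_nonneg) auto
  then show False
    using lorentz_self_combination(2)[OF Y(3) Y', of a] by (simp add: a lorentz_def)
qed

definition lorentz_perp :: "minkowski set \<Rightarrow> minkowski set" where
  "lorentz_perp A = {x. \<forall>u\<in>A. lorentz x u = 0}"

lemma subspace_lorentz_perp: "subspace (lorentz_perp A)"
  by (auto simp: subspace_def lorentz_perp_def lorentz_expand lorentz.zero_left)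

lemma dim_lorentz_perp:
  assumes "independent A"
  shows "dim (lorentz_perp A) = 4 - card A"
proof -
  \<comment> \<open>Flipping the sign of time turns Lorentz into Euclidean orthogonality, for which
    the dimension formula is available.\<close>
  define J :: "minkowski \<Rightarrow> minkowski" where "J u = (fst u, - snd u)" for u
  have J: "linear J" "inj J" by (auto intro!: linearI injI simp: J_def prod_eq_iff)
  have inner: "lorentz x u = x \<bullet> J u" for x u by (simp add: lorentz_def J_def inner_prod_def)
  have "lorentz_perp A = {y \<in> UNIV. \<forall>x\<in>J ` A. orthogonal x y}"
    by (auto simp: lorentz_perp_def inner orthogonal_def inner_commute)
  also have "\<dots> = {y \<in> UNIV. \<forall>x\<in>span (J ` A). orthogonal x y}"
  proof (intro Collect_cong conj_cong refl iffI ballI)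
    fix x y assume "\<forall>x\<in>J ` A. orthogonal x y" "x \<in> span (J ` A)"
    then show "orthogonal x y" using orthogonal_to_span[of x "J ` A" y] orthogonal_commute by blast
  next
    fix x y assume "\<forall>x\<in>span (J ` A). orthogonal x y" "x \<in> J ` A"
    then show "orthogonal x y" by (simp only: span_base)
  qed
  finally have "dim (lorentz_perp A) + dim (span (J ` A)) = 4"
    using dim_subspace_orthogonal_to_vectors[of "span (J ` A)" UNIV] by simp
  moreover have "dim (span (J ` A)) = card A"
    using linear_independent_injective_image[OF J(1) assms inj_on_subset[OF J(2)]]
      card_image[OF inj_on_subset[OF J(2)], of A]
    by (simp add: dim_eq_card_independent)
  ultimately show ?thesis by simp
qed

lemma independent_unit_pair:
  assumes "lorentz u u = 1" "lorentz v v = 1" "v \<noteq> u" "v \<noteq> - u"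
  shows "independent {u, v}"
proof -
  have "v \<notin> span {u}"
  proof
    assume "v \<in> span {u}"
    then obtain c where c: "v = c *\<^sub>R u" by (auto simp: span_singleton)
    then have "c * c = 1" using assms by (simp add: lorentz_expand)
    then have "c = 1 \<or> c = -1" by (metis square_eq_1_iff)
    then show False using c assms by auto
  qed
  moreover have "u \<noteq> 0" using assms by (auto simp: lorentz.zero_left)
  ultimately show ?thesis
    by (metis independent_insert independent_empty insert_commute span_empty singletonD insert_absorb)
qed

section \<open>Generic points\<close>

text \<open>Treat the functionals one at a time: a small move along a direction where the new one is
  nonzero preserves \<open>Q\<close> and the nonvanishing already achieved.\<close>

lemma generic_point:
  fixes L :: "'a::real_normed_vector set" and F :: "('a \<Rightarrow> real) set"
  assumes "finite F" and F: "\<And>f. f \<in> F \<Longrightarrow> linear f \<and> (\<exists>d\<in>L. f d \<noteq> 0)"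
    and L: "subspace L" and x1: "x1 \<in> L" "Q x1"
    and Q: "\<And>x d. x \<in> L \<Longrightarrow> Q x \<Longrightarrow> d \<in> L \<Longrightarrow> eventually (\<lambda>t. Q (x + t *\<^sub>R d)) (at_right (0::real))"
  obtains x where "x \<in> L" "Q x" "\<And>f. f \<in> F \<Longrightarrow> f x \<noteq> 0"
proof -
  have "\<exists>x\<in>L. Q x \<and> (\<forall>f\<in>F. f x \<noteq> 0)"
    using assms(1) F
  proof (induction F)
    case empty
    then show ?case using x1 by blast
  next
    case (insert f F)
    then obtain x where x: "x \<in> L" "Q x" "\<forall>f\<in>F. f x \<noteq> 0" by auto
    show ?case
    proof (cases "f x = 0")
      case False
      then show ?thesis using x by auto
    next
      case True
      obtain d where d: "d \<in> L" "f d \<noteq> 0" using insert.prems by blast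
      have "eventually (\<lambda>t. g (x + t *\<^sub>R d) \<noteq> 0) (at_right (0::real))" if g: "g \<in> F" for g
      proof -
        interpret g: linear g using insert.prems g by blast
        have "((\<lambda>t. g x + t * g d) \<longlongrightarrow> g x + 0 * g d) (at_right 0)"
          by (intro tendsto_intros)
        then have "eventually (\<lambda>t. g x + t * g d \<noteq> 0) (at_right 0)"
          using x g by (intro tendsto_imp_eventually_ne) auto
        then show ?thesis by (simp add: g.add g.scale)
      qed
      then have "eventually (\<lambda>t. \<forall>g\<in>F. g (x + t *\<^sub>R d) \<noteq> 0) (at_right (0::real))"
        using insert.hyps by (simp add: eventually_ball_finite)
      then have "eventually (\<lambda>t. (0::real) < t \<and> Q (x + t *\<^sub>R d) \<and> (\<forall>g\<in>F. g (x + t *\<^sub>R d) \<noteq> 0)) (at_right 0)"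
        using Q[OF x(1,2) d(1)] eventually_at_right_less[of "0::real"] by eventually_elim auto
      then obtain t :: real where t: "0 < t" "Q (x + t *\<^sub>R d)" "\<forall>g\<in>F. g (x + t *\<^sub>R d) \<noteq> 0"
        using eventually_happens by force
      interpret f: linear f using insert.prems by blast
      have "f (x + t *\<^sub>R d) \<noteq> 0" using True t d by (simp add: f.add f.scale)
      moreover have "x + t *\<^sub>R d \<in> L" using x d L by (simp add: subspace_add subspace_scale)
      ultimately show ?thesis using t by auto
    qed
  qed
  then show ?thesis using that by blast
qed

text \<open>Moving from a generic point towards \<open>z\<close>, the boundary of the region cut out by the
  functionals \<open>lorentz _ w\<close> is crossed at a point where, within \<open>L\<close>, only one wall is met.\<close>

lemma generic_exit:
  assumes W: "finite W" and L: "subspace L" and x1: "x1 \<in> L" "x1 \<in> future" "\<And>w. w \<in> W \<Longrightarrow> lorentz x1 w < 0"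
    and z: "z \<in> L" "z \<in> future" and w0: "w0 \<in> W" "lorentz z w0 > 0"
  obtains w q where "w \<in> W" "lorentz z w > 0" "q \<in> L" "q \<in> future" "lorentz q w = 0"
    "\<forall>w'\<in>W. lorentz q w' < 0 \<or> (\<exists>c>0. \<forall>x\<in>L. lorentz x w' = c * lorentz x w)"
proof -
  \<comment> \<open>For walls positive at \<open>z\<close>, \<open>\<phi> w w'\<close> vanishes at
    \<open>x\<close> exactly if the ray from \<open>x\<close> in direction \<open>z\<close> meets
    both at the same time. A generic \<open>x\<close> permits this only if \<phi> vanishes on all of
    \<open>L\<close>, so that the two walls are proportional there.\<close>
  define \<phi> where "\<phi> w w' = (\<lambda>x. lorentz x (lorentz z w' *\<^sub>R w - lorentz z w *\<^sub>R w'))" for w w'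
  define F where "F = {f \<in> (\<lambda>(w, w'). \<phi> w w') ` (W \<times> W). \<exists>d\<in>L. f d \<noteq> 0}"
  obtain x where x: "x \<in> L" "x \<in> future \<and> (\<forall>w\<in>W. lorentz x w < 0)" "\<And>f. f \<in> F \<Longrightarrow> f x \<noteq> 0"
  proof (rule generic_point[of F L x1 "\<lambda>x. x \<in> future \<and> (\<forall>w\<in>W. lorentz x w < 0)"])
    show "finite F" using W by (simp add: F_def)
    show "linear f \<and> (\<exists>d\<in>L. f d \<noteq> 0)" if "f \<in> F" for f
      using that by (auto simp: F_def \<phi>_def linear_lorentz_left)
    show "eventually (\<lambda>t. x + t *\<^sub>R d \<in> future \<and> (\<forall>w\<in>W. lorentz (x + t *\<^sub>R d) w < 0)) (at_right 0)"
      if "x \<in> future \<and> (\<forall>w\<in>W. lorentz x w < 0)" for x d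
      using that W by (intro eventually_conj eventually_future eventually_ball_finite)
        (auto intro: eventually_lorentz_neg)
  qed (use L x1 in auto)
  define V where "V = {w \<in> W. lorentz z w > 0}"
  define \<rho> where "\<rho> w = - lorentz x w / lorentz z w" for w
  have "w0 \<in> V" using w0 by (simp add: V_def)
  then have V: "finite V" "V \<noteq> {}" using W unfolding V_def by (simp, blast)
  obtain w where w: "w \<in> V" "\<And>w'. w' \<in> V \<Longrightarrow> \<rho> w \<le> \<rho> w'"
    using ex_min_if_finite[of "\<rho> ` V"] V by (metis (no_types, lifting) finite_imageI image_iff image_is_empty not_le)
  have wW: "w \<in> W" "lorentz z w > 0" using w by (auto simp: V_def)
  have rpos: "\<rho> w > 0" using wW x by (simp add: \<rho>_def divide_neg_pos)
  \<comment> \<open>Up to positive scaling, the points x + \<rho> z with \<rho> > 0 are those of the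
    open segment from \<open>x\<close> to \<open>z\<close>.\<close>
  define q where "q = x + \<rho> w *\<^sub>R z"
  have qw: "lorentz q w' = lorentz x w' + \<rho> w * lorentz z w'" for w'
    by (simp add: q_def lorentz_expand)
  show ?thesis
  proof (rule that[OF wW])
    show "q \<in> L" using x z L by (simp add: q_def subspace_add subspace_scale)
    show "q \<in> future" using x z rpos by (simp add: q_def future_add future_scaleR)
    show "lorentz q w = 0" using wW by (simp add: qw \<rho>_def)
    have "lorentz q w' < 0 \<or> (\<exists>c>0. \<forall>x\<in>L. lorentz x w' = c * lorentz x w)" if w': "w' \<in> W" for w'
    proof (cases "lorentz z w' > 0")
      case False
      then have "\<rho> w * lorentz z w' \<le> 0" using rpos by (simp add: mult_nonneg_nonpos)
      then show ?thesis using x w' by (auto simp: qw intro: add_neg_nonpos)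
    next
      case True
      have q': "lorentz q w' = lorentz z w' * (\<rho> w - \<rho> w')"
        using True by (simp add: qw \<rho>_def field_simps)
      show ?thesis
      proof (cases "\<rho> w = \<rho> w'")
        case False
        then have "\<rho> w < \<rho> w'" using w(2)[of w'] w' True by (simp add: V_def)
        then show ?thesis using q' True by (simp add: mult_pos_neg)
      next
        case eq: True
        have "\<phi> w w' x = 0"
          using eq True wW by (simp add: \<phi>_def \<rho>_def lorentz_expand field_simps)
        then have "\<phi> w w' \<notin> F" using x(3) by blast
        then have "\<phi> w w' d = 0" if "d \<in> L" for d using that wW w' by (auto simp: F_def)
        then have "lorentz d w' = lorentz z w' / lorentz z w * lorentz d w" if "d \<in> L" for d
          using that wW by (simp add: \<phi>_def lorentz_expand field_simps)
        moreover have "lorentz z w' / lorentz z w > 0" using True wW by simp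
        ultimately show ?thesis by blast
      qed
    qed
    then show "\<forall>w'\<in>W. lorentz q w' < 0 \<or> (\<exists>c>0. \<forall>x\<in>L. lorentz x w' = c * lorentz x w)" ..
  qed
qed

text \<open>Near \<open>q\<close> the slice contains, up to scaling, a full neighbourhood in
  \<open>L\<close>: walls strictly avoided at \<open>q\<close> remain so, the others contain
  \<open>L\<close>. This converts generic points into dimensions of faces and edges.\<close>

lemma span_polyhedron_slice:
  assumes W: "finite W" and L: "subspace L" and q: "q \<in> L" "q \<in> future"
    and walls: "\<And>w. w \<in> W \<Longrightarrow> lorentz q w < 0 \<or> (\<forall>x\<in>L. lorentz x w = 0)"
  shows "L \<subseteq> span (H3 \<inter> (\<Inter>w\<in>W. hhalfspace w) \<inter> L)" (is "_ \<subseteq> span ?S")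
proof -
  have S: "x \<in> span ?S" if x: "x \<in> L" "x \<in> future" "\<And>w. w \<in> W \<Longrightarrow> lorentz x w \<le> 0" for x
  proof -
    obtain c where c: "c > 0" "c *\<^sub>R x \<in> H3" using future_normalize[OF x(2)] .
    then have "c *\<^sub>R x \<in> ?S"
      using x L by (auto simp: hhalfspace_def lorentz_expand subspace_scale mult_le_0_iff)
    then have "(1 / c) *\<^sub>R (c *\<^sub>R x) \<in> span ?S" by (rule span_scale[OF span_base])
    then show ?thesis using c by simp
  qed
  show ?thesis
  proof
    fix d assume d: "d \<in> L"
    obtain t :: real where t: "0 < t" "q + t *\<^sub>R d \<in> future" "\<forall>w\<in>W. lorentz (q + t *\<^sub>R d) w \<le> 0"
    proof (rule small_step[OF q(2) W, of d])
      show "lorentz q w < 0 \<or> lorentz q w \<le> 0 \<and> lorentz d w \<le> 0" if "w \<in> W" for w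
        using walls[OF that] q(1) d by fastforce
    qed
    have "q + t *\<^sub>R d \<in> span ?S" using t q d L by (intro S) (auto simp: subspace_add subspace_scale)
    moreover have "q \<in> span ?S"
    proof (rule S[OF q])
      fix w assume "w \<in> W"
      from walls[OF this] show "lorentz q w \<le> 0" using q(1) by auto
    qed
    ultimately have "(1 / t) *\<^sub>R ((q + t *\<^sub>R d) - q) \<in> span ?S" by (rule span_scale[OF span_diff])
    then show "d \<in> span ?S" using t by simp
  qed
qed

section \<open>Right-angled polyhedra\<close>

definition hproj :: "minkowski \<Rightarrow> minkowski" where
  "hproj x = (1 / sqrt (- lorentz x x)) *\<^sub>R x"

lemma hproj_pos: "x \<in> future \<Longrightarrow> 1 / sqrt (- lorentz x x) > 0"
  by (simp add: future_def)

lemma hproj_H3: "x \<in> future \<Longrightarrow> hproj x \<in> H3"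
  by (simp add: hproj_def future_def H3_def lorentz_expand divide_simps)

lemma lorentz_hproj: "lorentz (hproj x) w = lorentz x w / sqrt (- lorentz x x)"
  by (simp add: hproj_def lorentz_expand)

lemma lorentz_hproj_sign:
  assumes "x \<in> future"
  shows "lorentz (hproj x) w \<le> 0 \<longleftrightarrow> lorentz x w \<le> 0" "lorentz (hproj x) w = 0 \<longleftrightarrow> lorentz x w = 0"
  using assms by (auto simp: lorentz_hproj future_def divide_le_0_iff)

lemma hproj_tendsto:
  assumes "x \<in> H3"
  shows "((\<lambda>t. hproj (x + t *\<^sub>R d)) \<longlongrightarrow> x) (at_right 0)"
proof -
  have "((\<lambda>t. (1 / sqrt (- lorentz (x + t *\<^sub>R d) (x + t *\<^sub>R d))) *\<^sub>R (x + t *\<^sub>R d))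
      \<longlongrightarrow> (1 / sqrt (- lorentz (x + 0 *\<^sub>R d) (x + 0 *\<^sub>R d))) *\<^sub>R (x + 0 *\<^sub>R d)) (at_right 0)"
    using assms by (intro tendsto_intros lorentz.tendsto) (auto simp: H3_def)
  then show ?thesis using assms by (simp add: hproj_def H3_def)
qed


text \<open>Hyperbolic projection onto \<open>hplane u\<close> before normalization, and therefore
  linear.\<close>

definition plane_proj :: "minkowski \<Rightarrow> minkowski \<Rightarrow> minkowski" where
  "plane_proj u x = x - lorentz x u *\<^sub>R u"

locale right_angled_polyhedron =
  fixes P :: "minkowski set"
  assumes polyhedron: "convex_polyhedron P" and right: "right_angled P"
begin

abbreviation N :: "minkowski set" where "N \<equiv> face_normals P"

lemma P_H3: "P \<subseteq> H3"
  using polyhedron by (auto simp: convex_polyhedron_def)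

text \<open>If an interior point lay on the plane of some \<open>u\<close>, moving it slightly along
  the outward normal would leave \<open>P\<close> without leaving a given neighbourhood in
  \<open>H3\<close>.\<close>

lemma representation:
  obtains U x0 where "finite U" "\<And>u. u \<in> U \<Longrightarrow> lorentz u u = 1" "P = H3 \<inter> (\<Inter>u\<in>U. hhalfspace u)"
    "x0 \<in> H3" "\<And>u. u \<in> U \<Longrightarrow> lorentz x0 u < 0"
proof -
  obtain U where U: "finite U" "\<And>u. u \<in> U \<Longrightarrow> lorentz u u = 1" "P = H3 \<inter> (\<Inter>u\<in>U. hhalfspace u)"
    using polyhedron unfolding convex_polyhedron_def by blast
  obtain x0 where "x0 \<in> (top_of_set H3) interior_of P"
    using polyhedron unfolding convex_polyhedron_def by blast
  then obtain T where T: "openin (top_of_set H3) T" "x0 \<in> T" "T \<subseteq> P" by (auto simp: interior_of_def)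
  then obtain V where V: "open V" "T = H3 \<inter> V" by (auto simp: openin_open)
  have x0: "x0 \<in> H3" "x0 \<in> V" using T V by auto
  have "lorentz x0 u < 0" if u: "u \<in> U" for u
  proof (rule ccontr)
    assume "\<not> lorentz x0 u < 0"
    moreover have "lorentz x0 u \<le> 0" using T U u by (auto simp: hhalfspace_def)
    ultimately have z: "lorentz x0 u = 0" by simp
    have "eventually (\<lambda>t. hproj (x0 + t *\<^sub>R u) \<in> V) (at_right 0)"
      using hproj_tendsto[OF x0(1)] V(1) x0(2) by (rule topological_tendstoD)
    then have "eventually (\<lambda>t. 0 < t \<and> x0 + t *\<^sub>R u \<in> future \<and> hproj (x0 + t *\<^sub>R u) \<in> V) (at_right (0::real))"
      using eventually_future[of x0 u] x0(1) H3_subset_future eventually_at_right_less[of "0::real"]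
      by (auto elim!: eventually_elim2 simp: eventually_conj_iff subset_eq)
    then obtain t :: real where t: "0 < t" "x0 + t *\<^sub>R u \<in> future" "hproj (x0 + t *\<^sub>R u) \<in> V"
      using eventually_happens by force
    then have "hproj (x0 + t *\<^sub>R u) \<in> P" using T V hproj_H3 by blast
    then have "lorentz (hproj (x0 + t *\<^sub>R u)) u \<le> 0" using U u by (auto simp: hhalfspace_def)
    then have "t \<le> 0" using lorentz_hproj_sign(1)[OF t(2)] z U u by (simp add: lorentz_expand)
    then show False using t by simp
  qed
  then show ?thesis using that[OF U x0(1)] by blast
qed

lemma span_P: "span P = UNIV"
proof -
  obtain U x0 where U: "finite U" "\<And>u. u \<in> U \<Longrightarrow> lorentz u u = 1" "P = H3 \<inter> (\<Inter>u\<in>U. hhalfspace u)"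
    "x0 \<in> H3" "\<And>u. u \<in> U \<Longrightarrow> lorentz x0 u < 0"
    by (rule representation) (rule that; assumption)
  have "UNIV \<subseteq> span (H3 \<inter> (\<Inter>u\<in>U. hhalfspace u) \<inter> UNIV)"
    using U H3_subset_future by (intro span_polyhedron_slice[of U UNIV x0]) auto
  then show ?thesis using U by auto
qed

lemma normal_unit: "u \<in> N \<Longrightarrow> lorentz u u = 1"
  and normal_halfspace: "u \<in> N \<Longrightarrow> x \<in> P \<Longrightarrow> lorentz x u \<le> 0"
  and normal_dim: "u \<in> N \<Longrightarrow> dim (P \<inter> hplane u) = 3"
  and normal_touches: "u \<in> N \<Longrightarrow> P \<inter> hplane u \<noteq> {}"
  by (auto simp: face_normals_def supporting_def hhalfspace_def hdim_def)

lemma normal_neq_uminus: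
  assumes "u \<in> N" "lorentz w w = 1" "\<And>x. x \<in> P \<Longrightarrow> lorentz x w \<le> 0"
  shows "w \<noteq> - u"
proof
  assume "w = - u"
  then have "lorentz x u = 0" if "x \<in> P" for x
    using assms that normal_halfspace[of u x] by (fastforce simp: lorentz_expand)
  then have "P \<subseteq> lorentz_perp {u}" by (auto simp: lorentz_perp_def)
  then have "u \<in> lorentz_perp {u}"
    using span_minimal[OF _ subspace_lorentz_perp] span_P by blast
  then show False using normal_unit[OF assms(1)] by (simp add: lorentz_perp_def)
qed

text \<open>No other admissible plane contains the face, since two such planes meet in linear
  dimension 2 while the face has 3. So each \<open>w\<close> is strictly avoided by some face point,
  and the sum of these points avoids all of them.\<close>

lemma face_interior:
  assumes u: "u \<in> N" and W: "finite W"
    "\<And>w. w \<in> W \<Longrightarrow> lorentz w w = 1 \<and> w \<noteq> u \<and> (\<forall>x\<in>P. lorentz x w \<le> 0)"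
  obtains x where "x \<in> future" "lorentz x u = 0" "\<And>w. w \<in> W \<Longrightarrow> lorentz x w < 0"
proof -
  have "\<exists>x\<in>P. lorentz x u = 0 \<and> lorentz x w < 0" if w: "w \<in> W" for w
  proof (rule ccontr)
    assume *: "\<not> ?thesis"
    have "lorentz x w = 0" if "x \<in> P \<inter> hplane u" for x
      using * W(2)[OF w] that by (fastforce simp: hplane_def)
    then have "P \<inter> hplane u \<subseteq> lorentz_perp {u, w}" by (auto simp: hplane_def lorentz_perp_def)
    then have "dim (P \<inter> hplane u) \<le> dim (lorentz_perp {u, w})" by (rule dim_subset)
    moreover have "w \<noteq> - u" using normal_neq_uminus[OF u] W(2)[OF w] by blast
    then have "independent {u, w}"
      using independent_unit_pair[of u w] normal_unit[OF u] W(2)[OF w] by blast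
    then have "dim (lorentz_perp {u, w}) = 4 - card {u, w}" by (rule dim_lorentz_perp)
    moreover have "card {u, w} = 2" using W(2)[OF w] by auto
    ultimately show False using normal_dim[OF u] by simp
  qed
  then obtain f where f: "\<And>w. w \<in> W \<Longrightarrow> f w \<in> P \<and> lorentz (f w) u = 0 \<and> lorentz (f w) w < 0" by metis
  obtain b where b: "b \<in> P" "lorentz b u = 0" using normal_touches[OF u] by (auto simp: hplane_def)
  define x where "x = b + (\<Sum>w\<in>W. f w)"
  have "b + (\<Sum>w\<in>V. f w) \<in> future" if "V \<subseteq> W" for V
    using finite_subset[OF that W(1)] that
  proof (induction V)
    case empty
    then show ?case using b P_H3 H3_subset_future by auto
  next
    case (insert w V)
    then have "w \<in> W" "b + sum f V \<in> future" by auto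
    moreover from this have "f w \<in> future" using f[of w] P_H3 H3_subset_future by blast
    ultimately have "(b + sum f V) + f w \<in> future" by (blast intro: future_add)
    then show ?case using insert by (simp add: algebra_simps)
  qed
  then have "x \<in> future" by (simp add: x_def)
  moreover have "lorentz x u = 0" using b f by (simp add: x_def lorentz_expand lorentz.sum_left)
  moreover have "lorentz x w < 0" if w: "w \<in> W" for w
  proof -
    have "lorentz x w = lorentz b w + lorentz (f w) w + (\<Sum>v\<in>W - {w}. lorentz (f v) w)"
      using W(1) w by (simp add: x_def lorentz_expand lorentz.sum_left sum.remove)
    moreover have "(\<Sum>v\<in>W - {w}. lorentz (f v) w) \<le> 0"
      using f W(2)[OF w] by (intro sum_nonpos) auto
    moreover have "lorentz b w \<le> 0" using b W(2)[OF w] by auto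
    ultimately show ?thesis using f[OF w] by linarith
  qed
  ultimately show ?thesis using that by blast
qed

text \<open>Otherwise a relatively interior point of the face would satisfy all defining
  inequalities strictly and could be pushed out across the face. Finiteness of the set of normals
  follows.\<close>

lemma normals_in_representation:
  assumes U: "finite U" "\<And>u. u \<in> U \<Longrightarrow> lorentz u u = 1" "P = H3 \<inter> (\<Inter>u\<in>U. hhalfspace u)"
  shows "N \<subseteq> U"
proof (rule subsetI, rule ccontr)
  fix u assume u: "u \<in> N" "u \<notin> U"
  have "lorentz x w \<le> 0" if "x \<in> P" "w \<in> U" for x w using U that by (auto simp: hhalfspace_def)
  then obtain x where x: "x \<in> future" "lorentz x u = 0" "\<And>w. w \<in> U \<Longrightarrow> lorentz x w < 0"
    using face_interior[OF u(1) U(1)] U(2) u(2) by metis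
  obtain t :: real where t: "0 < t" "x + t *\<^sub>R u \<in> future" "\<forall>w\<in>U. lorentz (x + t *\<^sub>R u) w \<le> 0"
    using small_step[OF x(1) U(1), of u] x(3) by blast
  have "lorentz (hproj (x + t *\<^sub>R u)) w \<le> 0" if "w \<in> U" for w
    using lorentz_hproj_sign(1)[OF t(2)] t(3) that by simp
  then have "hproj (x + t *\<^sub>R u) \<in> P" using hproj_H3[OF t(2)] by (simp add: U(3) hhalfspace_def)
  then have "lorentz (x + t *\<^sub>R u) u \<le> 0"
    using normal_halfspace[OF u(1)] lorentz_hproj_sign(1)[OF t(2)] by blast
  then show False using x t normal_unit[OF u(1)] by (simp add: lorentz_expand)
qed

lemma finite_normals: "finite N"
  using representation normals_in_representation finite_subset by metis

lemma interior_point: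
  obtains x0 where "x0 \<in> H3" "\<And>u. u \<in> N \<Longrightarrow> lorentz x0 u < 0"
  using representation normals_in_representation subsetD by metis

text \<open>A point outside \<open>P\<close> is approached generically from the interior. At the
  exit point a single wall is met up to proportionality, so this wall carries a face of full
  dimension, and its normal is violated by the point.\<close>

lemma P_eq: "P = H3 \<inter> (\<Inter>u\<in>N. hhalfspace u)"
proof
  show "P \<subseteq> H3 \<inter> (\<Inter>u\<in>N. hhalfspace u)"
    using P_H3 normal_halfspace by (auto simp: hhalfspace_def)
  obtain U x0 where U: "finite U" "\<And>u. u \<in> U \<Longrightarrow> lorentz u u = 1" "P = H3 \<inter> (\<Inter>u\<in>U. hhalfspace u)"
    "x0 \<in> H3" "\<And>u. u \<in> U \<Longrightarrow> lorentz x0 u < 0"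
    by (rule representation) (rule that; assumption)
  show "H3 \<inter> (\<Inter>u\<in>N. hhalfspace u) \<subseteq> P"
  proof (rule subsetI, rule ccontr)
    fix z assume z: "z \<in> H3 \<inter> (\<Inter>u\<in>N. hhalfspace u)" "z \<notin> P"
    then obtain w0 where w0: "w0 \<in> U" "lorentz z w0 > 0" using U(3) by (auto simp: hhalfspace_def)
    have zf: "z \<in> future" "x0 \<in> future" using z U(4) H3_subset_future by auto
    obtain w q where w: "w \<in> U" "lorentz z w > 0" and "q \<in> UNIV" and q: "q \<in> future" "lorentz q w = 0"
      and walls: "\<forall>w'\<in>U. lorentz q w' < 0 \<or> (\<exists>c>0. \<forall>x\<in>UNIV. lorentz x w' = c * lorentz x w)"
      by (rule generic_exit[OF U(1) subspace_UNIV UNIV_I zf(2) U(5) UNIV_I zf(1) w0])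
    have L: "lorentz_perp {w} \<subseteq> span (P \<inter> lorentz_perp {w})"
      unfolding U(3)
    proof (rule span_polyhedron_slice[OF U(1) subspace_lorentz_perp _ q(1)])
      show "q \<in> lorentz_perp {w}" using q by (simp add: lorentz_perp_def)
      show "lorentz q w' < 0 \<or> (\<forall>x\<in>lorentz_perp {w}. lorentz x w' = 0)" if "w' \<in> U" for w'
        using bspec[OF walls that] by (auto simp: lorentz_perp_def)
    qed
    have Pw: "P \<inter> lorentz_perp {w} = P \<inter> hplane w" using P_H3 by (auto simp: hplane_def lorentz_perp_def)
    have d3: "dim (lorentz_perp {w}) = 3"
    proof -
      have "w \<noteq> 0" using U(2)[OF w(1)] by (auto simp: lorentz.zero_left)
      then show ?thesis by (subst dim_lorentz_perp) auto
    qed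
    have "P \<inter> hplane w \<subseteq> lorentz_perp {w}" using Pw by blast
    then have "dim (P \<inter> hplane w) \<le> 3" using dim_subset d3 by metis
    moreover have "3 \<le> dim (P \<inter> hplane w)" using dim_subset[OF L] d3 Pw by simp
    ultimately have "dim (P \<inter> hplane w) = 3" by simp
    moreover from this have "P \<inter> hplane w \<noteq> {}" by auto
    moreover have "P \<subseteq> hhalfspace w" using U(3) w by auto
    ultimately have "w \<in> N" using U(2)[OF w(1)] by (simp add: face_normals_def supporting_def hdim_def)
    then show False using z w by (auto simp: hhalfspace_def)
  qed
qed

text \<open>The positive multiples of points of \<open>P\<close>. Being homogeneous, it can be
  tested against unnormalized projections.\<close>

definition cone :: "minkowski set" where
  "cone = {x \<in> future. \<forall>u\<in>N. lorentz x u \<le> 0}"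

lemma cone_nonempty: "\<exists>x. x \<in> cone"
proof -
  obtain x0 where "x0 \<in> H3" "\<And>u. u \<in> N \<Longrightarrow> lorentz x0 u < 0" by (rule interior_point) (rule that; assumption)
  then have "x0 \<in> cone" using H3_subset_future by (auto simp: cone_def less_imp_le)
  then show ?thesis ..
qed

lemma P_cone: "P \<subseteq> cone"
  using P_H3 H3_subset_future normal_halfspace by (auto simp: cone_def)

lemma hproj_cone: "x \<in> cone \<Longrightarrow> hproj x \<in> P"
  using hproj_H3 lorentz_hproj_sign(1) by (subst P_eq) (auto simp: cone_def hhalfspace_def)

lemma normals_not_opposite: "u \<in> N \<Longrightarrow> w \<in> N \<Longrightarrow> w \<noteq> - u"
  using normal_neq_uminus normal_unit normal_halfspace by blast

lemma independent_normals: "u \<in> N \<Longrightarrow> w \<in> N \<Longrightarrow> u \<noteq> w \<Longrightarrow> independent {u, w}"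
  using independent_unit_pair normal_unit normals_not_opposite by blast

text \<open>Both u + w and u - w are orthogonal to the timelike common point and nonzero, hence
  spacelike.\<close>

lemma normals_meeting_abs:
  assumes "u \<in> N" "w \<in> N" "u \<noteq> w" "q \<in> future" "lorentz q u = 0" "lorentz q w = 0"
  shows "\<bar>lorentz u w\<bar> < 1"
proof -
  have "u + w \<noteq> 0" using normals_not_opposite[OF assms(1,2)] by (metis add_eq_0_iff)
  then have "lorentz (u + w) (u + w) > 0"
    using assms by (intro spacelike_if_orthogonal_future[OF assms(4)]) (auto simp: lorentz_expand)
  moreover have "lorentz (u - w) (u - w) > 0"
    using assms by (intro spacelike_if_orthogonal_future[OF assms(4)]) (auto simp: lorentz_expand)
  ultimately show ?thesis
    using normal_unit assms lorentz_commute[of u w] by (simp add: lorentz_expand)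
qed

text \<open>To apply the hypothesis on dihedral angles, the intersection of the two planes with
  \<open>P\<close> must be exhibited as an edge. The normalized sum of the normals is the normal of
  a supporting plane that touches \<open>P\<close> exactly there.\<close>

lemma orthogonal_at_edge:
  assumes u: "u \<in> N" and w: "w \<in> N" and uw: "u \<noteq> w"
    and q: "q \<in> future" "lorentz q u = 0" "lorentz q w = 0"
    and L: "lorentz_perp {u, w} \<subseteq> span (P \<inter> lorentz_perp {u, w})"
  shows "lorentz u w = 0"
proof -
  let ?c = "lorentz u w"
  let ?L = "lorentz_perp {u, w}"
  have c: "\<bar>?c\<bar> < 1" using normals_meeting_abs[OF u w uw q] .
  define s where "s = sqrt (2 + 2 * ?c)"
  have s: "s > 0" "s * s = 2 + 2 * ?c" using c by (auto simp: s_def)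
  define e where "e = (1 / s) *\<^sub>R (u + w)"
  have le: "lorentz x e = (lorentz x u + lorentz x w) / s" for x
    by (simp add: e_def lorentz_expand)
  have Pe: "P \<inter> hplane e = P \<inter> ?L"
  proof -
    have "lorentz x e = 0 \<longleftrightarrow> lorentz x u = 0 \<and> lorentz x w = 0" if "x \<in> P" for x
      using s normal_halfspace[OF u that] normal_halfspace[OF w that] by (auto simp: le)
    then show ?thesis using P_H3 by (auto simp: hplane_def lorentz_perp_def)
  qed
  have dL: "dim ?L = 2" using dim_lorentz_perp[OF independent_normals[OF u w uw]] uw by simp
  have "dim (P \<inter> ?L) \<le> 2" "2 \<le> dim (P \<inter> ?L)"
    using dim_subset[of "P \<inter> ?L" ?L] dim_subset[OF L] dL by auto
  then have d2: "dim (P \<inter> ?L) = 2" by simp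
  then have "P \<inter> ?L \<noteq> {}" by auto
  moreover have "lorentz e e = lorentz (u + w) (u + w) / (s * s)"
    by (simp add: e_def lorentz.scaleR_left lorentz.scaleR_right)
  then have "lorentz e e = 1"
    using c normal_unit[OF u] normal_unit[OF w] lorentz_commute[of w u]
    by (simp add: s(2) lorentz_expand)
  moreover have "P \<subseteq> hhalfspace e"
    using P_H3 normal_halfspace[OF u] normal_halfspace[OF w] s
    by (auto simp: hhalfspace_def le divide_le_0_iff intro!: add_nonpos_nonpos)
  ultimately have "P \<inter> ?L \<in> edges P"
    using Pe d2 unfolding edges_def supporting_def hdim_def by (intro CollectI exI[of _ e]) auto
  moreover have "P \<inter> ?L \<subseteq> P \<inter> hplane u" "P \<inter> ?L \<subseteq> P \<inter> hplane w"
    using P_H3 by (auto simp: hplane_def lorentz_perp_def)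
  ultimately have "dihedral_angle u w = pi / 2" using right u w uw unfolding right_angled_def by blast
  then have "arccos ?c = pi / 2" by (simp add: dihedral_angle_def)
  then have "cos (arccos ?c) = 0" by (simp only: cos_pi_half)
  then show ?thesis using c by (subst (asm) cos_arccos) auto
qed

text \<open>A generic segment leaves a face through the relative interior of an edge.\<close>

lemma cone_if_orthogonal_constraints:
  assumes u: "u \<in> N" and z: "z \<in> future" "lorentz z u = 0"
    and orth: "\<And>w. w \<in> N \<Longrightarrow> lorentz u w = 0 \<Longrightarrow> lorentz z w \<le> 0"
  shows "z \<in> cone"
proof (rule ccontr)
  assume "z \<notin> cone"
  then obtain w0 where w0: "w0 \<in> N - {u}" "lorentz z w0 > 0" using z by (force simp: cone_def)
  let ?L = "lorentz_perp {u}"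
  have fin: "finite (N - {u})" using finite_normals by simp
  obtain x1 where x1: "x1 \<in> future" "lorentz x1 u = 0" "\<And>w. w \<in> N - {u} \<Longrightarrow> lorentz x1 w < 0"
    using face_interior[OF u fin] normal_unit normal_halfspace by (metis DiffE singletonI)
  have in_L: "x1 \<in> ?L" "z \<in> ?L" using x1 z by (simp_all add: lorentz_perp_def)
  obtain w q where w: "w \<in> N - {u}" "lorentz z w > 0" and q: "q \<in> ?L" "q \<in> future" "lorentz q w = 0"
    and walls: "\<forall>w'\<in>N - {u}. lorentz q w' < 0 \<or> (\<exists>c>0. \<forall>x\<in>?L. lorentz x w' = c * lorentz x w)"
    by (rule generic_exit[OF fin subspace_lorentz_perp in_L(1) x1(1,3) in_L(2) z(1) w0])
  have qu: "lorentz q u = 0" using q by (simp add: lorentz_perp_def)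
  have "lorentz_perp {u, w} \<subseteq> span (P \<inter> lorentz_perp {u, w})"
  proof (subst P_eq, rule span_polyhedron_slice[OF finite_normals subspace_lorentz_perp _ q(2)])
    show "q \<in> lorentz_perp {u, w}" using q by (simp add: lorentz_perp_def)
    show "lorentz q w' < 0 \<or> (\<forall>x\<in>lorentz_perp {u, w}. lorentz x w' = 0)" if "w' \<in> N" for w'
      using bspec[OF walls, of w'] that by (cases "w' = u") (auto simp: lorentz_perp_def)
  qed
  then have "lorentz u w = 0"
    using orthogonal_at_edge[OF u _ _ q(2) qu q(3)] w by auto
  then show False using orth[of w] w by auto
qed

text \<open>Subtracting a multiple of \<open>u\<close> does not change products with normals
  orthogonal to \<open>u\<close>, and by \<open>cone_if_orthogonal_constraints\<close> these are the
  only constraints to be checked.\<close>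

lemma plane_proj_cone:
  assumes u: "u \<in> N" and y: "y \<in> cone"
  shows "plane_proj u y \<in> cone"
proof (rule cone_if_orthogonal_constraints[OF u])
  have yf: "y \<in> future" using y by (simp add: cone_def)
  have sq: "lorentz (plane_proj u y) (plane_proj u y) = lorentz y y - (lorentz y u)\<^sup>2"
    "lorentz y (plane_proj u y) = lorentz y y - (lorentz y u)\<^sup>2"
    using normal_unit[OF u] lorentz_commute[of u y]
    by (simp_all add: plane_proj_def lorentz_expand power2_eq_square)
  have "lorentz y y < 0" using yf by (simp add: future_def)
  then have "lorentz y y - (lorentz y u)\<^sup>2 < 0" using zero_le_power2[of "lorentz y u"] by linarith
  then show "plane_proj u y \<in> future" using sq by (intro future_if_timelike[OF yf]) auto
  show "lorentz (plane_proj u y) u = 0" using normal_unit[OF u] by (simp add: plane_proj_def lorentz_expand)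
  show "lorentz (plane_proj u y) w \<le> 0" if "w \<in> N" "lorentz u w = 0" for w
    using that y by (simp add: plane_proj_def lorentz_expand cone_def)
qed

text \<open>Project a relatively interior point \<open>y\<close> of the face of \<open>v\<close>
  onto the plane of \<open>u\<close>: the result stays in the cone, and its product with
  \<open>v\<close> is - lorentz y u * lorentz u v with lorentz y u < 0.\<close>

lemma normals_nonpos:
  assumes u: "u \<in> N" and v: "v \<in> N" and uv: "u \<noteq> v"
  shows "lorentz u v \<le> 0"
proof -
  have "finite (N - {v})" using finite_normals by simp
  then obtain y where y: "y \<in> future" "lorentz y v = 0" "\<And>w. w \<in> N - {v} \<Longrightarrow> lorentz y w < 0"
    using face_interior[OF v] normal_unit normal_halfspace by (metis DiffE singletonI)
  have "lorentz y w \<le> 0" if "w \<in> N" for w using y(2) y(3)[of w] that by (cases "w = v") auto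
  then have "y \<in> cone" using y(1) by (simp add: cone_def)
  then have "plane_proj u y \<in> cone" by (rule plane_proj_cone[OF u])
  then have "lorentz (plane_proj u y) v \<le> 0" using v by (simp add: cone_def)
  then have "0 \<le> lorentz y u * lorentz u v" using y by (simp add: plane_proj_def lorentz_expand)
  moreover have "lorentz y u < 0" using y(3)[of u] u uv by simp
  ultimately show ?thesis by (simp add: zero_le_mult_iff)
qed

text \<open>Alternating projections onto two intersecting face planes stay in the cone and converge to
  the projection onto the intersection, which is therefore spanned by an edge.\<close>

theorem normals_gram:
  assumes u: "u \<in> N" and v: "v \<in> N" and uv: "u \<noteq> v"
  shows "lorentz u v = 0 \<or> lorentz u v \<le> -1"
proof (rule disjCI)
  define c where "c = lorentz u v"
  assume "\<not> lorentz u v \<le> -1"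
  then have c: "-1 < c" "c \<le> 0" using normals_nonpos[OF assms] by (auto simp: c_def)
  have uu: "lorentz u u = 1" "lorentz v v = 1" "lorentz u v = c" "lorentz v u = c"
    using normal_unit u v lorentz_commute[of v u] by (auto simp: c_def)
  have "c * c < 1"
    using c mult_le_one[of "-c" "-c"] mult_strict_mono[of "-c" 1 "-c" 1] by (cases "c = 0") auto
  then have cc: "1 - c * c > 0" by simp
  \<comment> \<open>Solving the Gram system of \<open>u\<close> and \<open>v\<close>: these
    coefficients make \<open>prj\<close> the orthogonal projection onto the intersection of both
    planes.\<close>
  define \<alpha> where "\<alpha> x = (lorentz x u - c * lorentz x v) / (1 - c * c)" for x
  define \<beta> where "\<beta> x = (lorentz x v - c * lorentz x u) / (1 - c * c)" for x
  define prj where "prj x = x - (\<alpha> x *\<^sub>R u + \<beta> x *\<^sub>R v)" for x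
  have ab: "\<alpha> x + c * \<beta> x = lorentz x u" "c * \<alpha> x + \<beta> x = lorentz x v" for x
  proof -
    have m: "\<alpha> x * (1 - c * c) = lorentz x u - c * lorentz x v"
      "\<beta> x * (1 - c * c) = lorentz x v - c * lorentz x u"
      using cc by (simp_all add: \<alpha>_def \<beta>_def)
    have "(\<alpha> x + c * \<beta> x) * (1 - c * c) = lorentz x u * (1 - c * c)"
      unfolding distrib_right mult.assoc m by (simp add: algebra_simps)
    then show "\<alpha> x + c * \<beta> x = lorentz x u" using cc by simp
    have "(c * \<alpha> x + \<beta> x) * (1 - c * c) = lorentz x v * (1 - c * c)"
      unfolding distrib_right mult.assoc m by (simp add: algebra_simps)
    then show "c * \<alpha> x + \<beta> x = lorentz x v" using cc by simp
  qed
  have prj_lin: "linear prj"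
    by (intro linearI) (simp_all add: prj_def \<alpha>_def \<beta>_def lorentz_expand add_divide_distrib diff_divide_distrib algebra_simps)
  have prj_perp: "lorentz (prj x) u = 0" "lorentz (prj x) v = 0" for x
    using ab[of x] by (simp_all add: prj_def lorentz_expand uu algebra_simps)
  have prj_fix: "prj x = x" if "x \<in> lorentz_perp {u, v}" for x
    using that by (simp add: prj_def \<alpha>_def \<beta>_def lorentz_perp_def)
  have prj_cone: "prj y \<in> cone" if y: "y \<in> cone" for y
  proof -
    \<comment> \<open>Closed form of the alternating projections. The first one leaves the error
      \<beta> y times (v - c u); each round through \<open>v\<close> and \<open>u\<close> multiplies
      it by c^2 < 1.\<close>
    have iter: "prj y + (c ^ (2 * n) * \<beta> y) *\<^sub>R (v - c *\<^sub>R u) \<in> cone" for n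
    proof (induction n)
      case 0
      have "prj y + \<beta> y *\<^sub>R (v - c *\<^sub>R u) = y - (\<alpha> y + c * \<beta> y) *\<^sub>R u"
        by (simp add: prj_def algebra_simps)
      also have "\<dots> = plane_proj u y" using ab(1)[of y] by (simp add: plane_proj_def)
      finally show ?case using plane_proj_cone[OF u y] by simp
    next
      case (Suc n)
      define g where "g = c ^ (2 * n) * \<beta> y"
      define x where "x = prj y + g *\<^sub>R (v - c *\<^sub>R u)"
      have "lorentz x v = g * (1 - c * c)" by (simp add: x_def lorentz_expand uu prj_perp)
      then have "plane_proj v x = x - (g * (1 - c * c)) *\<^sub>R v" by (simp add: plane_proj_def)
      then have px: "plane_proj v x = prj y - (g * c) *\<^sub>R (u - c *\<^sub>R v)"
        by (simp add: x_def algebra_simps)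
      have "lorentz (plane_proj v x) u = - (g * c * (1 - c * c))" by (simp add: px lorentz_expand uu prj_perp)
      then have "plane_proj u (plane_proj v x) = plane_proj v x + (g * c * (1 - c * c)) *\<^sub>R u"
        by (simp add: plane_proj_def[of u])
      then have "plane_proj u (plane_proj v x) = prj y + (g * c * c) *\<^sub>R (v - c *\<^sub>R u)"
        by (simp add: px algebra_simps)
      moreover have "plane_proj u (plane_proj v x) \<in> cone"
        using Suc by (intro plane_proj_cone u v) (simp add: x_def g_def)
      ultimately show ?case by (simp add: g_def mult_ac)
    qed
    have yf: "y \<in> future" using y by (simp add: cone_def)
    have "lorentz (prj y) w \<le> 0" if w: "w \<in> N" for w
    proof -
      have nc: "norm (c * c) < 1" using \<open>c * c < 1\<close> by simp
      have lim: "(\<lambda>n. lorentz (prj y) w + (c * c) ^ n * (\<beta> y * lorentz (v - c *\<^sub>R u) w))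
          \<longlonglongrightarrow> lorentz (prj y) w + 0 * (\<beta> y * lorentz (v - c *\<^sub>R u) w)"
        by (intro tendsto_intros nc)
      have le: "lorentz (prj y) w + (c * c) ^ n * (\<beta> y * lorentz (v - c *\<^sub>R u) w) \<le> 0" for n
      proof -
        have "lorentz (prj y + (c ^ (2 * n) * \<beta> y) *\<^sub>R (v - c *\<^sub>R u)) w \<le> 0"
          using iter[of n] w by (simp add: cone_def)
        then show ?thesis by (simp add: lorentz.add_left lorentz.scaleR_left power_mult power2_eq_square)
      qed
      have "lorentz (prj y) w + 0 * (\<beta> y * lorentz (v - c *\<^sub>R u) w) \<le> 0"
        by (rule LIMSEQ_le_const2[OF lim]) (use le in blast)
      then show ?thesis by simp
    qed
    moreover have "prj y \<in> future"
    proof (rule future_if_timelike[OF yf])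
      define s where "s = \<alpha> y *\<^sub>R u + \<beta> y *\<^sub>R v"
      have y_eq: "y = prj y + s" by (simp add: prj_def s_def)
      have perp: "lorentz (prj y) s = 0" by (simp add: s_def lorentz_expand prj_perp)
      have "lorentz s s = (\<alpha> y)\<^sup>2 + 2 * c * (\<alpha> y * \<beta> y) + (\<beta> y)\<^sup>2"
        by (simp add: s_def lorentz_expand uu power2_eq_square algebra_simps)
      also have "\<dots> = (\<alpha> y + c * \<beta> y)\<^sup>2 + (1 - c * c) * (\<beta> y)\<^sup>2"
        by (simp add: power2_eq_square algebra_simps)
      finally have "0 \<le> lorentz s s" using cc by simp
      moreover have "lorentz y y = lorentz (prj y + s) (prj y + s)" by (simp only: y_eq[symmetric])
      then have "lorentz y y = lorentz (prj y) (prj y) + lorentz s s"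
        using perp lorentz_commute[of s "prj y"] by (simp add: lorentz.add_left lorentz.add_right)
      moreover have "lorentz y y < 0" using yf by (simp add: future_def)
      ultimately show neg: "lorentz (prj y) (prj y) < 0" by linarith
      have "lorentz y (prj y) = lorentz (prj y + s) (prj y)" by (simp only: y_eq[symmetric])
      then have "lorentz y (prj y) = lorentz (prj y) (prj y)"
        using perp lorentz_commute[of s "prj y"] by (simp add: lorentz.add_left)
      then show "lorentz y (prj y) < 0" using neg by simp
    qed
    ultimately show ?thesis by (simp add: cone_def)
  qed
  let ?L = "lorentz_perp {u, v}"
  have prj_span: "prj y \<in> span (P \<inter> ?L)" if "y \<in> P" for y
  proof -
    have c: "prj y \<in> cone" using prj_cone that P_cone by blast
    then have f: "prj y \<in> future" by (simp add: cone_def)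
    have "hproj (prj y) \<in> P \<inter> ?L"
      using hproj_cone[OF c] prj_perp[of y] by (simp add: lorentz_perp_def lorentz_hproj)
    then have "sqrt (- lorentz (prj y) (prj y)) *\<^sub>R hproj (prj y) \<in> span (P \<inter> ?L)"
      by (rule span_scale[OF span_base])
    then show ?thesis using hproj_pos[OF f] by (simp add: hproj_def)
  qed
  \<comment> \<open>\<open>prj\<close> is linear and \<open>P\<close> spans the whole space, so the
    projected points, which lie in the cone, span \<open>?L\<close>.\<close>
  have "?L \<subseteq> span (P \<inter> ?L)"
  proof
    fix x assume x: "x \<in> ?L"
    have "x \<in> prj ` span P" using prj_fix[OF x] span_P by (metis UNIV_I imageI)
    also have "prj ` span P = span (prj ` P)" by (rule linear_span_image[OF prj_lin, symmetric])
    also have "\<dots> \<subseteq> span (P \<inter> ?L)" using prj_span by (intro span_minimal) auto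
    finally show "x \<in> span (P \<inter> ?L)" .
  qed
  moreover obtain x0 where "x0 \<in> cone" using cone_nonempty ..
  then have "prj x0 \<in> future" using prj_cone by (simp add: cone_def)
  ultimately show "lorentz u v = 0"
    using orthogonal_at_edge[OF u v uv _ prj_perp] by blast
qed

end

section \<open>Compact polyhedra: counting edges and vertices\<close>

text \<open>\<open>q\<close>, \<open>u\<close>, \<open>v\<close>, \<open>w\<close> exhaust the four
  dimensions: a nonzero remainder after removing the \<open>q\<close> component would, normalized,
  be a fourth orthonormal spacelike vector.\<close>

lemma timelike_expansion:
  assumes q: "q \<in> future" "lorentz q q = -1"
    and unit: "lorentz u u = 1" "lorentz v v = 1" "lorentz w w = 1"
    and perp: "lorentz u v = 0" "lorentz u w = 0" "lorentz v w = 0"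
      "lorentz q u = 0" "lorentz q v = 0" "lorentz q w = 0"
    and x: "lorentz x u = 0" "lorentz x v = 0" "lorentz x w = 0"
  shows "x = - lorentz x q *\<^sub>R q"
proof (rule ccontr)
  define z where "z = x + lorentz x q *\<^sub>R q"
  assume "x \<noteq> - lorentz x q *\<^sub>R q"
  then have z0: "z \<noteq> 0" by (simp add: z_def add_eq_0_iff2)
  have zq: "lorentz q z = 0" using q(2) lorentz_commute[of q x] by (simp add: z_def lorentz_expand)
  have zp: "lorentz z u = 0" "lorentz z v = 0" "lorentz z w = 0"
    using x perp by (simp_all add: z_def lorentz_expand)
  have zz: "lorentz z z > 0" using spacelike_if_orthogonal_future[OF q(1) zq z0] .
  define n where "n = (1 / sqrt (lorentz z z)) *\<^sub>R z"
  have n: "lorentz n n = 1" "lorentz n u = 0" "lorentz n v = 0" "lorentz n w = 0"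
    using zz zp by (simp_all add: n_def lorentz_expand)
  have distinct: "card {u, v, w, n} = 4"
  proof -
    have "u \<noteq> v" "u \<noteq> w" "v \<noteq> w" "n \<noteq> u" "n \<noteq> v" "n \<noteq> w" using unit perp n by auto
    then show ?thesis by auto
  qed
  have "card {u, v, w, n} \<le> 3"
  proof (rule card_orthonormal_spacelike)
    show "lorentz a a = 1" if "a \<in> {u, v, w, n}" for a using that unit n by auto
    show "pairwise (\<lambda>u v. lorentz u v = 0) {u, v, w, n}"
      using perp n by (auto simp: pairwise_insert lorentz_commute)
  qed
  then show False using distinct by simp
qed

text \<open>Used with \<open>A\<close> the set of ascending edges at a vertex: two of the three
  edges go up, or two do not, and two edges at a vertex span one of its faces.\<close>

lemma three_set_split:
  assumes "card T = 3"
  shows "(\<exists>u\<in>T. T - {u} \<subseteq> A) \<or> (\<exists>u\<in>T. (T - {u}) \<inter> A = {})"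
proof -
  obtain x y z where "T = {x, y, z}" "x \<noteq> y" "x \<noteq> z" "y \<noteq> z"
    using assms by (auto simp: card_3_iff)
  then show ?thesis by (cases "x \<in> A"; cases "y \<in> A"; cases "z \<in> A") auto
qed

locale compact_right_angled_polyhedron = right_angled_polyhedron +
  assumes compact: "compact P"
begin

text \<open>Combinatorial stand-in for the faces, edges and vertices of \<open>P\<close> (j = 1, 2,
  3), as the sets of normals of the planes through them.\<close>

definition orth_cliques :: "nat \<Rightarrow> minkowski set set" where
  "orth_cliques j = {X. X \<subseteq> N \<and> pairwise (\<lambda>u v. lorentz u v = 0) X \<and> card X = j}"

lemma finite_orth_cliques: "finite (orth_cliques j)"
  by (rule finite_subset[of _ "Pow N"]) (auto simp: orth_cliques_def finite_normals)

lemma orth_if_meet: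
  assumes "u \<in> N" "w \<in> N" "u \<noteq> w" "q \<in> future" "lorentz q u = 0" "lorentz q w = 0"
  shows "lorentz u w = 0"
  using normals_meeting_abs[OF assms] normals_gram[OF assms(1-3)] by auto

definition vertex :: "minkowski set \<Rightarrow> minkowski" where
  "vertex T = (SOME x. x \<in> P \<and> (\<forall>u\<in>T. lorentz x u = 0))"

text \<open>Projecting successively onto three mutually orthogonal planes stays in the cone, and
  later projections do not undo earlier ones.\<close>

lemma vertex_exists:
  assumes "T \<in> orth_cliques 3"
  shows "\<exists>x. x \<in> P \<and> (\<forall>u\<in>T. lorentz x u = 0)"
proof -
  obtain u v w where T: "T = {u, v, w}" "u \<noteq> v" "u \<noteq> w" "v \<noteq> w"
    using assms by (auto simp: orth_cliques_def card_3_iff)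
  have N3: "u \<in> N" "v \<in> N" "w \<in> N" and o: "lorentz v u = 0" "lorentz w u = 0" "lorentz w v = 0"
    using assms T by (auto simp: orth_cliques_def pairwise_def)
  obtain x0 where "x0 \<in> cone" using cone_nonempty ..
  then have "plane_proj w (plane_proj v (plane_proj u x0)) \<in> cone" (is "?x \<in> _") using N3 by (intro plane_proj_cone)
  moreover have "lorentz ?x u = 0" "lorentz ?x v = 0" "lorentz ?x w = 0"
    using o normal_unit[OF N3(1)] normal_unit[OF N3(2)] normal_unit[OF N3(3)]
    by (simp_all add: plane_proj_def lorentz_expand)
  ultimately show ?thesis
    using hproj_cone[of ?x] T by (intro exI[of _ "hproj ?x"]) (simp add: lorentz_hproj)
qed

text \<open>All face planes through the point meet there, hence are pairwise orthogonal, hence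
  number at most three; those in \<open>T\<close> are already three.\<close>

lemma vertex:
  assumes T: "T \<in> orth_cliques 3"
  shows "vertex T \<in> P" "vertex T \<in> future" "lorentz (vertex T) (vertex T) = -1"
    and "u \<in> N \<Longrightarrow> lorentz (vertex T) u = 0 \<longleftrightarrow> u \<in> T"
    and "u \<in> N - T \<Longrightarrow> lorentz (vertex T) u < 0"
proof -
  have v: "vertex T \<in> P \<and> (\<forall>u\<in>T. lorentz (vertex T) u = 0)"
    unfolding vertex_def using vertex_exists[OF T] by (rule someI_ex)
  then show P: "vertex T \<in> P" by simp
  then show f: "vertex T \<in> future" "lorentz (vertex T) (vertex T) = -1"
    using P_H3 H3_subset_future by (auto simp: H3_def)
  let ?A = "{u \<in> N. lorentz (vertex T) u = 0}"
  have "card ?A \<le> 3"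
  proof (rule card_orthonormal_spacelike)
    show "pairwise (\<lambda>u v. lorentz u v = 0) ?A"
      using orth_if_meet f by (auto simp: pairwise_def)
  qed (simp add: normal_unit)
  moreover have "T \<subseteq> ?A" "card T = 3" using v T by (auto simp: orth_cliques_def)
  moreover have "finite ?A" using finite_normals by simp
  ultimately have "T = ?A" by (intro card_seteq) auto
  then show iff: "lorentz (vertex T) u = 0 \<longleftrightarrow> u \<in> T" if "u \<in> N" for u using that by blast
  show "lorentz (vertex T) u < 0" if "u \<in> N - T" for u
    using iff[of u] that normal_halfspace[OF _ P, of u] by (auto simp: less_le)
qed


text \<open>Base point \<open>q\<close> and unit tangent \<open>f\<close> of the line carrying the
  edge.\<close>

lemma edge_frame:
  assumes u: "u \<in> N" and v: "v \<in> N" and uv: "u \<noteq> v" "lorentz u v = 0"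
  obtains q f where "q \<in> cone" "lorentz q q = -1" "lorentz q u = 0" "lorentz q v = 0"
    "lorentz f f = 1" "lorentz f q = 0" "lorentz f u = 0" "lorentz f v = 0"
proof -
  obtain x0 where "x0 \<in> cone" using cone_nonempty ..
  define y where "y = plane_proj v (plane_proj u x0)"
  have y: "y \<in> cone" unfolding y_def using \<open>x0 \<in> cone\<close> by (intro plane_proj_cone u v)
  have "lorentz v u = 0" using uv by (simp add: lorentz_commute)
  then have yuv: "lorentz y u = 0" "lorentz y v = 0"
    using normal_unit[OF u] normal_unit[OF v] by (simp_all add: y_def plane_proj_def lorentz_expand)
  define q where "q = hproj y"
  have q: "q \<in> P" "lorentz q u = 0" "lorentz q v = 0"
    using hproj_cone[OF y] yuv by (simp_all add: q_def lorentz_hproj)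
  then have q': "q \<in> cone" "lorentz q q = -1" using P_cone P_H3 by (auto simp: H3_def)
  let ?L = "lorentz_perp {u, v}"
  have "dim ?L = 2" using dim_lorentz_perp[OF independent_normals[OF u v uv(1)]] uv by simp
  then have "\<not> ?L \<subseteq> span {q}"
    using dim_subset[of ?L "span {q}"] dim_le_card'[of "{q}"] by auto
  then obtain d where d: "d \<in> ?L" "d \<notin> span {q}" by blast
  define f0 where "f0 = d + lorentz d q *\<^sub>R q"
  have "f0 \<noteq> 0"
  proof
    assume "f0 = 0"
    then have "d = - lorentz d q *\<^sub>R q" by (simp add: f0_def add_eq_0_iff2)
    then show False using d by (metis span_base span_scale singletonI)
  qed
  have f0: "lorentz f0 q = 0" "lorentz f0 u = 0" "lorentz f0 v = 0"
    using d q q' by (simp_all add: f0_def lorentz_expand lorentz_perp_def)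
  have "lorentz f0 f0 > 0"
    using q' f0 \<open>f0 \<noteq> 0\<close> by (intro spacelike_if_orthogonal_future[of q]) (auto simp: cone_def lorentz_commute)
  then show ?thesis
    using q q' f0 by (intro that[of q "(1 / sqrt (lorentz f0 f0)) *\<^sub>R f0"]) (auto simp: lorentz_expand)
qed

text \<open>The ray from \<open>q\<close> in direction \<open>f\<close> is unbounded, so it leaves
  the compact \<open>P\<close> through the plane of some \<open>w\<close>. That plane meets the line
  of the edge, which forces orthogonality to \<open>u\<close> and \<open>v\<close>.\<close>

lemma edge_end_exists:
  assumes u: "u \<in> N" and v: "v \<in> N"
    and q: "q \<in> cone" "lorentz q q = -1" "lorentz q u = 0" "lorentz q v = 0"
    and f: "lorentz f f = 1" "lorentz f q = 0" "lorentz f u = 0" "lorentz f v = 0"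
  obtains w where "w \<in> N" "lorentz u w = 0" "lorentz v w = 0" "lorentz f w > 0"
proof -
  have qf: "q \<in> future" using q by (simp add: cone_def)
  have ray: "q + t *\<^sub>R f \<in> future" "lorentz (q + t *\<^sub>R f) (q + t *\<^sub>R f) = t * t - 1"
    if t: "0 \<le> t" "t < 1" for t
  proof -
    show *: "lorentz (q + t *\<^sub>R f) (q + t *\<^sub>R f) = t * t - 1"
      using q f lorentz_commute[of q f] by (simp add: lorentz_expand)
    have "t * t < 1 * 1" using t by (intro mult_strict_mono') auto
    then show "q + t *\<^sub>R f \<in> future"
      using * q f lorentz_commute[of q f] by (intro future_if_timelike[OF qf]) (auto simp: lorentz_expand)
  qed
  have "bounded ((\<lambda>x. lorentz x q) ` P)"
    using compact by (intro compact_imp_bounded compact_continuous_image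
        linear_continuous_on linear_conv_bounded_linear[THEN iffD1] linear_lorentz_left)
  then obtain K where K: "K > 0" "\<And>x. x \<in> P \<Longrightarrow> \<bar>lorentz x q\<bar> \<le> K"
    by (auto simp: bounded_pos)
  \<comment> \<open>Chosen so that the normalized point has product -(K + 1) with \<open>q\<close>,
    beyond the bound \<open>K\<close> valid on \<open>P\<close>.\<close>
  define t where "t = sqrt (1 - 1 / (K + 1)\<^sup>2)"
  have K1: "1 / (K + 1)\<^sup>2 < 1" "0 < 1 / (K + 1)\<^sup>2"
    using K(1) one_less_power[of "K + 1" 2] by auto
  have t: "0 \<le> t" "t < 1" "t * t = 1 - 1 / (K + 1)\<^sup>2"
    using K1 by (auto simp: t_def)
  define x where "x = q + t *\<^sub>R f"
  have x: "x \<in> future" "lorentz x x = t * t - 1" using ray t by (simp_all add: x_def)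
  have "x \<notin> cone"
  proof
    assume "x \<in> cone"
    then have "\<bar>lorentz (hproj x) q\<bar> \<le> K" by (intro K(2) hproj_cone)
    moreover have "- lorentz x x = (1 / (K + 1))\<^sup>2" using x(2) t(3) by (simp add: power_one_over)
    then have "sqrt (- lorentz x x) = 1 / (K + 1)" using K(1) by simp
    then have "lorentz (hproj x) q = - (K + 1)"
      using q f by (simp add: lorentz_hproj x_def lorentz_expand)
    ultimately show False using K(1) by simp
  qed
  then obtain w where w: "w \<in> N" "lorentz x w > 0" using x(1) by (force simp: cone_def)
  have qw: "lorentz q w \<le> 0" using q w by (simp add: cone_def)
  have fw: "t * lorentz f w > - lorentz q w" using w by (simp add: x_def lorentz_expand)
  then have "t * lorentz f w > 0" using qw by simp
  then have fpos: "lorentz f w > 0" using t by (simp add: zero_less_mult_iff)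
  define r where "r = - lorentz q w / lorentz f w"
  have r: "0 \<le> r" "r < t" using qw fw fpos by (simp_all add: r_def divide_simps)
  have ray_r: "q + r *\<^sub>R f \<in> future" using ray(1)[of r] r t by simp
  have meet: "lorentz (q + r *\<^sub>R f) w = 0"
    "lorentz (q + r *\<^sub>R f) u = 0" "lorentz (q + r *\<^sub>R f) v = 0"
    using fpos q f by (simp_all add: lorentz_expand r_def)
  have "u \<noteq> w" "v \<noteq> w" using f fpos by auto
  then have "lorentz u w = 0" "lorentz v w = 0"
    using orth_if_meet[OF u w(1) _ ray_r meet(2,1)] orth_if_meet[OF v w(1) _ ray_r meet(3,1)] by auto
  then show ?thesis using that w(1) fpos by blast
qed

text \<open>Such a normal lies in the span of \<open>q\<close> and \<open>f\<close> and has the form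
  - a q + b f with b^2 = 1 + a^2. Two of them with b and b' of equal sign have product b b' - a a' >
  0, against \<open>normals_nonpos\<close>.\<close>

lemma edge_end_unique:
  assumes u: "u \<in> N" and v: "v \<in> N" and uv: "lorentz u v = 0"
    and q: "q \<in> cone" "lorentz q q = -1" "lorentz q u = 0" "lorentz q v = 0"
    and f: "lorentz f f = 1" "lorentz f q = 0" "lorentz f u = 0" "lorentz f v = 0"
    and w: "w \<in> N" "lorentz u w = 0" "lorentz v w = 0"
  shows "lorentz f w \<noteq> 0"
    and "w' \<in> N \<Longrightarrow> lorentz u w' = 0 \<Longrightarrow> lorentz v w' = 0 \<Longrightarrow> lorentz f w * lorentz f w' > 0 \<Longrightarrow> w = w'"
proof -
  have qf: "q \<in> future" using q by (simp add: cone_def)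
  note uu = normal_unit[OF u] normal_unit[OF v]
  have sym: "lorentz q f = 0" "lorentz u f = 0" "lorentz v f = 0" "lorentz u q = 0" "lorentz v q = 0"
    using q f by (simp_all add: lorentz_commute)
  have expand: "z = - lorentz z q *\<^sub>R q + lorentz f z *\<^sub>R f" and norm: "(lorentz f z)\<^sup>2 = 1 + (lorentz z q)\<^sup>2"
    if z: "z \<in> N" "lorentz u z = 0" "lorentz v z = 0" for z
  proof -
    define y where "y = z - lorentz f z *\<^sub>R f"
    have zs: "lorentz z u = 0" "lorentz z v = 0" "lorentz z f = lorentz f z"
      using z by (simp_all add: lorentz_commute)
    have "y = - lorentz y q *\<^sub>R q"
      by (rule timelike_expansion[OF qf q(2) uu f(1) uv])
        (use sym q f zs in \<open>auto simp: y_def lorentz_expand\<close>)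
    moreover have "lorentz y q = lorentz z q" using f by (simp add: y_def lorentz_expand)
    ultimately have "z - lorentz f z *\<^sub>R f = - lorentz z q *\<^sub>R q" by (simp add: y_def)
    then show ex: "z = - lorentz z q *\<^sub>R q + lorentz f z *\<^sub>R f" by (simp add: algebra_simps)
    have "lorentz z z = lorentz (- lorentz z q *\<^sub>R q + lorentz f z *\<^sub>R f) (- lorentz z q *\<^sub>R q + lorentz f z *\<^sub>R f)"
      by (simp only: ex[symmetric])
    also have "\<dots> = (lorentz f z)\<^sup>2 - (lorentz z q)\<^sup>2"
      using q f sym by (simp add: lorentz_expand power2_eq_square)
    finally show "(lorentz f z)\<^sup>2 = 1 + (lorentz z q)\<^sup>2" using normal_unit[OF z(1)] by simp
  qed
  have "0 < (lorentz f w)\<^sup>2" using norm[OF w] zero_le_power2[of "lorentz w q"] by linarith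
  then show "lorentz f w \<noteq> 0" by auto
  assume w': "w' \<in> N" "lorentz u w' = 0" "lorentz v w' = 0" and pos: "lorentz f w * lorentz f w' > 0"
  show "w = w'"
  proof (rule ccontr)
    assume ne: "w \<noteq> w'"
    define a b a' b' where ab: "a = lorentz w q" "b = lorentz f w" "a' = lorentz w' q" "b' = lorentz f w'"
    have "lorentz w w' = lorentz (- a *\<^sub>R q + b *\<^sub>R f) (- a' *\<^sub>R q + b' *\<^sub>R f)"
      unfolding ab using expand[OF w] expand[OF w'] by simp
    also have "\<dots> = b * b' - a * a'" using q f sym by (simp add: lorentz_expand)
    finally have ww: "lorentz w w' = b * b' - a * a'" .
    have "\<bar>a * a'\<bar>\<^sup>2 < \<bar>b * b'\<bar>\<^sup>2"
      using norm[OF w] norm[OF w'] unfolding ab[symmetric]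
      by (simp add: power_mult_distrib algebra_simps add_pos_nonneg)
    then have "\<bar>a * a'\<bar> < \<bar>b * b'\<bar>" by (rule power2_less_imp_less) simp
    then have "lorentz w w' > 0" using pos ww ab by auto
    then show False using normals_nonpos[OF w(1) w'(1) ne] by simp
  qed
qed

lemma card_edge_ends:
  assumes e: "e \<in> orth_cliques 2"
  shows "card {T \<in> orth_cliques 3. e \<subseteq> T} = 2"
proof -
  obtain u v where e_eq: "e = {u, v}" "u \<noteq> v" using e by (auto simp: orth_cliques_def card_2_iff)
  have u: "u \<in> N" and v: "v \<in> N" and uv: "lorentz u v = 0"
    using e e_eq by (auto simp: orth_cliques_def pairwise_def)
  obtain q f where q: "q \<in> cone" "lorentz q q = -1" "lorentz q u = 0" "lorentz q v = 0"
    and f: "lorentz f f = 1" "lorentz f q = 0" "lorentz f u = 0" "lorentz f v = 0"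
    by (rule edge_frame[OF u v e_eq(2) uv])
  have f': "lorentz (- f) (- f) = 1" "lorentz (- f) q = 0" "lorentz (- f) u = 0" "lorentz (- f) v = 0"
    using f by (simp_all add: lorentz_expand)
  obtain w1 where w1: "w1 \<in> N" "lorentz u w1 = 0" "lorentz v w1 = 0" "lorentz f w1 > 0"
    by (rule edge_end_exists[OF u v q f])
  obtain w2 where w2: "w2 \<in> N" "lorentz u w2 = 0" "lorentz v w2 = 0" "lorentz (- f) w2 > 0"
    by (rule edge_end_exists[OF u v q f'])
  have w2f: "lorentz f w2 < 0" using w2 by (simp add: lorentz_expand)
  have third: "w = w1 \<or> w = w2" if w: "w \<in> N" "lorentz u w = 0" "lorentz v w = 0" for w
  proof (cases "lorentz f w > 0")
    case True
    then show ?thesis using edge_end_unique(2)[OF u v uv q f w w1(1-3)] w1 by simp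
  next
    case False
    then have "lorentz f w < 0" using edge_end_unique(1)[OF u v uv q f w] by simp
    then show ?thesis using edge_end_unique(2)[OF u v uv q f w w2(1-3)] w2f by (simp add: mult_neg_neg)
  qed
  have nuv: "w1 \<noteq> u" "w1 \<noteq> v" "w2 \<noteq> u" "w2 \<noteq> v" "w1 \<noteq> w2" using f w1 w2f by auto
  have cl: "insert w e \<in> orth_cliques 3" if "w \<in> N" "lorentz u w = 0" "lorentz v w = 0" "w \<noteq> u" "w \<noteq> v" for w
    using that e e_eq uv by (auto simp: orth_cliques_def pairwise_insert lorentz_commute)
  have "{T \<in> orth_cliques 3. e \<subseteq> T} = {insert w1 e, insert w2 e}"
  proof
    show "{insert w1 e, insert w2 e} \<subseteq> {T \<in> orth_cliques 3. e \<subseteq> T}"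
      using cl[OF w1(1-3)] cl[OF w2(1-3)] nuv by auto
    show "{T \<in> orth_cliques 3. e \<subseteq> T} \<subseteq> {insert w1 e, insert w2 e}"
    proof (rule subsetI)
      fix T assume "T \<in> {T \<in> orth_cliques 3. e \<subseteq> T}"
      then have T: "T \<in> orth_cliques 3" "e \<subseteq> T" by simp_all
      then have "card (T - e) = 1" using e by (subst card_Diff_subset) (auto simp: orth_cliques_def e_eq)
      then obtain w where w: "T - e = {w}" by (auto simp: card_1_singleton_iff)
      then have T_eq: "T = insert w e" and we: "w \<notin> e" using T by auto
      have Tp: "T \<subseteq> N" "pairwise (\<lambda>u v. lorentz u v = 0) T" using T(1) by (simp_all add: orth_cliques_def)
      have "w \<in> N" using Tp(1) T_eq by simp
      moreover have "lorentz u w = 0" "lorentz v w = 0"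
        using pairwiseD[OF Tp(2), of u w] pairwiseD[OF Tp(2), of v w] we T_eq e_eq by auto
      ultimately show "T \<in> {insert w1 e, insert w2 e}" using third[of w] T_eq by blast
    qed
  qed
  moreover have "insert w1 e \<noteq> insert w2 e" using nuv e_eq by auto
  ultimately show ?thesis by simp
qed

lemma edge_vertex_count: "3 * card (orth_cliques 3) = 2 * card (orth_cliques 2)"
proof -
  have "2 * card (orth_cliques 2) = (\<Sum>e\<in>orth_cliques 2. card {T \<in> orth_cliques 3. e \<subseteq> T})"
    by (simp add: card_edge_ends)
  also have "\<dots> = (\<Sum>e\<in>orth_cliques 2. \<Sum>T\<in>orth_cliques 3. if e \<subseteq> T then 1 else 0)"
    by (intro sum.cong refl) (simp add: sum.If_cases Int_def finite_orth_cliques)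
  also have "\<dots> = (\<Sum>T\<in>orth_cliques 3. \<Sum>e\<in>orth_cliques 2. if e \<subseteq> T then 1 else 0)"
    by (rule sum.swap)
  also have "\<dots> = (\<Sum>T\<in>orth_cliques 3. 3)"
  proof (intro sum.cong refl)
    fix T assume T: "T \<in> orth_cliques 3"
    then have e: "{e \<in> orth_cliques 2. e \<subseteq> T} = {e. e \<subseteq> T \<and> card e = 2}" and fin: "finite T" "card T = 3"
      by (auto simp: orth_cliques_def intro: pairwise_subset card_ge_0_finite)
    have "(\<Sum>e\<in>orth_cliques 2. if e \<subseteq> T then 1 else 0) = card {e \<in> orth_cliques 2. e \<subseteq> T}"
      by (simp add: sum.If_cases Int_def finite_orth_cliques)
    also have "\<dots> = 3 choose 2" unfolding e using n_subsets[OF fin(1), of 2] fin(2) by simp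
    also have "\<dots> = 3" by (simp add: choose_two)
    finally show "(\<Sum>e\<in>orth_cliques 2. if e \<subseteq> T then 1 else 0) = (3 :: nat)" .
  qed
  finally show ?thesis by simp
qed

text \<open>The other end of the edge at the vertex \<open>T\<close> that leaves the plane of
  \<open>w\<close>.\<close>

definition opposite :: "minkowski set \<Rightarrow> minkowski \<Rightarrow> minkowski set" where
  "opposite T w = (SOME T'. T' \<in> orth_cliques 3 \<and> T - {w} \<subseteq> T' \<and> w \<notin> T')"

lemma opposite:
  assumes T: "T \<in> orth_cliques 3" and w: "w \<in> T"
  shows "opposite T w \<in> orth_cliques 3" "T - {w} \<subseteq> opposite T w" "w \<notin> opposite T w"
proof -
  have finT: "finite T" "card T = 3" using T by (auto simp: orth_cliques_def intro: card_ge_0_finite)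
  have "T - {w} \<in> orth_cliques 2"
    using T w finT by (auto simp: orth_cliques_def pairwise_def)
  then have "card {T' \<in> orth_cliques 3. T - {w} \<subseteq> T'} = 2" by (rule card_edge_ends)
  then have "\<not> {T' \<in> orth_cliques 3. T - {w} \<subseteq> T'} \<subseteq> {T}"
    using card_mono[of "{T}" "{T' \<in> orth_cliques 3. T - {w} \<subseteq> T'}"] by auto
  then obtain T' where T': "T' \<in> orth_cliques 3" "T - {w} \<subseteq> T'" "T' \<noteq> T" by blast
  have "w \<notin> T'"
  proof
    assume "w \<in> T'"
    then have "T \<subseteq> T'" using T' by auto
    then have "T = T'" using T' finT by (intro card_seteq) (auto simp: orth_cliques_def intro: card_ge_0_finite)
    then show False using T' by simp
  qed
  then have "\<exists>T'. T' \<in> orth_cliques 3 \<and> T - {w} \<subseteq> T' \<and> w \<notin> T'" using T' by blast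
  from someI_ex[OF this] show "opposite T w \<in> orth_cliques 3" "T - {w} \<subseteq> opposite T w" "w \<notin> opposite T w"
    by (auto simp: opposite_def)
qed

text \<open>A face lies in the convex cone spanned, from any of its vertices, by the two edges there.\<close>

lemma face_local_min:
  fixes a :: minkowski
  defines "\<phi> \<equiv> \<lambda>T. (a \<bullet> vertex T) / snd (vertex T)"
  assumes T: "T \<in> orth_cliques 3" and u: "u \<in> T"
    and up: "\<And>w. w \<in> T - {u} \<Longrightarrow> \<phi> T \<le> \<phi> (opposite T w)"
    and T': "T' \<in> orth_cliques 3" "u \<in> T'"
  shows "\<phi> T \<le> \<phi> T'"
proof -
  have finT: "finite T" "card T = 3" using T by (auto simp: orth_cliques_def intro: card_ge_0_finite)
  then have "card (T - {u}) = 2" using u by simp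
  then obtain v w where vw: "T - {u} = {v, w}" "v \<noteq> w" by (auto simp: card_2_iff)
  then have T_eq: "T = {u, v, w}" "u \<noteq> v" "u \<noteq> w" using u by auto
  have N3: "u \<in> N" "v \<in> N" "w \<in> N" and o: "lorentz u v = 0" "lorentz u w = 0" "lorentz v w = 0"
    using T T_eq vw by (auto simp: orth_cliques_def pairwise_def)
  \<comment> \<open>The height difference to \<open>T\<close> with its denominator cleared: linear,
    and at a vertex of the same sign as the difference of heights. Dividing by \<open>snd\<close> is
    passing to the Klein model, where heights are affine.\<close>
  define ht where "ht x = a \<bullet> x - \<phi> T * snd x" for x
  have ht_lin: "ht (x + y) = ht x + ht y" "ht (c *\<^sub>R x) = c * ht x" for x y c
    by (simp_all add: ht_def inner_add_right algebra_simps)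
  have snd_pos: "snd (vertex X) > 0" if "X \<in> orth_cliques 3" for X
    using vertex(2)[OF that] by (simp add: future_def)
  have ht_vertex: "ht (vertex X) = (\<phi> X - \<phi> T) * snd (vertex X)" if "X \<in> orth_cliques 3" for X
    using snd_pos[OF that] by (simp add: ht_def \<phi>_def algebra_simps)
  define x where "x = vertex T"
  define x1 where "x1 = vertex (opposite T w)"
  define x2 where "x2 = vertex (opposite T v)"
  define y where "y = vertex T'"
  have ow: "opposite T w \<in> orth_cliques 3" "{u, v} \<subseteq> opposite T w" "w \<notin> opposite T w"
    using opposite[OF T, of w] T_eq vw(2) by auto
  have ov: "opposite T v \<in> orth_cliques 3" "{u, w} \<subseteq> opposite T v" "v \<notin> opposite T v"
    using opposite[OF T, of v] T_eq vw(2) by auto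
  have lx: "lorentz x u = 0" "lorentz x v = 0" "lorentz x w = 0"
    using vertex(4)[OF T] N3 T_eq by (auto simp: x_def)
  have lx1: "lorentz x1 u = 0" "lorentz x1 v = 0" "lorentz x1 w < 0"
    using vertex(4)[OF ow(1)] vertex(5)[OF ow(1)] N3 ow by (auto simp: x1_def)
  have lx2: "lorentz x2 u = 0" "lorentz x2 w = 0" "lorentz x2 v < 0"
    using vertex(4)[OF ov(1)] vertex(5)[OF ov(1)] N3 ov by (auto simp: x2_def)
  have ly: "lorentz y u = 0" "lorentz y v \<le> 0" "lorentz y w \<le> 0"
    using vertex(4)[OF T'(1)] T'(2) N3 normal_halfspace[OF _ vertex(1)[OF T'(1)]] by (auto simp: y_def)
  \<comment> \<open>These coefficients cancel the products of \<open>y\<close> with \<open>w\<close>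
    and \<open>v\<close>; what remains is a multiple of \<open>x\<close> by
    \<open>timelike_expansion\<close> and has height zero.\<close>
  define \<alpha> where "\<alpha> = lorentz y w / lorentz x1 w"
  define \<beta> where "\<beta> = lorentz y v / lorentz x2 v"
  have pos: "0 \<le> \<alpha>" "0 \<le> \<beta>"
    using lx1 lx2 ly by (simp_all add: \<alpha>_def \<beta>_def divide_nonpos_neg)
  define z where "z = y - \<alpha> *\<^sub>R x1 - \<beta> *\<^sub>R x2"
  have lz: "lorentz z u = 0" "lorentz z v = 0" "lorentz z w = 0"
    using lx1 lx2 ly by (simp_all add: z_def lorentz_expand \<alpha>_def \<beta>_def)
  have "z = - lorentz z x *\<^sub>R x"
    by (rule timelike_expansion[of x u v w])
      (use vertex(2,3)[OF T] normal_unit N3 o lx lz in \<open>auto simp: x_def\<close>)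
  moreover have "y = z + \<alpha> *\<^sub>R x1 + \<beta> *\<^sub>R x2" by (simp add: z_def)
  ultimately have "y = (- lorentz z x) *\<^sub>R x + \<alpha> *\<^sub>R x1 + \<beta> *\<^sub>R x2" by simp
  then have "ht y = (- lorentz z x) * ht x + \<alpha> * ht x1 + \<beta> * ht x2" by (simp only: ht_lin)
  moreover have "ht x = 0" using ht_vertex[OF T] by (simp add: x_def)
  moreover have "0 \<le> ht x1" "0 \<le> ht x2"
    using ht_vertex[OF ow(1)] ht_vertex[OF ov(1)] up[of w] up[of v] vw snd_pos[OF ow(1)] snd_pos[OF ov(1)]
    by (simp_all add: x1_def x2_def)
  ultimately have "0 \<le> ht y" using pos by simp
  then have "0 \<le> (\<phi> T' - \<phi> T) * snd (vertex T')" using ht_vertex[OF T'(1)] by (simp add: y_def)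
  then show ?thesis using snd_pos[OF T'(1)] by (simp add: zero_le_mult_iff)
qed

text \<open>Distinct vertices are not proportional, because the planes through a vertex determine
  \<open>T\<close>. Hence finitely many nonzero functionals of \<open>a\<close> have to be kept from
  vanishing.\<close>

lemma generic_height:
  obtains a :: minkowski where
    "inj_on (\<lambda>T. (a \<bullet> vertex T) / snd (vertex T)) (orth_cliques 3)"
proof -
  define d where "d T T' = (1 / snd (vertex T)) *\<^sub>R vertex T - (1 / snd (vertex T')) *\<^sub>R vertex T'" for T T'
  define F where "F = {\<lambda>a. a \<bullet> d T T' |T T'. T \<in> orth_cliques 3 \<and> T' \<in> orth_cliques 3 \<and> T \<noteq> T'}"
  have d0: "d T T' \<noteq> 0" if T: "T \<in> orth_cliques 3" "T' \<in> orth_cliques 3" "T \<noteq> T'" for T T'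
  proof
    assume "d T T' = 0"
    moreover have pos: "snd (vertex T) > 0" "snd (vertex T') > 0"
      using vertex(2)[OF T(1)] vertex(2)[OF T(2)] by (auto simp: future_def)
    ultimately have "lorentz ((1 / snd (vertex T)) *\<^sub>R vertex T) u = lorentz ((1 / snd (vertex T')) *\<^sub>R vertex T') u" for u
      by (simp add: d_def)
    then have "lorentz (vertex T) u * snd (vertex T') = lorentz (vertex T') u * snd (vertex T)" for u
      using pos by (simp add: lorentz_expand field_simps)
    then have "lorentz (vertex T) u = 0 \<longleftrightarrow> lorentz (vertex T') u = 0" for u
      using pos by (metis less_irrefl mult_eq_0_iff)
    then have "u \<in> T \<longleftrightarrow> u \<in> T'" if "u \<in> N" for u
      using vertex(4)[OF T(1) that] vertex(4)[OF T(2) that] by simp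
    then show False using T by (auto simp: orth_cliques_def)
  qed
  obtain a :: minkowski where a: "\<And>f. f \<in> F \<Longrightarrow> f a \<noteq> 0"
  proof (rule generic_point[of F UNIV 0 "\<lambda>_. True"])
    show "finite F"
    proof (rule finite_subset)
      show "F \<subseteq> (\<Union>T\<in>orth_cliques 3. (\<lambda>T'. \<lambda>a. a \<bullet> d T T') ` orth_cliques 3)"
        unfolding F_def by blast
    qed (simp add: finite_orth_cliques)
    show "linear f \<and> (\<exists>d\<in>UNIV. f d \<noteq> 0)" if f: "f \<in> F" for f
    proof -
      obtain T T' where "f = (\<lambda>a. a \<bullet> d T T')" "d T T' \<noteq> 0" using f d0 unfolding F_def by blast
      moreover have "linear (\<lambda>a. a \<bullet> d T T')" by (intro linearI) (simp_all add: inner_add_left)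
      moreover from calculation have "f (d T T') \<noteq> 0" by simp
      ultimately show ?thesis by blast
    qed
  qed auto
  have "inj_on (\<lambda>T. (a \<bullet> vertex T) / snd (vertex T)) (orth_cliques 3)"
  proof (rule inj_onI, rule ccontr)
    fix T T' assume T: "T \<in> orth_cliques 3" "T' \<in> orth_cliques 3" "T \<noteq> T'"
      and eq: "(a \<bullet> vertex T) / snd (vertex T) = (a \<bullet> vertex T') / snd (vertex T')"
    have "(\<lambda>a. a \<bullet> d T T') \<in> F" using T unfolding F_def by blast
    then have "a \<bullet> d T T' \<noteq> 0" by (rule a)
    then show False using eq by (simp add: d_def inner_diff_right)
  qed
  then show ?thesis by (rule that)
qed

text \<open>The counting argument for h-vectors of simple polytopes: in a generic direction every face
  has at most one lowest and one highest vertex, whereas every vertex is extremal on at least one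
  of its three faces, and the two globally extremal vertices are so on all three.\<close>

theorem vertex_count:
  assumes k: "card N \<ge> 2"
  shows "card (orth_cliques 3) + 4 \<le> 2 * card N"
proof (cases "orth_cliques 3 = {}")
  case True
  then show ?thesis using k by simp
next
  case False
  let ?V = "orth_cliques 3"
  obtain a where inj: "inj_on (\<lambda>T. (a \<bullet> vertex T) / snd (vertex T)) ?V" by (rule generic_height)
  define \<phi> where "\<phi> T = (a \<bullet> vertex T) / snd (vertex T)" for T
  have inj: "\<phi> T = \<phi> T' \<Longrightarrow> T \<in> ?V \<Longrightarrow> T' \<in> ?V \<Longrightarrow> T = T'" for T T'
    using inj by (auto simp: inj_on_def \<phi>_def)
  \<comment> \<open>The edges of the face \<open>u\<close> at the vertex \<open>T\<close> belong to
    the elements of T - {u}. Thus \<open>lows\<close> collects the faces whose lowest vertex is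
    \<open>T\<close>, and \<open>highs\<close> those whose highest vertex is
    \<open>T\<close>.\<close>
  define Up where "Up T = {w \<in> T. \<phi> T < \<phi> (opposite T w)}" for T
  define lows where "lows T = {u \<in> T. T - {u} \<subseteq> Up T}" for T
  define highs where "highs T = {u \<in> T. (T - {u}) \<inter> Up T = {}}" for T
  have finT: "finite T" "card T = 3" "T \<subseteq> N" if "T \<in> ?V" for T
    using that by (auto simp: orth_cliques_def intro: card_ge_0_finite)
  have low_unique: "T = T'" if "T \<in> ?V" "T' \<in> ?V" "u \<in> lows T" "u \<in> lows T'" for T T' u
  proof -
    have "\<phi> X \<le> \<phi> X'" if "X \<in> ?V" "X' \<in> ?V" "u \<in> lows X" "u \<in> lows X'" for X X'
      unfolding \<phi>_def
      by (rule face_local_min[of X u]) (use that in \<open>auto simp: lows_def Up_def \<phi>_def less_imp_le subset_eq\<close>)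
    then show ?thesis using that by (intro inj antisym) auto
  qed
  have high_unique: "T = T'" if "T \<in> ?V" "T' \<in> ?V" "u \<in> highs T" "u \<in> highs T'" for T T' u
  proof -
    \<comment> \<open>Highest vertices are lowest vertices for the direction
      \<open>- a\<close>.\<close>
    have "((- a) \<bullet> vertex X) / snd (vertex X) \<le> ((- a) \<bullet> vertex X') / snd (vertex X')"
      if "X \<in> ?V" "X' \<in> ?V" "u \<in> highs X" "u \<in> highs X'" for X X'
      by (rule face_local_min[of X u]) (use that in \<open>auto simp: highs_def Up_def \<phi>_def not_less\<close>)
    from this[of T T'] this[of T' T] show ?thesis using that by (intro inj) (auto simp: \<phi>_def)
  qed
  have finsub: "finite (lows T)" "finite (highs T)" if "T \<in> ?V" for T
    using finT(1)[OF that] by (auto simp: lows_def highs_def)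
  have sum_le: "(\<Sum>T\<in>?V. card (X T)) \<le> card N"
    if X: "\<And>T. T \<in> ?V \<Longrightarrow> X T \<subseteq> T" "\<And>T T' u. T \<in> ?V \<Longrightarrow> T' \<in> ?V \<Longrightarrow> u \<in> X T \<Longrightarrow> u \<in> X T' \<Longrightarrow> T = T'" for X
  proof -
    have "(\<Sum>T\<in>?V. card (X T)) = card (\<Union>T\<in>?V. X T)"
    proof (rule card_UN_disjoint[symmetric])
      show "\<forall>T\<in>?V. finite (X T)" using X(1) finT(1) finite_subset by blast
      show "\<forall>T\<in>?V. \<forall>T'\<in>?V. T \<noteq> T' \<longrightarrow> X T \<inter> X T' = {}" using X(2) by blast
    qed (rule finite_orth_cliques)
    also have "(\<Union>T\<in>?V. X T) \<subseteq> N" using X(1) finT(3) by blast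
    then have "card (\<Union>T\<in>?V. X T) \<le> card N" by (rule card_mono[OF finite_normals])
    finally show ?thesis .
  qed
  have total: "(\<Sum>T\<in>?V. card (lows T) + card (highs T)) \<le> 2 * card N"
  proof -
    have "(\<Sum>T\<in>?V. card (lows T)) \<le> card N"
    proof (rule sum_le)
      show "lows T \<subseteq> T" for T by (simp add: lows_def)
    qed (rule low_unique)
    moreover have "(\<Sum>T\<in>?V. card (highs T)) \<le> card N"
    proof (rule sum_le)
      show "highs T \<subseteq> T" for T by (simp add: highs_def)
    qed (rule high_unique)
    ultimately show ?thesis by (simp add: sum.distrib)
  qed
  have one: "1 \<le> card (lows T) + card (highs T)" if T: "T \<in> ?V" for T
  proof -
    have "lows T \<noteq> {} \<or> highs T \<noteq> {}"
      using three_set_split[OF finT(2)[OF T], of "Up T"] unfolding lows_def highs_def by blast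
    then show ?thesis using finsub[OF T] by (auto simp: Suc_le_eq card_gt_0_iff)
  qed
  have opp: "opposite T w \<in> ?V" "\<phi> (opposite T w) \<noteq> \<phi> T" if "T \<in> ?V" "w \<in> T" for T w
    using opposite[OF that] that inj[of "opposite T w" T] by auto
  have finV: "finite ?V" by (rule finite_orth_cliques)
  have img: "finite (\<phi> ` ?V)" "\<phi> ` ?V \<noteq> {}" using finV False by simp_all
  obtain B where B: "B \<in> ?V" "\<phi> B = Min (\<phi> ` ?V)" using Min_in[OF img] by (metis imageE)
  obtain A where A: "A \<in> ?V" "\<phi> A = Max (\<phi> ` ?V)" using Max_in[OF img] by (metis imageE)
  have B_le: "\<phi> B \<le> \<phi> T" and A_ge: "\<phi> T \<le> \<phi> A" if "T \<in> ?V" for T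
    using A B img that by simp_all
  have "\<phi> B < \<phi> (opposite B w)" if "w \<in> B" for w
    using B_le[OF opp(1)[OF B(1) that]] opp(2)[OF B(1) that] by simp
  then have "Up B = B" unfolding Up_def by blast
  then have lB: "lows B = B" unfolding lows_def by blast
  have "\<not> \<phi> A < \<phi> (opposite A w)" if "w \<in> A" for w
    using A_ge[OF opp(1)[OF A(1) that]] by simp
  then have "Up A = {}" unfolding Up_def by blast
  then have hA: "highs A = A" unfolding highs_def by blast
  have "A \<noteq> B" using \<open>Up A = {}\<close> \<open>Up B = B\<close> finT(2)[OF B(1)] by auto
  \<comment> \<open>The top vertex \<open>A\<close> and the bottom vertex \<open>B\<close> are
    extremal on three faces each, two more than the one guaranteed to every vertex.\<close>
  have "card ?V + 4 = (\<Sum>T\<in>?V. 1 + (if T = A then 2 else 0) + (if T = B then 2 else 0))"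
    unfolding sum.distrib using finV A(1) B(1) by simp
  also have "\<dots> \<le> (\<Sum>T\<in>?V. card (lows T) + card (highs T))"
  proof (intro sum_mono)
    fix T assume "T \<in> ?V"
    then show "1 + (if T = A then 2 else 0) + (if T = B then 2 else 0) \<le> card (lows T) + card (highs T)"
      using one[of T] hA lB \<open>A \<noteq> B\<close> finT(2)[OF A(1)] finT(2)[OF B(1)] by auto
  qed
  finally show ?thesis using total by linarith
qed

end

section \<open>The percolation gap\<close>

context cayley_percolation
begin

text \<open>One parameter between 1 / \<mu> and 1 / \<Lambda> separates the thresholds: infinite
  clusters exist there, whereas uniqueness at \<open>x\<close> forces x \<ge> 1 / \<Lambda>.\<close>

theorem nonuniqueness_gap:
  assumes \<Lambda>: "1 \<le> \<Lambda>" "\<Lambda> < \<mu>"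
    and growth: "\<And>n. \<mu> * real (card (sphere n)) \<le> real (card (sphere (Suc n)))"
    and K: "0 \<le> K" "\<And>n g. g \<in> carrier G \<Longrightarrow> real (walks n g) \<le> K * \<Lambda> ^ n"
  shows "Inf {p \<in> {0..1}. \<P>(\<omega> in PM p. iclusters \<omega> \<noteq> {}) > 0}
    < Inf {p \<in> {0..1}. AE \<omega> in PM p. \<exists>!C. C \<in> iclusters \<omega>}" (is "Inf ?C < Inf ?U")
proof -
  have spheres: "sphere n \<noteq> {}" for n
  proof -
    have "0 < card (sphere n)"
    proof (induction n)
      case (Suc n)
      have "0 < \<mu> * real (card (sphere n))" using Suc \<Lambda> by simp
      also have "\<dots> \<le> real (card (sphere (Suc n)))" by (rule growth)
      finally show ?case by simp
    qed (simp add: sphere_0)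
    then show ?thesis by auto
  qed
  define p where "p = (1 / \<mu> + 1 / \<Lambda>) / 2"
  have inv: "1 / \<mu> < 1 / \<Lambda>" "0 < 1 / \<mu>" "1 / \<Lambda> \<le> 1"
    using \<Lambda> by (auto simp: divide_simps)
  have "0 \<le> (a + b) / 2 \<and> (a + b) / 2 \<le> 1 \<and> a < (a + b) / 2 \<and> (a + b) / 2 < b"
    if "a < b" "0 < a" "b \<le> 1" for a b :: real using that by auto
  from this[OF inv] have p: "0 \<le> p" "p \<le> 1" "1 / \<mu> < p" "p < 1 / \<Lambda>" by (simp_all add: p_def)
  have "1 < p * \<mu>" using p(3) \<Lambda> by (simp add: field_simps)
  then have "p \<in> ?C"
    using infinite_cluster_above[OF p(1,2) _ _ growth] p \<Lambda> by simp
  then have "Inf ?C \<le> p" by (rule cInf_lower) (auto intro: bdd_belowI[of _ 0])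
  also have "p < 1 / \<Lambda>" by (rule p(4))
  also have "1 / \<Lambda> \<le> Inf ?U"
  proof (rule cInf_greatest)
    show "?U \<noteq> {}" using unique_at_one[OF spheres] by (auto intro: exI[of _ 1])
    fix x assume "x \<in> ?U"
    then have x: "0 \<le> x" "x \<le> 1" "AE \<omega> in PM x. \<exists>!C. C \<in> iclusters \<omega>" by auto
    have "1 \<le> x * \<Lambda>"
      using not_unique_below[OF x(1,2) K(1) _ _ spheres x(3), of \<Lambda>] K(2) \<Lambda> by simp
    then show "1 / \<Lambda> \<le> x" using \<Lambda> by (simp add: field_simps)
  qed
  finally show ?thesis .
qed

end

context involution_generated_group
begin

abbreviation cay :: "'g ugraph" where
  "cay \<equiv> cayley_graph G (r ` N)"

lemma fst_cay: "fst cay = carrier G"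
  by (simp add: cayley_graph_def)

lemma cay_edge_iff:
  "{v, w} \<in> snd cay \<longleftrightarrow> v \<in> carrier G \<and> w \<in> carrier G \<and> v \<noteq> w \<and> (\<exists>u\<in>N. w = v \<otimes> r u)"
proof -
  have sym: "(\<exists>u\<in>N. w = v \<otimes> r u) \<longleftrightarrow> (\<exists>u\<in>N. v = w \<otimes> r u)" if "v \<in> carrier G" "w \<in> carrier G" for v w
    using that mult_r_r by metis
  show ?thesis
  proof
    assume "{v, w} \<in> snd cay"
    then obtain a b u where ab: "{v, w} = {a, b}" "a \<in> carrier G" "b \<in> carrier G" "a \<noteq> b"
      and u: "u \<in> N" "a = b \<otimes> r u" by (auto simp: cayley_graph_def)
    from ab(1) have "v = a \<and> w = b \<or> v = b \<and> w = a" by (auto simp: doubleton_eq_iff)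
    then show "v \<in> carrier G \<and> w \<in> carrier G \<and> v \<noteq> w \<and> (\<exists>u\<in>N. w = v \<otimes> r u)"
      using ab(2-4) u sym[of v w] by blast
  next
    assume R: "v \<in> carrier G \<and> w \<in> carrier G \<and> v \<noteq> w \<and> (\<exists>u\<in>N. w = v \<otimes> r u)"
    then obtain u where "u \<in> N" "v = w \<otimes> r u" using sym[of v w] by blast
    then show "{v, w} \<in> snd cay"
      using R unfolding cayley_graph_def snd_conv by blast
  qed
qed

lemma cay_edgeE:
  assumes "e \<in> snd cay"
  obtains v w where "e = {v, w}" "v \<in> carrier G" "w \<in> carrier G" "v \<noteq> w" "\<exists>u\<in>N. w = v \<otimes> r u"
proof -
  obtain v w where "e = {v, w}" using assms by (auto simp: cayley_graph_def)
  then show ?thesis using that assms cay_edge_iff[of v w] by blast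
qed

lemma inj_on_image_left_mult:
  assumes "g \<in> carrier G"
  shows "inj_on ((`) (\<lambda>v. g \<otimes> v)) (Pow (carrier G))"
  using assms by (intro inj_on_image_Pow) (simp add: inj_on_def)

lemma bond_model:
  "cayley_percolation G N r (snd cay) (\<lambda>_. {}) (\<lambda>v w. {v, w}) (\<lambda>g e. (\<lambda>v. g \<otimes> v) ` e) (\<lambda>v w. {v, w} \<in> snd cay)"
proof (unfold_locales)
  fix g assume g: "g \<in> carrier G"
  have "snd cay \<subseteq> Pow (carrier G)" by (auto elim!: cay_edgeE)
  then show "inj_on (\<lambda>e. (\<lambda>v. g \<otimes> v) ` e) (snd cay)"
    using inj_on_image_left_mult[OF g] inj_on_subset by blast
  show "(\<lambda>e. (\<lambda>v. g \<otimes> v) ` e) \<in> snd cay \<rightarrow> snd cay"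
  proof
    fix e assume "e \<in> snd cay"
    then obtain v w where e: "e = {v, w}" "v \<in> carrier G" "w \<in> carrier G" "v \<noteq> w" "\<exists>u\<in>N. w = v \<otimes> r u"
      by (rule cay_edgeE)
    then have "{g \<otimes> v, g \<otimes> w} \<in> snd cay" using g r_closed unfolding cay_edge_iff by (auto simp: m_assoc)
    then show "(\<lambda>v. g \<otimes> v) ` e \<in> snd cay" using e by simp
  qed
qed (auto simp: cay_edge_iff)

lemma site_model:
  "cayley_percolation G N r (fst cay) (\<lambda>v. {v}) (\<lambda>v w. w) (\<lambda>g v. g \<otimes> v) (\<lambda>v w. {v, w} \<in> snd cay)"
proof (unfold_locales)
qed (auto simp: cay_edge_iff fst_cay inj_on_def)

lemma infinite_clusters_bond:
  "infinite_clusters (bond_subgraph cay \<omega>)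
    = cayley_percolation.iclusters G (\<lambda>_. {}) (\<lambda>v w. {v, w}) (\<lambda>v w. {v, w} \<in> snd cay) \<omega>"
proof -
  interpret cayley_percolation G N r "snd cay" "\<lambda>_. {}" "\<lambda>v w. {v, w}" "\<lambda>g e. (\<lambda>v. g \<otimes> v) ` e" "\<lambda>v w. {v, w} \<in> snd cay"
    by (rule bond_model)
  have "{(x, y). {x, y} \<in> snd (bond_subgraph cay \<omega>)} = steps \<omega>"
    by (auto simp: bond_subgraph_def steps_def alive_def)
  then show ?thesis
    by (auto simp: infinite_clusters_def clusters_def iclusters_def infinite_at_def alive_def cluster_def
        bond_subgraph_def fst_cay)
qed

text \<open>A closed vertex is no vertex of the subgraph, which corresponds to the demand in
  \<open>infinite_at\<close> that the starting vertex be alive.\<close>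

lemma infinite_clusters_site:
  "infinite_clusters (site_subgraph cay \<omega>)
    = cayley_percolation.iclusters G (\<lambda>v. {v}) (\<lambda>v w. w) (\<lambda>v w. {v, w} \<in> snd cay) \<omega>"
proof -
  interpret cayley_percolation G N r "fst cay" "\<lambda>v. {v}" "\<lambda>v w. w" "\<lambda>g v. g \<otimes> v" "\<lambda>v w. {v, w} \<in> snd cay"
    by (rule site_model)
  have "{(x, y). {x, y} \<in> snd (site_subgraph cay \<omega>)} = steps \<omega>"
    by (auto simp: site_subgraph_def steps_def alive_def)
  then show ?thesis
    by (auto simp: infinite_clusters_def clusters_def iclusters_def infinite_at_def alive_def cluster_def
        site_subgraph_def fst_cay)
qed

theorem cayley_graph_gap:
  assumes \<Lambda>: "1 \<le> \<Lambda>" "\<Lambda> < \<mu>"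
    and growth: "\<And>n. \<mu> * real (card (sphere n)) \<le> real (card (sphere (Suc n)))"
    and walks: "\<And>n. real (walks n \<one>) \<le> \<Lambda> ^ n"
  shows "pc_bond cay < pu_bond cay" "pc_site cay < pu_site cay"
proof -
  have K: "0 \<le> real (card N) + 1" "\<And>n g. g \<in> carrier G \<Longrightarrow> real (walks n g) \<le> (real (card N) + 1) * \<Lambda> ^ n"
    using walks_le[OF \<Lambda>(1) walks] by auto
  show "pc_bond cay < pu_bond cay"
    unfolding pc_bond_def pu_bond_def infinite_clusters_bond
    by (rule cayley_percolation.nonuniqueness_gap[OF bond_model \<Lambda> growth K])
  show "pc_site cay < pu_site cay"
    unfolding pc_site_def pu_site_def infinite_clusters_site
    by (rule cayley_percolation.nonuniqueness_gap[OF site_model \<Lambda> growth K])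
qed

end

section \<open>The reflection group\<close>

lemma carrier_H3_isometries:
  "f \<in> carrier H3_isometries \<longleftrightarrow> f \<in> Bij H3 \<and> (\<forall>x\<in>H3. \<forall>y\<in>H3. hdist (f x) (f y) = hdist x y)"
  by (simp add: H3_isometries_def)

lemma mult_H3_isometries:
  assumes "f \<in> carrier H3_isometries" "g \<in> carrier H3_isometries"
  shows "f \<otimes>\<^bsub>H3_isometries\<^esub> g = compose H3 f g"
  using assms by (simp add: H3_isometries_def BijGroup_def)

lemma group_H3_isometries: "group H3_isometries"
proof -
  let ?B = "BijGroup H3" and ?I = "carrier H3_isometries"
  interpret B: group ?B by (rule group_BijGroup)
  have "subgroup ?I ?B"
  proof (rule B.subgroupI)
    show "?I \<subseteq> carrier ?B" by (auto simp: carrier_H3_isometries BijGroup_def)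
    have "(\<lambda>x\<in>H3. x) \<in> ?I"
      by (auto simp: carrier_H3_isometries Bij_def bij_betw_def inj_on_def)
    then show "?I \<noteq> {}" by blast
    fix f assume f: "f \<in> ?I"
    then have fB: "f \<in> Bij H3" by (simp add: carrier_H3_isometries)
    then have bij: "bij_betw f H3 H3" by (simp add: Bij_def)
    have inv: "inv\<^bsub>?B\<^esub> f = (\<lambda>x\<in>H3. inv_into H3 f x)" by (rule inv_BijGroup[OF fB])
    show "inv\<^bsub>?B\<^esub> f \<in> ?I"
      unfolding carrier_H3_isometries
    proof (intro conjI ballI)
      have "carrier ?B = Bij H3" by (simp add: BijGroup_def)
      then show "inv\<^bsub>?B\<^esub> f \<in> Bij H3" using B.inv_closed[of f] fB by blast
      fix x y assume xy: "x \<in> H3" "y \<in> H3"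
      have "f (inv_into H3 f x) = x" "f (inv_into H3 f y) = y" "inv_into H3 f x \<in> H3" "inv_into H3 f y \<in> H3"
        using bij xy by (auto simp: bij_betw_def f_inv_into_f intro: inv_into_into)
      then show "hdist ((inv\<^bsub>?B\<^esub> f) x) ((inv\<^bsub>?B\<^esub> f) y) = hdist x y"
        using f xy unfolding inv by (simp add: carrier_H3_isometries) metis
    qed
    fix g assume g: "g \<in> ?I"
    then have gB: "g \<in> Bij H3" by (simp add: carrier_H3_isometries)
    have "g x \<in> H3" if "x \<in> H3" for x using gB that by (auto simp: Bij_def bij_betw_def)
    then have "compose H3 f g \<in> ?I"
      using f g compose_Bij[OF fB gB] by (auto simp: carrier_H3_isometries compose_def)
    then show "f \<otimes>\<^bsub>?B\<^esub> g \<in> ?I" using fB gB by (simp add: BijGroup_def)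
  qed
  then have "group (?B\<lparr>carrier := ?I\<rparr>)" by (rule B.subgroup_imp_group)
  then show ?thesis by (simp add: H3_isometries_def)
qed

lemma lorentz_reflect:
  assumes "lorentz u u = 1"
  shows "lorentz (x - (2 * lorentz x u) *\<^sub>R u) (y - (2 * lorentz y u) *\<^sub>R u) = lorentz x y"
  using assms lorentz_commute[of u y] by (simp add: lorentz_expand)

lemma hreflection_apply: "x \<in> H3 \<Longrightarrow> hreflection u x = x - (2 * lorentz x u) *\<^sub>R u"
  by (simp add: hreflection_def)

lemma hreflection_H3:
  assumes u: "lorentz u u = 1" and x: "x \<in> H3"
  shows "hreflection u x \<in> H3"
proof -
  have xx: "lorentz x x = -1" "x \<in> future" using x H3_subset_future by (auto simp: H3_def)
  let ?y = "x - (2 * lorentz x u) *\<^sub>R u"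
  have yy: "lorentz ?y ?y = -1" using lorentz_reflect[OF u, of x x] xx by simp
  have "lorentz x ?y = -1 - 2 * (lorentz x u)\<^sup>2"
    using xx by (simp add: lorentz_expand power2_eq_square)
  also have "\<dots> < 0" using zero_le_power2[of "lorentz x u"] by linarith
  finally have "?y \<in> future" using future_if_timelike[OF xx(2), of ?y] yy by simp
  then show ?thesis using yy x by (simp add: hreflection_apply H3_def future_def)
qed

lemma hreflection_involution:
  assumes u: "lorentz u u = 1" and x: "x \<in> H3"
  shows "hreflection u (hreflection u x) = x"
  using hreflection_H3[OF u x] x u
  by (simp add: hreflection_apply lorentz_expand algebra_simps flip: scaleR_add_left)

lemma hreflection_isometry:
  assumes u: "lorentz u u = 1"
  shows "hreflection u \<in> carrier H3_isometries"
  unfolding carrier_H3_isometries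
proof (intro conjI ballI)
  have "bij_betw (hreflection u) H3 H3"
    using hreflection_H3[OF u] hreflection_involution[OF u]
    by (intro bij_betwI[where g = "hreflection u"]) auto
  then show "hreflection u \<in> Bij H3" by (simp add: Bij_def hreflection_def)
  fix x y assume "x \<in> H3" "y \<in> H3"
  then show "hdist (hreflection u x) (hreflection u y) = hdist x y"
    by (simp add: hdist_def hreflection_apply lorentz_reflect[OF u])
qed

lemma hreflection_square:
  assumes u: "lorentz u u = 1"
  shows "hreflection u \<otimes>\<^bsub>H3_isometries\<^esub> hreflection u = \<one>\<^bsub>H3_isometries\<^esub>"
proof -
  have "\<one>\<^bsub>H3_isometries\<^esub> = (\<lambda>x\<in>H3. x)" by (simp add: H3_isometries_def BijGroup_def)
  moreover have "compose H3 (hreflection u) (hreflection u) = (\<lambda>x\<in>H3. x)"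
    using hreflection_involution[OF u] by (auto simp: compose_def)
  ultimately show ?thesis using hreflection_isometry[OF u] by (simp add: mult_H3_isometries)
qed

lemma hreflection_commute:
  assumes "lorentz u u = 1" "lorentz v v = 1" "lorentz u v = 0"
  shows "hreflection u \<otimes>\<^bsub>H3_isometries\<^esub> hreflection v = hreflection v \<otimes>\<^bsub>H3_isometries\<^esub> hreflection u"
proof -
  have "hreflection u (hreflection v x) = hreflection v (hreflection u x)" if "x \<in> H3" for x
    using that assms hreflection_H3[of u x] hreflection_H3[of v x] lorentz_commute[of v u]
    by (simp add: hreflection_apply lorentz_expand)
  then have "compose H3 (hreflection u) (hreflection v) = compose H3 (hreflection v) (hreflection u)"
    by (auto simp: compose_def)
  then show ?thesis using hreflection_isometry assms by (simp add: mult_H3_isometries)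
qed

context compact_right_angled_polyhedron
begin

abbreviation G :: "(minkowski \<Rightarrow> minkowski) monoid" where
  "G \<equiv> reflection_group P"

lemma face_reflections_isometries: "face_reflections P \<subseteq> carrier H3_isometries"
  using hreflection_isometry normal_unit by (auto simp: face_reflections_def)

lemma G_simps: "carrier G = generate H3_isometries (face_reflections P)"
  "x \<otimes>\<^bsub>G\<^esub> y = x \<otimes>\<^bsub>H3_isometries\<^esub> y" "\<one>\<^bsub>G\<^esub> = \<one>\<^bsub>H3_isometries\<^esub>"
  by (simp_all add: reflection_group_def)

lemma G_subset: "carrier G \<subseteq> carrier H3_isometries"
  unfolding G_simps using group.generate_incl[OF group_H3_isometries face_reflections_isometries] .

lemma group_G: "group G"
  using group.generate_is_subgroup[OF group_H3_isometries face_reflections_isometries]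
    group.subgroup_imp_group[OF group_H3_isometries] by (simp add: reflection_group_def)

lemma hreflection_G: "u \<in> N \<Longrightarrow> hreflection u \<in> carrier G"
  unfolding G_simps by (rule generate.incl) (simp add: face_reflections_def)

lemma involution_generated: "involution_generated_group G N hreflection"
proof -
  interpret group G by (rule group_G)
  show ?thesis
  proof (unfold_locales)
    show "finite N" by (rule finite_normals)
    show "hreflection u \<in> carrier G" if "u \<in> N" for u by (rule hreflection_G[OF that])
    show "hreflection u \<otimes>\<^bsub>G\<^esub> hreflection u = \<one>\<^bsub>G\<^esub>" if "u \<in> N" for u
      using hreflection_square[OF normal_unit[OF that]] by (simp add: G_simps)
    let ?f = "\<lambda>ws. foldr (\<lambda>u h. hreflection u \<otimes>\<^bsub>G\<^esub> h) ws \<one>\<^bsub>G\<^esub>"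
    have f_closed: "?f ws \<in> carrier G" if "set ws \<subseteq> N" for ws
      using that by (induction ws) (auto intro: hreflection_G)
    have f_append: "?f (ws @ vs) = ?f ws \<otimes>\<^bsub>G\<^esub> ?f vs" if "set ws \<subseteq> N" "set vs \<subseteq> N" for ws vs
      using that(1)
    proof (induction ws)
      case Nil
      then show ?case using f_closed[OF that(2)] by simp
    next
      case (Cons u ws)
      then show ?case using hreflection_G[of u] f_closed[of ws] f_closed[OF that(2)] by (simp add: m_assoc)
    qed
    fix g assume "g \<in> carrier G"
    then have "g \<in> generate H3_isometries (face_reflections P)" by (simp add: G_simps)
    then show "\<exists>ws. set ws \<subseteq> N \<and> g = ?f ws"
    proof induction
      case one
      then show ?case by (intro exI[of _ "[]"]) (simp add: G_simps)
    next
      case (incl h)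
      then obtain u where u: "u \<in> N" "h = hreflection u" by (auto simp: face_reflections_def)
      then show ?case using hreflection_G[OF u(1)] by (intro exI[of _ "[u]"]) simp
    next
      case (inv h)
      then obtain u where u: "u \<in> N" "h = hreflection u" by (auto simp: face_reflections_def)
      then have "inv\<^bsub>H3_isometries\<^esub> h = h"
        using group.inv_equality[OF group_H3_isometries hreflection_square] normal_unit hreflection_isometry
        by simp
      then show ?case using u hreflection_G[OF u(1)] by (intro exI[of _ "[u]"]) simp
    next
      case (eng h1 h2)
      then obtain ws vs where "set ws \<subseteq> N" "h1 = ?f ws" "set vs \<subseteq> N" "h2 = ?f vs" by blast
      then show ?case using f_append[of ws vs] by (intro exI[of _ "ws @ vs"]) (simp add: G_simps)
    qed
  qed
qed

theorem percolation_gap: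
  assumes k: "card N \<ge> 18"
  shows "pc_bond (cayley_graph G (face_reflections P)) < pu_bond (cayley_graph G (face_reflections P))"
    "pc_site (cayley_graph G (face_reflections P)) < pu_site (cayley_graph G (face_reflections P))"
proof -
  obtain x0 where x0: "x0 \<in> H3" "\<And>u. u \<in> N \<Longrightarrow> lorentz x0 u < 0"
    by (rule interior_point) (rule that; assumption)
  interpret involution_generated_group G N hreflection by (rule involution_generated)
  have apply_mult: "(f \<otimes>\<^bsub>G\<^esub> g) x0 = f (g x0)" if "f \<in> carrier G" "g \<in> carrier G" for f g
    using that G_subset x0(1) by (simp add: G_simps mult_H3_isometries subset_iff compose_def)
  have G_H3: "g x0 \<in> H3" if "g \<in> carrier G" for g
    using that G_subset x0(1) by (auto simp: carrier_H3_isometries Bij_def bij_betw_def subset_iff)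
  \<comment> \<open>The base point is interior, so its products with the normals are negative.
    Inversion turns right multiplication by a generator into a reflection of the translated base
    point, which gives the rule for \<open>y\<close>.\<close>
  interpret right_angled_reflections G N hreflection lorentz "\<lambda>g u. lorentz ((inv\<^bsub>G\<^esub> g) x0) u"
  proof (unfold_locales)
    fix u v assume u: "u \<in> N" and v: "v \<in> N"
    show "lorentz u u = 1" using u by (rule normal_unit)
    show "lorentz u v = lorentz v u" by (rule lorentz_commute)
    show "u \<noteq> v \<Longrightarrow> lorentz u v = 0 \<or> lorentz u v \<le> -1" by (rule normals_gram[OF u v])
    show "lorentz u v = 0 \<Longrightarrow> hreflection u \<otimes>\<^bsub>G\<^esub> hreflection v = hreflection v \<otimes>\<^bsub>G\<^esub> hreflection u"
      using hreflection_commute[OF normal_unit[OF u] normal_unit[OF v]] by (simp add: G_simps)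
    have "\<one>\<^bsub>G\<^esub> x0 = x0" using x0(1) by (simp add: G_simps H3_isometries_def BijGroup_def)
    then show "lorentz ((inv\<^bsub>G\<^esub> \<one>\<^bsub>G\<^esub>) x0) u < 0" using x0(2)[OF u] by simp
    fix g assume g: "g \<in> carrier G"
    have "inv\<^bsub>G\<^esub> (g \<otimes>\<^bsub>G\<^esub> hreflection v) = hreflection v \<otimes>\<^bsub>G\<^esub> inv\<^bsub>G\<^esub> g"
      using g v r_closed by (simp add: inv_mult_group r_inv)
    then have "(inv\<^bsub>G\<^esub> (g \<otimes>\<^bsub>G\<^esub> hreflection v)) x0 = hreflection v ((inv\<^bsub>G\<^esub> g) x0)"
      using g v r_closed by (simp add: apply_mult)
    then show "lorentz ((inv\<^bsub>G\<^esub> (g \<otimes>\<^bsub>G\<^esub> hreflection v)) x0) u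
        = lorentz ((inv\<^bsub>G\<^esub> g) x0) u - 2 * lorentz u v * lorentz ((inv\<^bsub>G\<^esub> g) x0) v"
      using hreflection_apply[OF G_H3, of "inv\<^bsub>G\<^esub> g" v] g lorentz_commute[of v u]
      by (simp add: lorentz_expand)
  next
    fix X assume "X \<subseteq> N" "pairwise (\<lambda>u v. lorentz u v = 0) X"
    then show "card X \<le> 3" using normal_unit by (intro card_orthonormal_spacelike) auto
  qed
  have cl: "cliques j = orth_cliques j" for j by (simp add: cliques_def orth_cliques_def)
  let ?k = "real (card N)"
  have growth: "3 * ?k / 4 * real (card (sphere n)) \<le> real (card (sphere (Suc n)))" for n
    using sphere_growth[OF k] edge_vertex_count vertex_count k by (simp add: cl)
  have k18: "?k \<ge> 18" using k by simp
  define \<Lambda> where "\<Lambda> = 2 * sqrt (3 * (?k - 3))"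
  have "\<Lambda> < 3 * ?k / 4"
  proof -
    \<comment> \<open>This is 16/9 times (3 k / 4)^2 - 12 (k - 3), the difference between the
      squares of the growth ratio and of \<Lambda>.\<close>
    have "0 < (?k - 18) * (?k - 10 / 3) + 4" using k18 by (intro add_nonneg_pos mult_nonneg_nonneg) auto
    also have "\<dots> = 16 / 9 * ((3 * ?k / 8)\<^sup>2 * 4 - 12 * (?k - 3))" by (simp add: power2_eq_square field_simps)
    finally have "3 * (?k - 3) < (3 * ?k / 8)\<^sup>2" by simp
    then have "sqrt (3 * (?k - 3)) < 3 * ?k / 8" using k18 by (intro real_less_lsqrt) auto
    then show ?thesis by (simp add: \<Lambda>_def)
  qed
  moreover have "1 \<le> \<Lambda>"
  proof -
    have "1 \<le> sqrt (3 * (?k - 3))" using k18 by (intro real_le_rsqrt) simp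
    then show ?thesis unfolding \<Lambda>_def by linarith
  qed
  moreover have "real (walks n \<one>\<^bsub>G\<^esub>) \<le> \<Lambda> ^ n" for n
    using walks_one_le[of n] k by (simp add: \<Lambda>_def)
  ultimately show "pc_bond (cayley_graph G (face_reflections P)) < pu_bond (cayley_graph G (face_reflections P))"
    "pc_site (cayley_graph G (face_reflections P)) < pu_site (cayley_graph G (face_reflections P))"
    using cayley_graph_gap[of \<Lambda> "3 * ?k / 4"] growth unfolding face_reflections_def by auto
qed

end

theorem theorem2p1p4:
  fixes P :: "minkowski set" and \<Gamma> :: "(minkowski \<Rightarrow> minkowski) ugraph"
  assumes "convex_polyhedron P" and "compact P" and "right_angled P"
    and "card (faces P) \<ge> 18"
    and "\<Gamma> = cayley_graph (reflection_group P) (face_reflections P)"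
  shows "pc_bond \<Gamma> < pu_bond \<Gamma> \<and> pc_site \<Gamma> < pu_site \<Gamma>"
proof -
  interpret compact_right_angled_polyhedron P
    using assms by unfold_locales
  have "faces P = (\<lambda>u. P \<inter> hplane u) ` face_normals P" by (auto simp: faces_def)
  then have "card (faces P) \<le> card (face_normals P)"     using card_image_le[OF finite_normals, of "\<lambda>u. P \<inter> hplane u"] by simp
  then show ?thesis using percolation_gap assms by simp
qed

end
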